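(* Let $K$ be a field and let $G$ be a Cohen-Macaulay bipartite graph on $V_n$, $n\ge1$. Then the following assertions hold: (i) $G$ comes from a chain if and only if $H_{A(G)}(z)=\dfrac{(1+z)^n}{(1-z)^{2n+1}}$; (ii) $G$ comes from an antichain if and only if $H_{A(G)}(z)=\dfrac{h''_nz^n+h''_{n-1}z^{n-1}+\cdots+h''_1z+h''_0}{(1-z)^{2n+1}}$, where $h''=(h''_0,h''_1,\dots,h''_n)$ is the $h$-vector of the vertex cover algebra $A(G'')$ of the bipartite graph $G''$ that comes from an antichain $P''_n=\{p''_1,\dots,p''_n\}$ with $n$ elements.
   Context: $V_n=W\cup W'$ with $W=\{x_1,\dots,x_n\}$, $W'=\{y_1,\dots,y_n\}$; a bipartite graph on $V_n$ has bipartition $W,W'$. For a poset $P_n=\{p_1,\dots,p_n\}$, $G(P_n)$ is the bipartite graph on $V_n$ whose edges are all $\{x_i,y_j\}$ with $p_i\le p_j$. A bipartite graph $G$ on $V_n$ comes from a poset if there is a poset $P_n=\{p_1,\dots,p_n\}$ with $p_i\le p_j\Rightarrow i\le j$ such that, after relabelling the vertices, $G=G(P_n)$; it comes from a chain (antichain) if $P_n$ can be taken to be a chain (antichain). A graph is Cohen-Macaulay if the quotient of the polynomial ring over $K$ in its vertices by its edge ideal is Cohen-Macaulay; graphs are assumed to have no isolated vertices, and then by a theorem of Herzog and Hibi a bipartite graph on $V_n$ is Cohen-Macaulay if and only if it comes from a poset. Let $S=K[x_1,\dots,x_n,y_1,\dots,y_n]$. A $k$-vertex cover of $G$ ($k\in\mathbb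 N$, $0\in\mathbb N$) is a vector $c\in\mathbb N^{2n}$, indexed by the vertices, with $c(v)+c(w)\ge k$ for every edge $\{v,w\}$. The vertex cover algebra $A(G)$ is the subalgebra of $S[t]$ generated over $K$ by all monomials $x_1^{c_1}\cdots x_n^{c_n}y_1^{c_{n+1}}\cdots y_n^{c_{2n}}t^k$ with $c$ a $k$-vertex cover, $k\in\mathbb N$. It is known that $A(G)=\bigoplus_{k\ge0}I_G^kt^k$, where the cover ideal $I_G\subset S$ is minimally generated by the monomials $m_C=\prod_{v\in C}v$, $C$ a minimal vertex cover of $G$, and each such $C$ has exactly $n$ elements. $A(G)$ is a standard graded $K$-algebra by giving degree $1$ to each $x_i$, each $y_j$ and each $m_Ct$; $H_{A(G)}(z)$ is its Hilbert series. Its Krull dimension is $2n+1$, and its $h$-vector is the coefficient sequence of the polynomial $h(z)$ with $H_{A(G)}(z)=h(z)/(1-z)^{2n+1}$. *)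

theory Defs
  imports
    "HOL-Algebra.QuotRing"
    "HOL-Algebra.Ring_Divisibility"
    "HOL-Library.Poly_Mapping"
    "HOL-Library.Extended_Nat"
    "HOL-Computational_Algebra.Polynomial"
    "HOL-Computational_Algebra.Formal_Power_Series"
    "HOL-Computational_Algebra.Polynomial_FPS"
begin

section \<open>Bipartite graphs and posets\<close>

datatype vertex = X nat | Y nat

definition Vn :: "nat \<Rightarrow> vertex set" where
  "Vn n = X ` {1..n} \<union> Y ` {1..n}"

text \<open>A graph on \<open>Vn n\<close> is given by its set of edges, each edge being a two-element set of
  vertices.\<close>

definition bipartite_graph :: "nat \<Rightarrow> vertex set set \<Rightarrow> bool" where
  "bipartite_graph n E \<longleftrightarrow> E \<subseteq> {{X i, Y j} |i j. i \<in> {1..n} \<and> j \<in> {1..n}}"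

definition no_isolated_vertices :: "nat \<Rightarrow> vertex set set \<Rightarrow> bool" where
  "no_isolated_vertices n E \<longleftrightarrow> (\<forall>v\<in>Vn n. \<exists>e\<in>E. v \<in> e)"

text \<open>A poset \<open>{p\<^sub>1, \<dots>, p\<^sub>n}\<close> is given by the relation \<open>r\<close> on the index set, where
  \<open>(i, j) \<in> r\<close> means \<open>p\<^sub>i \<le> p\<^sub>j\<close>.\<close>

definition naturally_labelled_poset :: "nat \<Rightarrow> nat rel \<Rightarrow> bool" where
  "naturally_labelled_poset n r \<longleftrightarrow>
     partial_order_on {1..n} r \<and> (\<forall>i j. (i, j) \<in> r \<longrightarrow> i \<le> j)"

definition poset_graph :: "nat rel \<Rightarrow> vertex set set" where
  "poset_graph r = {{X i, Y j} |i j. (i, j) \<in> r}"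

definition equal_up_to_relabelling ::
    "nat \<Rightarrow> vertex set set \<Rightarrow> vertex set set \<Rightarrow> bool" where
  "equal_up_to_relabelling n E F \<longleftrightarrow>
     (\<exists>\<phi>. bij_betw \<phi> (Vn n) (Vn n) \<and> (\<lambda>e. \<phi> ` e) ` E = F)"

definition comes_from_chain :: "nat \<Rightarrow> vertex set set \<Rightarrow> bool" where
  "comes_from_chain n E \<longleftrightarrow>
     (\<exists>r. naturally_labelled_poset n r \<and> total_on {1..n} r \<and>
          equal_up_to_relabelling n E (poset_graph r))"

definition comes_from_antichain :: "nat \<Rightarrow> vertex set set \<Rightarrow> bool" where
  "comes_from_antichain n E \<longleftrightarrow>
     (\<exists>r. naturally_labelled_poset n r \<and> (\<forall>i j. (i, j) \<in> r \<longrightarrow> i = j) \<and>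
          equal_up_to_relabelling n E (poset_graph r))"

section \<open>Cohen-Macaulay rings\<close>

definition regular_sequence :: "('a, 'b) ring_scheme \<Rightarrow> 'a list \<Rightarrow> bool" where
  "regular_sequence R xs \<longleftrightarrow>
     set xs \<subseteq> carrier R \<and>
     (\<forall>i<length xs. \<forall>a\<in>carrier R.
        xs ! i \<otimes>\<^bsub>R\<^esub> a \<in> Idl\<^bsub>R\<^esub> (set (take i xs)) \<longrightarrow> a \<in> Idl\<^bsub>R\<^esub> (set (take i xs))) \<and>
     Idl\<^bsub>R\<^esub> (set xs) \<noteq> carrier R"

definition ideal_depth :: "('a, 'b) ring_scheme \<Rightarrow> 'a set \<Rightarrow> enat" where
  "ideal_depth R I = Sup {enat (length xs) |xs. regular_sequence R xs \<and> set xs \<subseteq> I}"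

definition prime_height :: "('a, 'b) ring_scheme \<Rightarrow> 'a set \<Rightarrow> enat" where
  "prime_height R Q = Sup {enat k |k. \<exists>p :: nat \<Rightarrow> 'a set.
     (\<forall>i\<le>k. primeideal (p i) R) \<and> (\<forall>i<k. p i \<subset> p (Suc i)) \<and> p k = Q}"

text \<open>This is the definition in Eisenbud's \<^emph>\<open>Commutative Algebra\<close> (Section 18.2). It agrees with
  the requirement that all localizations at maximal ideals \<open>M\<close> be Cohen-Macaulay local rings,
  since \<open>prime_height R M\<close> is the dimension of the localization at \<open>M\<close>, and
  \<open>ideal_depth R M\<close> is its depth.\<close>

definition cohen_macaulay_ring :: "('a, 'b) ring_scheme \<Rightarrow> bool" where
  "cohen_macaulay_ring R \<longleftrightarrow>
     cring R \<and> noetherian_ring R \<and>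
     (\<forall>M. maximalideal M R \<longrightarrow> ideal_depth R M = prime_height R M)"

section \<open>The polynomial ring and Cohen-Macaulay graphs\<close>

text \<open>Polynomials over \<open>'k\<close>: an exponent vector is a finitely supported function
  \<^typ>\<open>vertex \<Rightarrow>\<^sub>0 nat\<close>, a polynomial a finitely supported function from exponent vectors to
  coefficients. The type has variables for all vertices \<open>X i\<close>, \<open>Y j\<close> with \<open>i\<close>, \<open>j\<close> arbitrary
  naturals; \<open>S\<close> is the subring of polynomials in the \<open>2 n\<close> variables of \<open>Vn n\<close>.\<close>

type_synonym 'k vpoly = "(vertex \<Rightarrow>\<^sub>0 nat) \<Rightarrow>\<^sub>0 'k"

definition vmonomial :: "(vertex \<Rightarrow>\<^sub>0 nat) \<Rightarrow> 'k::field vpoly" where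
  "vmonomial c = Poly_Mapping.single c 1"

definition Var :: "vertex \<Rightarrow> 'k::field vpoly" where
  "Var v = vmonomial (Poly_Mapping.single v 1)"

definition poly_ring :: "nat \<Rightarrow> 'k::field vpoly ring" where
  "poly_ring n = \<lparr>carrier = {f. \<forall>c\<in>Poly_Mapping.keys f. Poly_Mapping.keys c \<subseteq> Vn n},
     monoid.mult = (*), one = 1, zero = 0, add = (+)\<rparr>"

definition edge_ideal :: "nat \<Rightarrow> vertex set set \<Rightarrow> 'k::field vpoly set" where
  "edge_ideal n E = Idl\<^bsub>poly_ring n\<^esub> {Var v * Var w |v w. {v, w} \<in> E}"

definition cohen_macaulay_graph :: "'k::field itself \<Rightarrow> nat \<Rightarrow> vertex set set \<Rightarrow> bool" where
  "cohen_macaulay_graph _ n E \<longleftrightarrow>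
     cohen_macaulay_ring ((poly_ring n :: 'k vpoly ring) Quot edge_ideal n E)"

section \<open>The vertex cover algebra\<close>

definition k_vertex_cover :: "nat \<Rightarrow> vertex set set \<Rightarrow> nat \<Rightarrow> (vertex \<Rightarrow>\<^sub>0 nat) \<Rightarrow> bool" where
  "k_vertex_cover n E k c \<longleftrightarrow>
     Poly_Mapping.keys c \<subseteq> Vn n \<and>
     (\<forall>v w. {v, w} \<in> E \<longrightarrow> Poly_Mapping.lookup c v + Poly_Mapping.lookup c w \<ge> k)"

definition vertex_cover :: "nat \<Rightarrow> vertex set set \<Rightarrow> vertex set \<Rightarrow> bool" where
  "vertex_cover n E C \<longleftrightarrow> C \<subseteq> Vn n \<and> (\<forall>e\<in>E. e \<inter> C \<noteq> {})"

definition minimal_vertex_cover :: "nat \<Rightarrow> vertex set set \<Rightarrow> vertex set \<Rightarrow> bool" where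
  "minimal_vertex_cover n E C \<longleftrightarrow> vertex_cover n E C \<and> (\<forall>D. D \<subset> C \<longrightarrow> \<not> vertex_cover n E D)"

text \<open>\<open>S[t]\<close> consists of univariate polynomials, in \<open>t\<close>, over \<open>S\<close>; it is a \<open>K\<close>-vector space.\<close>

definition Kscale :: "'k::field \<Rightarrow> 'k vpoly poly \<Rightarrow> 'k vpoly poly" where
  "Kscale a f = smult (Poly_Mapping.single 0 a) f"

global_interpretation K: vector_space Kscale
  by standard
    (simp_all add: Kscale_def smult_add_right single_add smult_add_left mult_single)

inductive_set generated_subalgebra :: "'k::field vpoly poly set \<Rightarrow> 'k vpoly poly set"
  for B where
  const: "Kscale a 1 \<in> generated_subalgebra B"
| gen: "f \<in> B \<Longrightarrow> f \<in> generated_subalgebra B"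
| add: "f \<in> generated_subalgebra B \<Longrightarrow> g \<in> generated_subalgebra B \<Longrightarrow>
    f + g \<in> generated_subalgebra B"
| mult: "f \<in> generated_subalgebra B \<Longrightarrow> g \<in> generated_subalgebra B \<Longrightarrow>
    f * g \<in> generated_subalgebra B"

definition vertex_cover_algebra :: "nat \<Rightarrow> vertex set set \<Rightarrow> 'k::field vpoly poly set" where
  "vertex_cover_algebra n E =
     generated_subalgebra {Polynomial.monom (vmonomial c) k |c k. k_vertex_cover n E k c}"

definition degree_one_generators :: "nat \<Rightarrow> vertex set set \<Rightarrow> 'k::field vpoly poly set" where
  "degree_one_generators n E =
     {[:Var v:] |v. v \<in> Vn n} \<union>
     {Polynomial.monom (\<Prod>v\<in>C. Var v) 1 |C. minimal_vertex_cover n E C}"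

text \<open>The component of degree \<open>d\<close> of the standard grading: the elements of \<open>A(G)\<close> that are
  \<open>K\<close>-linear combinations of products of \<open>d\<close> degree-one generators.\<close>

definition vca_component :: "nat \<Rightarrow> vertex set set \<Rightarrow> nat \<Rightarrow> 'k::field vpoly poly set" where
  "vca_component n E d =
     {f \<in> vertex_cover_algebra n E.
        f \<in> K.span {prod_list gs |gs. length gs = d \<and> set gs \<subseteq> degree_one_generators n E}}"

definition vca_hilbert_series :: "'k::field itself \<Rightarrow> nat \<Rightarrow> vertex set set \<Rightarrow> rat fps" where
  "vca_hilbert_series _ n E =
     Abs_fps (\<lambda>d. of_nat (K.dim (vca_component n E d :: 'k vpoly poly set)))"

text \<open>The exponent \<open>2 n + 1\<close> is the Krull dimension of \<open>A(G)\<close>. The polynomial is unique if it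
  exists, because \<open>1 - z\<close> is a unit in the power series ring.\<close>

definition vca_h_vector :: "'k::field itself \<Rightarrow> nat \<Rightarrow> vertex set set \<Rightarrow> nat \<Rightarrow> rat" where
  "vca_h_vector K n E = Polynomial.coeff
     (THE h. vca_hilbert_series K n E = fps_of_poly h / (1 - fps_X) ^ (2 * n + 1))"

end

theory Submission
  imports Defs "HOL-Library.Product_Plus"
begin

text \<open>The component of degree \<open>d\<close> of \<open>A(G)\<close> has as basis the monomials that are
  products of \<open>d\<close> generators. For \<open>d = 1\<close> this gives \<open>2 n\<close> plus the number
  of minimal vertex covers, that is, of facets of the independence complex. Conversely, \<open>2 ^ n\<close> facets
  force every \<open>x\<^sub>i\<close> to have a neighbour of degree one, so that \<open>G\<close> is a perfect
  matching. For chains, Cohen-Macaulayness is needed (the disjoint union of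
  \<open>K\<^sub>1\<^sub>,\<^sub>1\<close> and \<open>K\<^sub>2\<^sub>,\<^sub>2\<close> has the same Hilbert series
  as the chain with three elements), but the theorem of Herzog and Hibi is not: it suffices that no link of
  dimension at least one in the independence complex is disconnected. Such a link is the disjoint union of two
  simplices, and at the maximal ideal of the point with coordinates \<open>1\<close> on the face and
  \<open>0\<close> elsewhere an explicit maximal regular sequence is shorter than an explicit chain of primes; by
  Kaplansky's exchange argument, all maximal regular sequences in a maximal ideal have the same length. Hence the
  facets \<open>W\<close> and \<open>W'\<close> are joined by a path of adjacent facets, and if there are only
  \<open>n + 1\<close> facets, then this path is unique and exhibits \<open>G\<close> as coming from a chain.

  The Hilbert series are computed from the description of the \<open>k\<close>-vertex covers by pairs of functions
  on the poset: in the chain case they are built up one poset element at a time, in the antichain case the factors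
  are independent for fixed \<open>k\<close>.\<close>

section \<open>Regular sequences and associated maximal ideals\<close>

text \<open>The Cohen-Macaulay hypothesis speaks of the quotient ring itself, so the link of a face
  \<open>A\<close> has to be reached without inverting variables. The point with coordinate 1 on
  \<open>A\<close> does this: the elements \<open>Var a - 1\<close> lie in its maximal ideal, they
  form a regular sequence because the edge ideal is homogeneous in each single variable, and setting
  the variables of \<open>A\<close> to 1 forces those of their neighbours to 0, which leaves the
  Stanley-Reisner ring of the link. For two disjoint simplices on \<open>B\<close> and
  \<open>C\<close>, that ring has a socle after one further regular element. So the depth at the
  point is \<open>card A + 1\<close>, while the face \<open>A \<union> B\<close> yields a chain of
  primes with \<open>card A + card B\<close> strict inclusions. Hence \<open>card B \<le> 1\<close>,
  and a disconnected link can only consist of two points. The ring theory is done with subsets of a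
  commutative ring type because the type of polynomials has variables for all indices, of which only
  those in \<open>Vn n\<close> belong to the ring in question.\<close>

locale comm_subring =
  fixes S :: "'a::comm_ring_1 set"
  assumes one_in [simp]: "1 \<in> S"
    and diff_in [simp]: "\<lbrakk>a \<in> S; b \<in> S\<rbrakk> \<Longrightarrow> a - b \<in> S"
    and mult_in [simp]: "\<lbrakk>a \<in> S; b \<in> S\<rbrakk> \<Longrightarrow> a * b \<in> S"
begin

lemma zero_in [simp]: "0 \<in> S"
  using diff_in[of 1 1] by simp

lemma uminus_in [simp]: "a \<in> S \<Longrightarrow> - a \<in> S"
  using diff_in[of 0 a] by simp

lemma add_in [simp]: "\<lbrakk>a \<in> S; b \<in> S\<rbrakk> \<Longrightarrow> a + b \<in> S"
  using diff_in[of a "- b"] by simp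

text \<open>Ideals of the subring \<open>S\<close>, not of the ambient type: only multiples by
  elements of \<open>S\<close> are required. As \<open>J\<close> is a plain set, sums and products
  are those of the type.\<close>

definition sub_ideal :: "'a set \<Rightarrow> bool" where
  "sub_ideal J \<longleftrightarrow> J \<subseteq> S \<and> 0 \<in> J \<and> (\<forall>a\<in>J. \<forall>b\<in>J. a + b \<in> J) \<and> (\<forall>s\<in>S. \<forall>a\<in>J. s * a \<in> J)"

lemma sub_idealI:
  assumes "J \<subseteq> S" "0 \<in> J" "\<And>a b. \<lbrakk>a \<in> J; b \<in> J\<rbrakk> \<Longrightarrow> a + b \<in> J"
    and "\<And>s a. \<lbrakk>s \<in> S; a \<in> J\<rbrakk> \<Longrightarrow> s * a \<in> J"
  shows "sub_ideal J"
  using assms unfolding sub_ideal_def by blast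

lemma sub_idealD:
  assumes "sub_ideal J"
  shows "a \<in> J \<Longrightarrow> a \<in> S" "0 \<in> J" "\<lbrakk>a \<in> J; b \<in> J\<rbrakk> \<Longrightarrow> a + b \<in> J"
    and "\<lbrakk>s \<in> S; a \<in> J\<rbrakk> \<Longrightarrow> s * a \<in> J" "\<lbrakk>s \<in> S; a \<in> J\<rbrakk> \<Longrightarrow> a * s \<in> J"
  using assms unfolding sub_ideal_def by (blast, blast, blast, blast, metis mult.commute)

lemma sub_ideal_uminus: "\<lbrakk>sub_ideal J; a \<in> J\<rbrakk> \<Longrightarrow> - a \<in> J"
  using sub_idealD(4)[of J "-1" a] by simp

lemma sub_ideal_diff: "\<lbrakk>sub_ideal J; a \<in> J; b \<in> J\<rbrakk> \<Longrightarrow> a - b \<in> J"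
  using sub_idealD(3)[of J a "-b"] sub_ideal_uminus[of J b] by simp

lemma sub_ideal_sum:
  assumes "sub_ideal J" "\<And>i. i \<in> A \<Longrightarrow> f i \<in> J"
  shows "sum f A \<in> J"
  using assms(2) by (induction A rule: infinite_finite_induct)
    (auto simp: sub_idealD(2,3)[OF assms(1)])

text \<open>The ideal \<open>J + x S\<close>. Adjoining generators one at a time matches the
  recursion along a regular sequence and provides the normal forms \<open>j + x * r\<close> for the
  exchange arguments.\<close>

definition extend :: "'a set \<Rightarrow> 'a \<Rightarrow> 'a set" where
  "extend J x = {j + x * r |j r. j \<in> J \<and> r \<in> S}"

definition extends :: "'a set \<Rightarrow> 'a list \<Rightarrow> 'a set" where
  "extends J xs = foldl extend J xs"

lemma extends_simps [simp]:
  "extends J [] = J" "extends J (x # xs) = extends (extend J x) xs"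
  "extends J (xs @ ys) = extends (extends J xs) ys"
  by (simp_all add: extends_def)

lemma extendI: "\<lbrakk>j \<in> J; r \<in> S\<rbrakk> \<Longrightarrow> j + x * r \<in> extend J x"
  unfolding extend_def by blast

lemma extend_ideal:
  assumes "sub_ideal J" "x \<in> S"
  shows "sub_ideal (extend J x)"
proof (rule sub_idealI)
  show "extend J x \<subseteq> S"
  proof
    fix a assume "a \<in> extend J x"
    then obtain j r where "a = j + x * r" "j \<in> J" "r \<in> S" unfolding extend_def by blast
    then show "a \<in> S" using sub_idealD(1)[OF assms(1)] assms(2) by simp
  qed
  show "0 \<in> extend J x"
    using extendI[OF sub_idealD(2)[OF assms(1)] zero_in] by simp
  fix a b assume "a \<in> extend J x" "b \<in> extend J x"
  then obtain j r k s where "a = j + x * r" "b = k + x * s" "j \<in> J" "k \<in> J" "r \<in> S" "s \<in> S"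
    unfolding extend_def by blast
  then show "a + b \<in> extend J x"
    using extendI[of "j + k" J "r + s" x] sub_idealD(3)[OF assms(1)]
    by (simp add: algebra_simps)
next
  fix s a assume s: "s \<in> S" "a \<in> extend J x"
  then obtain j r where "a = j + x * r" "j \<in> J" "r \<in> S"
    unfolding extend_def by blast
  then show "s * a \<in> extend J x"
    using extendI[OF sub_idealD(4)[OF assms(1) s(1)] mult_in[OF s(1)], of j r x]
    by (simp add: distrib_left mult.left_commute)
qed

lemma extend_mono: "J \<subseteq> extend J x"
  using extendI[OF _ zero_in] by fastforce

lemma extend_self: "0 \<in> J \<Longrightarrow> x \<in> extend J x"
  using extendI[OF _ one_in, of 0 J x] by simp

lemma extend_least: "\<lbrakk>sub_ideal K; J \<subseteq> K; x \<in> K\<rbrakk> \<Longrightarrow> extend J x \<subseteq> K"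
  unfolding extend_def by (auto intro!: sub_idealD(3) sub_idealD(5))

lemma extends_ideal: "\<lbrakk>sub_ideal J; set xs \<subseteq> S\<rbrakk> \<Longrightarrow> sub_ideal (extends J xs)"
  by (induction xs arbitrary: J) (auto simp: extend_ideal)

lemma extends_mono: "J \<subseteq> extends J xs"
  by (induction xs arbitrary: J) (use extend_mono in fastforce)+

lemma extends_set: "\<lbrakk>sub_ideal J; set xs \<subseteq> S\<rbrakk> \<Longrightarrow> set xs \<subseteq> extends J xs"
proof (induction xs arbitrary: J)
  case (Cons x xs)
  then show ?case
    using extend_self[of J x] sub_idealD(2)[of J] extends_mono[of "extend J x" xs] extend_ideal
    by auto
qed simp

lemma extends_least: "\<lbrakk>sub_ideal K; J \<subseteq> K; set xs \<subseteq> K\<rbrakk> \<Longrightarrow> extends J xs \<subseteq> K"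
  by (induction xs arbitrary: J) (auto simp: extend_least)

lemma extend_commute: "extend (extend J x) y = extend (extend J y) x"
proof -
  have "extend (extend J x) y \<subseteq> extend (extend J y) x" for x y
  proof
    fix a assume "a \<in> extend (extend J x) y"
    then obtain j r s where "a = j + x * r + y * s" "j \<in> J" "r \<in> S" "s \<in> S"
      unfolding extend_def by blast
    then show "a \<in> extend (extend J y) x"
      using extendI[OF extendI[of j J s y], of r x] by (simp add: algebra_simps)
  qed
  then show ?thesis by blast
qed

lemma extends_extend: "extends (extend J x) xs = extend (extends J xs) x"
  by (induction xs arbitrary: J) (simp_all add: extend_commute)

section \<open>Regular sequences over an ideal\<close>

definition regular_on :: "'a set \<Rightarrow> 'a \<Rightarrow> bool" where
  "regular_on J x \<longleftrightarrow> (\<forall>a\<in>S. x * a \<in> J \<longrightarrow> a \<in> J)"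

lemma regular_onD: "\<lbrakk>regular_on J x; a \<in> S; x * a \<in> J\<rbrakk> \<Longrightarrow> a \<in> J"
  unfolding regular_on_def by blast

fun regular_seq :: "'a set \<Rightarrow> 'a list \<Rightarrow> bool" where
  "regular_seq J [] \<longleftrightarrow> True"
| "regular_seq J (x # xs) \<longleftrightarrow> x \<in> S \<and> regular_on J x \<and> regular_seq (extend J x) xs"

lemma regular_seq_append:
  "regular_seq J (xs @ ys) \<longleftrightarrow> regular_seq J xs \<and> regular_seq (extends J xs) ys"
  by (induction xs arbitrary: J) auto

lemma regular_seq_iff:
  "regular_seq J xs \<longleftrightarrow> set xs \<subseteq> S \<and> (\<forall>i<length xs. regular_on (extends J (take i xs)) (xs ! i))"
proof (induction xs arbitrary: J)
  case (Cons x xs)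
  show ?case
    unfolding regular_seq.simps Cons.IH by (auto simp: less_Suc_eq_0_disj)
qed simp

definition associated :: "'a set \<Rightarrow> 'a set \<Rightarrow> bool" where
  "associated M J \<longleftrightarrow> (\<exists>a\<in>S - J. \<forall>m\<in>M. m * a \<in> J)"

lemma not_associated_if_regular: "\<lbrakk>x \<in> M; regular_on J x\<rbrakk> \<Longrightarrow> \<not> associated M J"
  unfolding associated_def regular_on_def by blast

text \<open>From \<open>h * b = j + x * c\<close>, regularity of \<open>x\<close> over
  \<open>extend J h\<close> gives \<open>c = k + h * d\<close>, whence
  \<open>h * (b - x * d)\<close> lies in \<open>J\<close> and \<open>h\<close> can be cancelled.
  This half of the permutability of regular sequences holds in every commutative ring.\<close>

lemma regular_on_extend_swap:
  assumes J: "sub_ideal J" and S: "x \<in> S" "h \<in> S"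
    and h: "regular_on J h" and x: "regular_on (extend J h) x"
  shows "regular_on (extend J x) h"
  unfolding regular_on_def
proof (intro ballI impI)
  fix b assume b: "b \<in> S" "h * b \<in> extend J x"
  then obtain j c where jc: "h * b = j + x * c" "j \<in> J" "c \<in> S"
    unfolding extend_def by blast
  have "x * c = - j + h * b" using jc by simp
  then have "x * c \<in> extend J h"
    using extendI[of "-j" J b h] sub_ideal_uminus[OF J] jc b by simp
  then have "c \<in> extend J h" using x jc regular_onD by blast
  then obtain k d where kd: "c = k + h * d" "k \<in> J" "d \<in> S"
    unfolding extend_def by blast
  have "h * (b - x * d) = j + x * k" using jc kd by (simp add: algebra_simps)
  then have "h * (b - x * d) \<in> J"
    using sub_idealD(3,4)[OF J] jc kd S by simp
  then have "b - x * d \<in> J" using h S b kd regular_onD by simp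
  then show "b \<in> extend J x" using extendI[of "b - x * d" J d x] kd by simp
qed

fun prefix_ideals :: "'a set \<Rightarrow> 'a list \<Rightarrow> 'a set set" where
  "prefix_ideals J [] = {J}"
| "prefix_ideals J (x # xs) = insert J (prefix_ideals (extend J x) xs)"

lemma finite_prefix_ideals [simp]: "finite (prefix_ideals J xs)"
  by (induction xs arbitrary: J) auto

lemma prefix_ideals_extends: "extends J xs \<in> prefix_ideals J xs"
  by (induction xs arbitrary: J) auto

lemma prefix_ideals_ideal:
  "\<lbrakk>K \<in> prefix_ideals J xs; sub_ideal J; set xs \<subseteq> S\<rbrakk> \<Longrightarrow> sub_ideal K \<and> J \<subseteq> K"
proof (induction xs arbitrary: J)
  case (Cons x xs)
  then show ?case using extend_mono[of J x] extend_ideal[of J x] by fastforce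
qed simp

text \<open>The prefixes stop before the last entry \<open>p\<close>, so each of their ideals is
  followed by an element of \<open>M\<close> that is regular over it.\<close>

lemma prefix_ideals_not_associated:
  "\<lbrakk>K \<in> prefix_ideals J xs; regular_seq J (xs @ [p]); set xs \<subseteq> M; p \<in> M\<rbrakk> \<Longrightarrow> \<not> associated M K"
  by (induction xs arbitrary: J) (auto dest: not_associated_if_regular)

lemma prefix_ideals_mem: "J \<in> prefix_ideals J xs"
  by (cases xs) auto

text \<open>Each entry of \<open>xs\<close> is moved past \<open>z\<close> by the swap lemma, which
  uses the regularity of \<open>z\<close> over the ideal of the next longer prefix.\<close>

lemma regular_seq_extend:
  "\<lbrakk>regular_seq J xs; sub_ideal J; z \<in> S; \<forall>K\<in>prefix_ideals J xs. regular_on K z\<rbrakk>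
    \<Longrightarrow> regular_seq (extend J z) xs"
proof (induction xs arbitrary: J)
  case (Cons x xs)
  have "regular_on (extend J x) z" using Cons.prems(4) prefix_ideals_mem[of "extend J x" xs] by auto
  then have "regular_on (extend J z) x" using Cons.prems regular_on_extend_swap by auto
  moreover have "regular_seq (extend (extend J x) z) xs"
    using Cons extend_ideal by auto
  ultimately show ?case using Cons.prems extend_commute by auto
qed simp

text \<open>For an ideal \<open>M\<close> this is the element form of the fact that Hom(S/M, S/(J,
  x)) and Hom(S/M, S/(J, y)) are both isomorphic to Ext^1(S/M, S/J). If \<open>a\<close> is killed
  by \<open>M\<close> modulo \<open>extend J x\<close>, write \<open>y * a = j + x * b\<close>; then
  \<open>b\<close> is killed by \<open>M\<close> modulo \<open>extend J y\<close>.\<close>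

lemma associated_extend_exchange:
  assumes J: "sub_ideal J" and M: "M \<subseteq> S" "x \<in> M" "y \<in> M"
    and reg: "regular_on J x" "regular_on J y"
    and assoc: "associated M (extend J x)"
  shows "associated M (extend J y)"
proof -
  obtain a where a: "a \<in> S" "a \<notin> extend J x" "\<And>m. m \<in> M \<Longrightarrow> m * a \<in> extend J x"
    using assoc unfolding associated_def by blast
  obtain j b where b: "y * a = j + x * b" "j \<in> J" "b \<in> S"
    using a(3)[OF M(3)] unfolding extend_def by blast
  have xy: "x \<in> S" "y \<in> S" using M by auto
  have "b \<notin> extend J y"
  proof
    assume "b \<in> extend J y"
    then obtain k d where kd: "b = k + y * d" "k \<in> J" "d \<in> S" unfolding extend_def by blast
    have "y * (a - x * d) = j + x * k" using b kd by (simp add: algebra_simps)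
    then have "y * (a - x * d) \<in> J"
      using sub_idealD(3,4)[OF J] b kd xy by simp
    then have "a - x * d \<in> J" using reg(2) kd xy a regular_onD by simp
    then show False using extendI[of "a - x * d" J d x] kd a by simp
  qed
  moreover have "m * b \<in> extend J y" if m: "m \<in> M" for m
  proof -
    have mS: "m \<in> S" using m M by auto
    obtain k c where c: "m * a = k + x * c" "k \<in> J" "c \<in> S"
      using a(3)[OF m] unfolding extend_def by blast
    have "x * b = y * a - j" using b(1) by simp
    then have "m * (x * b) = m * (y * a - j)" by simp
    then have "x * (m * b - y * c) = y * (m * a - x * c) - m * j"
      by (simp add: algebra_simps)
    also have "\<dots> = y * k - m * j" using c by simp
    also have "\<dots> \<in> J" using sub_ideal_diff[OF J] sub_idealD(4)[OF J] xy mS c b by simp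
    finally have "m * b - y * c \<in> J" using reg(1) regular_onD mS b c xy by simp
    then show ?thesis using extendI[of "m * b - y * c" J c y] c by simp
  qed
  ultimately show ?thesis unfolding associated_def using b(3) by blast
qed

section \<open>Prime ideals, prime avoidance and colon ideals\<close>

definition sub_prime :: "'a set \<Rightarrow> bool" where
  "sub_prime P \<longleftrightarrow> sub_ideal P \<and> 1 \<notin> P \<and> (\<forall>a\<in>S. \<forall>b\<in>S. a * b \<in> P \<longrightarrow> a \<in> P \<or> b \<in> P)"

lemma sub_prime_prod:
  assumes "sub_prime P" "finite A" "\<And>i. i \<in> A \<Longrightarrow> f i \<in> S" "\<And>i. i \<in> A \<Longrightarrow> f i \<notin> P"
  shows "prod f A \<in> S \<and> prod f A \<notin> P"
  using assms(2-4)
proof (induction A)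
  case empty
  then show ?case using assms(1) by (simp add: sub_prime_def)
next
  case (insert x A)
  then show ?case using assms(1) unfolding sub_prime_def by auto
qed

lemma prime_avoidance:
  assumes M: "sub_ideal M" and fin: "finite Ps"
    and P: "\<And>P. P \<in> Ps \<Longrightarrow> sub_prime P \<and> \<not> M \<subseteq> P"
  shows "\<exists>x\<in>M. \<forall>P\<in>Ps. x \<notin> P"
  using fin P
proof (induction Ps)
  case empty
  then show ?case using sub_idealD(2)[OF M] by blast
next
  case (insert P Ps)
  then obtain x where x: "x \<in> M" "\<forall>Q\<in>Ps. x \<notin> Q" by blast
  have P: "sub_prime P" "sub_ideal P" using insert.prems by (auto simp: sub_prime_def)
  have Ps: "sub_ideal Q" if "Q \<in> Ps" for Q using insert.prems that by (auto simp: sub_prime_def)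
  show ?case
  proof (cases "x \<in> P")
    case False
    then show ?thesis using x by blast
  next
    case True
    obtain m where m: "m \<in> M" "m \<notin> P" using insert.prems by blast
    \<comment> \<open>The old \<open>x\<close> fails only at \<open>P\<close>. It is corrected by an
      element of \<open>M\<close> that lies outside \<open>P\<close> but in every prime of
      \<open>Qs\<close>; a prime contained in \<open>P\<close> is avoided as soon as
      \<open>P\<close> is.\<close>
    define Qs where "Qs = {Q \<in> Ps. \<not> Q \<subseteq> P}"
    have "\<forall>Q\<in>Qs. \<exists>q. q \<in> Q \<and> q \<notin> P" unfolding Qs_def by blast
    then obtain q where q: "\<And>Q. Q \<in> Qs \<Longrightarrow> q Q \<in> Q \<and> q Q \<notin> P" by metis
    have qS: "q Q \<in> S" if "Q \<in> Qs" for Q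
      using q[OF that] Ps[of Q] sub_idealD(1) that unfolding Qs_def by blast
    have finQ: "finite Qs" using insert.hyps unfolding Qs_def by simp
    define y where "y = m * prod q Qs"
    have pr: "prod q Qs \<in> S" "prod q Qs \<notin> P"
      using sub_prime_prod[OF P(1) finQ, of q] q qS by auto
    have yM: "y \<in> M" unfolding y_def using sub_idealD(5)[OF M] m pr by blast
    have mS: "m \<in> S" using m M sub_idealD(1) by blast
    have yP: "y \<notin> P" unfolding y_def using P(1) m pr mS unfolding sub_prime_def by blast
    have yQ: "y \<in> Q" if Q: "Q \<in> Qs" for Q
    proof -
      have "prod q Qs = q Q * prod q (Qs - {Q})" using finQ Q by (rule prod.remove)
      moreover have "prod q (Qs - {Q}) \<in> S"
        using sub_prime_prod[OF P(1), of "Qs - {Q}" q] finQ q qS by auto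
      ultimately have "y = (m * prod q (Qs - {Q})) * q Q" "m * prod q (Qs - {Q}) \<in> S"
        unfolding y_def using mS by (auto simp: algebra_simps)
      then show ?thesis using sub_idealD(4)[of Q] Ps[of Q] Q q[OF Q] unfolding Qs_def by simp
    qed
    have nP: "x + y \<notin> P"
    proof
      assume "x + y \<in> P"
      then have "(x + y) - x \<in> P" using sub_ideal_diff P(2) True by blast
      then show False using yP by simp
    qed
    have "x + y \<notin> Q" if Q: "Q \<in> Ps" for Q
    proof
      assume *: "x + y \<in> Q"
      show False
      proof (cases "Q \<in> Qs")
        case True
        then have "(x + y) - y \<in> Q" using sub_ideal_diff[OF Ps[OF Q]] * yQ by blast
        then show False using x Q by simp
      next
        case False
        then show False using * nP Q unfolding Qs_def by blast
      qed
    qed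
    then show ?thesis using nP sub_idealD(3)[OF M] x(1) yM by blast
  qed
qed

text \<open>The colon ideal \<open>J : b\<close>, that is, the annihilator of the class of
  \<open>b\<close> modulo \<open>J\<close>.\<close>

definition annihilator :: "'a set \<Rightarrow> 'a \<Rightarrow> 'a set" where
  "annihilator J b = {y \<in> S. y * b \<in> J}"

lemma annihilator_ideal: "\<lbrakk>sub_ideal J; b \<in> S\<rbrakk> \<Longrightarrow> sub_ideal (annihilator J b)"
  unfolding annihilator_def
  by (rule sub_idealI) (auto simp: sub_idealD distrib_right mult.assoc)

lemma annihilator_mono: "\<lbrakk>sub_ideal J; b \<in> S\<rbrakk> \<Longrightarrow> J \<subseteq> annihilator J b"
  unfolding annihilator_def by (auto simp: sub_idealD)

lemma annihilator_extends:
  "\<lbrakk>\<forall>b\<in>set bs. y * b \<in> J'; p \<in> extends J bs; y \<in> S; sub_ideal J'; \<forall>b\<in>J. y * b \<in> J'; set bs \<subseteq> S\<rbrakk> \<Longrightarrow> y * p \<in> J'"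
proof (induction bs arbitrary: J)
  case (Cons b bs)
  have "\<forall>c\<in>extend J b. y * c \<in> J'"
  proof
    fix c assume "c \<in> extend J b"
    then obtain j r where "c = j + b * r" "j \<in> J" "r \<in> S" unfolding extend_def by blast
    moreover have "y * (j + b * r) = y * j + (y * b) * r" by (simp add: algebra_simps)
    ultimately show "y * c \<in> J'" using Cons.prems sub_idealD(3)[OF Cons.prems(4)] sub_idealD(5)[OF Cons.prems(4)] by auto
  qed
  then show ?case using Cons by auto
qed simp

end

text \<open>Noetherianity of the quotient by \<open>I\<close>, expressed through the ideals of
  \<open>S\<close> above \<open>I\<close>: \<open>F\<close> generates \<open>J\<close> together with
  \<open>I\<close>, and a universal property stands for the generated ideal.\<close>

locale noetherian_over = comm_subring +
  fixes I :: "'a set"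
  assumes finitely_generated: "\<lbrakk>sub_ideal J; I \<subseteq> J\<rbrakk> \<Longrightarrow>
    \<exists>F. finite F \<and> F \<subseteq> J \<and> (\<forall>J'. sub_ideal J' \<and> I \<subseteq> J' \<and> F \<subseteq> J' \<longrightarrow> J \<subseteq> J')"
begin

lemma ex_maximal:
  assumes "\<A> \<noteq> {}" and A: "\<And>J. J \<in> \<A> \<Longrightarrow> sub_ideal J \<and> I \<subseteq> J"
  shows "\<exists>M\<in>\<A>. \<forall>X\<in>\<A>. M \<subseteq> X \<longrightarrow> X = M"
proof (rule subset_Zorn_nonempty[OF assms(1)])
  fix C assume C: "C \<noteq> {}" "subset.chain \<A> C"
  have CA: "C \<subseteq> \<A>" using C(2) by (auto simp: subset.chain_def)
  have lin: "X \<subseteq> Y \<or> Y \<subseteq> X" if "X \<in> C" "Y \<in> C" for X Y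
    using C(2) that by (auto simp: subset.chain_def)
  have id: "sub_ideal X" "I \<subseteq> X" if "X \<in> C" for X using A CA that by auto
  have "sub_ideal (\<Union>C)"
  proof (rule sub_idealI)
    show "\<Union>C \<subseteq> S" using id sub_idealD(1) by blast
    show "0 \<in> \<Union>C" using id C(1) sub_idealD(2) by blast
    fix a b assume "a \<in> \<Union>C" "b \<in> \<Union>C"
    then obtain X Y where "X \<in> C" "Y \<in> C" "a \<in> X" "b \<in> Y" by blast
    then show "a + b \<in> \<Union>C" using lin[of X Y] id sub_idealD(3)[of X a b] sub_idealD(3)[of Y a b] by blast
  next
    fix s a assume "s \<in> S" "a \<in> \<Union>C"
    then show "s * a \<in> \<Union>C" using id sub_idealD(4) by blast
  qed
  moreover have "I \<subseteq> \<Union>C" using id C(1) by blast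
  ultimately obtain F where F: "finite F" "F \<subseteq> \<Union>C"
    "\<And>J'. \<lbrakk>sub_ideal J'; I \<subseteq> J'; F \<subseteq> J'\<rbrakk> \<Longrightarrow> \<Union>C \<subseteq> J'"
    using finitely_generated by meson
  \<comment> \<open>The finitely many generators of the union lie in a single member of the chain,
    which is then the union.\<close>
  have "\<exists>X\<in>C. F \<subseteq> X"
    using F(1,2)
  proof (induction F)
    case (insert f F)
    then obtain X Y where "X \<in> C" "F \<subseteq> X" "Y \<in> C" "f \<in> Y" by auto
    then show ?case using lin[of X Y] by blast
  qed (use C in blast)
  then obtain X where "X \<in> C" "F \<subseteq> X" by blast
  then have "\<Union>C = X" using F(3)[of X] id by blast
  then show "\<Union>C \<in> \<A>" using \<open>X \<in> C\<close> CA by blast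
qed

lemma ex_maximal_image:
  assumes "Q x" and "\<And>x. Q x \<Longrightarrow> sub_ideal (f x) \<and> I \<subseteq> f x"
  shows "\<exists>x. Q x \<and> (\<forall>y. Q y \<longrightarrow> f x \<subseteq> f y \<longrightarrow> f y = f x)"
proof -
  have "\<exists>M\<in>f ` {x. Q x}. \<forall>X\<in>f ` {x. Q x}. M \<subseteq> X \<longrightarrow> X = M"
    by (rule ex_maximal) (use assms in auto)
  then show ?thesis by auto
qed

text \<open>Colon ideals \<open>J : b\<close> that are maximal among those with \<open>b\<close>
  outside \<open>J\<close> are prime and cover the zero divisors modulo \<open>J\<close>. For
  finiteness, finitely many such elements \<open>bs\<close> already generate all of them modulo
  \<open>J\<close>, and then every maximal colon ideal is \<open>J : c\<close> for some
  \<open>c\<close> in \<open>bs\<close>.\<close>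

lemma finite_zero_divisor_primes:
  assumes J: "sub_ideal J" "I \<subseteq> J"
  shows "\<exists>Ps. finite Ps \<and> (\<forall>P\<in>Ps. sub_prime P \<and> (\<exists>b\<in>S - J. P = annihilator J b)) \<and>
    (\<forall>x\<in>S. \<not> regular_on J x \<longrightarrow> (\<exists>P\<in>Ps. x \<in> P))"
proof -
  define B where "B = {b \<in> S - J. \<forall>c\<in>S - J. annihilator J b \<subseteq> annihilator J c \<longrightarrow>
    annihilator J c = annihilator J b}"
  have Bmax: "annihilator J c = annihilator J b"
    if "b \<in> B" "c \<in> S - J" "annihilator J b \<subseteq> annihilator J c" for b c
    using that unfolding B_def by simp
  have ann: "sub_ideal (annihilator J b) \<and> I \<subseteq> annihilator J b" if "b \<in> S" for b
    using annihilator_ideal[OF J(1) that] annihilator_mono[OF J(1) that] J(2) by blast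
  have cover: "\<exists>b\<in>B. x \<in> annihilator J b" if x: "x \<in> S" "\<not> regular_on J x" for x
  proof -
    obtain a where a: "a \<in> S - J" "x \<in> annihilator J a"
      using x unfolding regular_on_def annihilator_def by blast
    have "\<exists>b. (b \<in> S - J \<and> x \<in> annihilator J b) \<and>
      (\<forall>c. c \<in> S - J \<and> x \<in> annihilator J c \<longrightarrow> annihilator J b \<subseteq> annihilator J c \<longrightarrow>
        annihilator J c = annihilator J b)"
      by (rule ex_maximal_image[where x = a]) (use a ann in auto)
    then obtain b where b: "b \<in> S - J" "x \<in> annihilator J b"
      "\<forall>c. c \<in> S - J \<and> x \<in> annihilator J c \<longrightarrow> annihilator J b \<subseteq> annihilator J c \<longrightarrow>
        annihilator J c = annihilator J b" by blast
    have "b \<in> B" unfolding B_def using b by blast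
    then show ?thesis using b(2) by blast
  qed
  have prime: "sub_prime (annihilator J b)" if b: "b \<in> B" for b
    unfolding sub_prime_def
  proof (intro conjI ballI impI)
    show "sub_ideal (annihilator J b)" "1 \<notin> annihilator J b"
      using b ann unfolding B_def by (auto simp: annihilator_def)
    fix p q assume pq: "p \<in> S" "q \<in> S" "p * q \<in> annihilator J b"
    show "p \<in> annihilator J b \<or> q \<in> annihilator J b"
    proof (rule disjCI)
      assume "q \<notin> annihilator J b"
      then have qb: "q * b \<in> S - J" using pq b unfolding B_def annihilator_def by auto
      have "annihilator J b \<subseteq> annihilator J (q * b)"
      proof
        fix x assume "x \<in> annihilator J b"
        then have "x \<in> S" "q * (x * b) \<in> J"
          using sub_idealD(4)[OF J(1) pq(2)] unfolding annihilator_def by auto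
        then show "x \<in> annihilator J (q * b)"
          unfolding annihilator_def by (simp add: mult.left_commute)
      qed
      then have "annihilator J (q * b) = annihilator J b" by (rule Bmax[OF b qb])
      then show "p \<in> annihilator J b"
        using pq unfolding annihilator_def by (auto simp: mult.assoc)
    qed
  qed
  have BS: "B \<subseteq> S" unfolding B_def by blast
  have "\<exists>bs. set bs \<subseteq> B \<and> (\<forall>cs. set cs \<subseteq> B \<longrightarrow> extends J bs \<subseteq> extends J cs \<longrightarrow>
      extends J cs = extends J bs)"
  proof (rule ex_maximal_image[where x = "[]"])
    fix bs assume "set bs \<subseteq> B"
    then show "sub_ideal (extends J bs) \<and> I \<subseteq> extends J bs"
      using extends_ideal[OF J(1), of bs] extends_mono[of J bs] J(2) BS by blast
  qed simp
  then obtain bs where bs: "set bs \<subseteq> B"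
    "\<And>cs. \<lbrakk>set cs \<subseteq> B; extends J bs \<subseteq> extends J cs\<rbrakk> \<Longrightarrow> extends J cs = extends J bs" by blast
  have mem: "b \<in> extends J bs" if b: "b \<in> B" for b
  proof -
    have "extends J bs \<subseteq> extends J (bs @ [b])" by (simp add: extend_mono)
    then have "extends J (bs @ [b]) = extends J bs" using bs(1) b by (intro bs(2)) auto
    moreover have "b \<in> extends J (bs @ [b])"
      using extends_set[OF J(1), of "bs @ [b]"] bs b BS by auto
    ultimately show ?thesis by simp
  qed
  have same: "\<exists>c\<in>set bs. annihilator J c = annihilator J b" if b: "b \<in> B" for b
  proof (rule ccontr)
    assume neg: "\<not> ?thesis"
    have "\<exists>y. y \<in> annihilator J c \<and> y \<notin> annihilator J b" if c: "c \<in> set bs" for c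
    proof (rule ccontr)
      assume "\<not> ?thesis"
      then have "annihilator J c \<subseteq> annihilator J b" by blast
      moreover have "c \<in> B" "b \<in> S - J" using c bs(1) b unfolding B_def by auto
      ultimately have "annihilator J b = annihilator J c" using Bmax by blast
      then show False using neg c by metis
    qed
    then obtain f where f: "\<And>c. c \<in> set bs \<Longrightarrow> f c \<in> annihilator J c \<and> f c \<notin> annihilator J b"
      by metis
    have fS: "f c \<in> S" if "c \<in> set bs" for c using f[OF that] unfolding annihilator_def by blast
    \<comment> \<open>By primality \<open>y\<close> avoids \<open>annihilator J b\<close>; yet it
      multiplies all of \<open>bs\<close> into \<open>J\<close>, hence also \<open>b\<close>, which
      lies in \<open>extends J bs\<close>.\<close>
    define y where "y = prod f (set bs)"
    have y: "y \<in> S" "y \<notin> annihilator J b"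
      using sub_prime_prod[OF prime[OF b], of "set bs" f] f fS unfolding y_def by auto
    have "y * c \<in> J" if c: "c \<in> set bs" for c
    proof -
      have "y = prod f (set bs - {c}) * f c"
        unfolding y_def using prod.remove[OF _ c, of f] by (simp add: mult.commute)
      moreover have "prod f (set bs - {c}) \<in> S"
        using sub_prime_prod[OF prime[OF b], of "set bs - {c}" f] f fS by auto
      ultimately show ?thesis
        using f[OF c] sub_idealD(4)[OF J(1)] unfolding annihilator_def by (simp add: mult.assoc)
    qed
    moreover have "\<forall>c\<in>J. y * c \<in> J" using y sub_idealD(4)[OF J(1)] by blast
    ultimately have "y * b \<in> J"
      using annihilator_extends[of bs y J b J] mem[OF b] y(1) J(1) bs(1) BS by blast
    then show False using y unfolding annihilator_def by blast
  qed
  show ?thesis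
  proof (intro exI[of _ "annihilator J ` set bs"] conjI ballI impI)
    show "finite (annihilator J ` set bs)" by simp
    fix P assume P: "P \<in> annihilator J ` set bs"
    then show "sub_prime P" using prime bs(1) by blast
    show "\<exists>b\<in>S - J. P = annihilator J b" using P bs(1) unfolding B_def by blast
  next
    fix x assume "x \<in> S" "\<not> regular_on J x"
    then obtain b where "b \<in> B" "x \<in> annihilator J b" using cover by blast
    moreover obtain c where "c \<in> set bs" "annihilator J c = annihilator J b"
      using same[OF \<open>b \<in> B\<close>] by blast
    ultimately show "\<exists>P\<in>annihilator J ` set bs. x \<in> P" by (metis imageI)
  qed
qed

text \<open>A prime \<open>J : b\<close> containing \<open>M\<close> would make \<open>b\<close> a
  witness for \<open>associated M J\<close>. So \<open>M\<close> lies in none of the finitely many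
  primes that belong to the ideals in \<open>Js\<close>, and prime avoidance treats all of them at
  once.\<close>

lemma common_regular_element:
  assumes M: "sub_ideal M" and fin: "finite Js"
    and Js: "\<And>J. J \<in> Js \<Longrightarrow> sub_ideal J \<and> I \<subseteq> J \<and> \<not> associated M J"
  shows "\<exists>x\<in>M. \<forall>J\<in>Js. regular_on J x"
proof -
  define good where "good J Ps \<longleftrightarrow> finite Ps \<and>
    (\<forall>P\<in>Ps. sub_prime P \<and> (\<exists>b\<in>S - J. P = annihilator J b)) \<and>
    (\<forall>x\<in>S. \<not> regular_on J x \<longrightarrow> (\<exists>P\<in>Ps. x \<in> P))" for J Ps
  have "\<forall>J\<in>Js. \<exists>Ps. good J Ps"
    using finite_zero_divisor_primes Js unfolding good_def by simp
  then have "\<exists>F. \<forall>J\<in>Js. good J (F J)" by (rule bchoice)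
  then obtain F where "\<forall>J\<in>Js. good J (F J)" by (rule exE)
  then have gF: "\<And>J. J \<in> Js \<Longrightarrow> good J (F J)" by (rule bspec)
  have F: "finite (F J)"
    "P \<in> F J \<Longrightarrow> sub_prime P \<and> (\<exists>b\<in>S - J. P = annihilator J b)"
    "\<lbrakk>x \<in> S; \<not> regular_on J x\<rbrakk> \<Longrightarrow> \<exists>P\<in>F J. x \<in> P" if "J \<in> Js" for J P x
    using gF[OF that] unfolding good_def by simp_all
  have "\<not> M \<subseteq> P" if P: "J \<in> Js" "P \<in> F J" for J P
  proof
    assume MP: "M \<subseteq> P"
    obtain b where "b \<in> S - J" "P = annihilator J b" using F(2) P by blast
    then have "associated M J" using MP unfolding associated_def annihilator_def by blast
    then show False using Js P by blast
  qed
  then have "\<exists>x\<in>M. \<forall>P\<in>\<Union>(F ` Js). x \<notin> P"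
    using F fin by (intro prime_avoidance[OF M]) auto
  then obtain x where x: "x \<in> M" "\<And>J P. \<lbrakk>J \<in> Js; P \<in> F J\<rbrakk> \<Longrightarrow> x \<notin> P" by auto
  have "regular_on J x" if "J \<in> Js" for J
    using F(3)[OF that sub_idealD(1)[OF M x(1)]] x(2)[OF that] by metis
  then show ?thesis using x(1) by metis
qed

text \<open>Kaplansky's route to the invariance of depth: a common regular element \<open>z\<close> is moved to the
  front of both sequences, so that the induction hypothesis applies modulo \<open>z\<close>.\<close>

theorem associated_exchange:
  assumes "sub_ideal M" "length xs = length ys" "sub_ideal J" "I \<subseteq> J"
    and "set xs \<subseteq> M" "set ys \<subseteq> M" "regular_seq J xs" "regular_seq J ys"
    and "associated M (extends J xs)"
  shows "associated M (extends J ys)"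
  using assms(2-)
proof (induction "length xs" arbitrary: xs ys J)
  case 0
  then show ?case by simp
next
  case (Suc r)
  obtain us p where xs: "xs = us @ [p]" using Suc.hyps(2) by (cases xs rule: rev_cases) auto
  obtain vs q where ys: "ys = vs @ [q]" using Suc.hyps(2) Suc.prems(1) by (cases ys rule: rev_cases) auto
  note M = assms(1)
  have MS: "M \<subseteq> S" using sub_idealD(1)[OF M] by blast
  have S: "set us \<subseteq> S" "set vs \<subseteq> S" "p \<in> M" "q \<in> M" "set us \<subseteq> M" "set vs \<subseteq> M"
    using Suc.prems MS xs ys by auto
  have reg: "regular_seq J us" "regular_seq J vs" "regular_on (extends J us) p"
    "regular_on (extends J vs) q"
    using Suc.prems xs ys by (auto simp: regular_seq_append)
  \<comment> \<open>The last entries \<open>p\<close> and \<open>q\<close> have to be split off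
    first: \<open>M\<close> is associated to the ideal of all of \<open>xs\<close>, so no element of
    \<open>M\<close> is regular over that one.\<close>
  have "\<exists>z\<in>M. \<forall>K\<in>prefix_ideals J us \<union> prefix_ideals J vs. regular_on K z"
  proof (rule common_regular_element[OF M])
    fix K assume "K \<in> prefix_ideals J us \<union> prefix_ideals J vs"
    then show "sub_ideal K \<and> I \<subseteq> K \<and> \<not> associated M K"
      using prefix_ideals_ideal[of K J] prefix_ideals_not_associated[of K J] Suc.prems xs ys S
      by blast
  qed simp
  then obtain z where z: "z \<in> M" "\<And>K. K \<in> prefix_ideals J us \<Longrightarrow> regular_on K z"
    "\<And>K. K \<in> prefix_ideals J vs \<Longrightarrow> regular_on K z" by blast
  have zS: "z \<in> S" using z MS by blast
  \<comment> \<open>Exchange \<open>p\<close> for \<open>z\<close>, move \<open>z\<close> to the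
    front, apply the induction hypothesis over \<open>extend J z\<close>, move \<open>z\<close> back
    and exchange it for \<open>q\<close>.\<close>
  have "associated M (extend (extends J us) z)"
    by (rule associated_extend_exchange[OF _ MS S(3) z(1)])
      (use reg z prefix_ideals_extends extends_ideal S Suc.prems xs in auto)
  then have 1: "associated M (extends (extend J z) us)" by (simp add: extends_extend)
  have "associated M (extends (extend J z) vs)"
    by (rule Suc.hyps(1)[OF _ _ _ _ _ _ _ _ 1])
      (use Suc.hyps(2) Suc.prems xs ys S z zS reg extend_ideal extend_mono[of J z]
        regular_seq_extend[of J us z] regular_seq_extend[of J vs z] in auto)
  then have "associated M (extend (extends J vs) z)" by (simp add: extends_extend)
  note assoc_z = this
  have "associated M (extend (extends J vs) q)"
    by (rule associated_extend_exchange[OF _ MS z(1) S(4) _ _ assoc_z])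
      (use reg z prefix_ideals_extends extends_ideal S Suc.prems ys in auto)
  then show ?case using ys by simp
qed

text \<open>Otherwise \<open>M\<close> would be associated to the ideal of the initial segment of
  \<open>ys\<close> that has the length of \<open>xs\<close>, although the next entry of
  \<open>ys\<close> is an element of \<open>M\<close> regular over that ideal.\<close>

corollary regular_seq_length_le:
  assumes "sub_ideal M" "sub_ideal J" "I \<subseteq> J"
    and xs: "set xs \<subseteq> M" "regular_seq J xs" "associated M (extends J xs)"
    and ys: "set ys \<subseteq> M" "regular_seq J ys"
  shows "length ys \<le> length xs"
proof (rule ccontr)
  assume "\<not> ?thesis"
  then obtain zs q us where ys_eq: "ys = zs @ q # us" "length zs = length xs"
    by (metis id_take_nth_drop length_take min.absorb4 not_le)
  have "associated M (extends J zs)"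
    by (rule associated_exchange[OF assms(1) _ assms(2,3) xs(1) _ xs(2)])
      (use ys ys_eq xs in \<open>auto simp: regular_seq_append\<close>)
  moreover have "\<not> associated M (extends J zs)"
    using ys ys_eq by (auto simp: regular_seq_append dest: not_associated_if_regular)
  ultimately show False by blast
qed

end

section \<open>Passage to a quotient ring\<close>

context comm_subring
begin

definition as_ring :: "'a ring" where
  "as_ring = \<lparr>carrier = S, monoid.mult = (*), one = 1, zero = 0, add = (+)\<rparr>"

lemma as_ring_simps [simp]:
  "carrier as_ring = S" "monoid.mult as_ring = (*)" "one as_ring = 1"
  "zero as_ring = 0" "add as_ring = (+)"
  by (simp_all add: as_ring_def)

lemma cring_as_ring: "cring as_ring"
proof (rule cringI)
  show "abelian_group as_ring"
  proof (rule abelian_groupI)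
    fix x assume "x \<in> carrier as_ring"
    then show "\<exists>y\<in>carrier as_ring. y \<oplus>\<^bsub>as_ring\<^esub> x = \<zero>\<^bsub>as_ring\<^esub>"
      by (auto intro!: bexI[of _ "- x"])
  qed (auto simp: algebra_simps)
  show "comm_monoid as_ring"
    by (rule comm_monoidI) (auto simp: algebra_simps)
qed (auto simp: algebra_simps)

lemma ring_as_ring: "ring as_ring"
  using cring_as_ring by (rule cring.axioms)

lemma a_inv_as_ring: "a \<in> S \<Longrightarrow> \<ominus>\<^bsub>as_ring\<^esub> a = - a"
proof -
  interpret cring as_ring by (rule cring_as_ring)
  assume "a \<in> S"
  then show ?thesis using minus_equality[of "- a" a] by simp
qed

lemma ideal_as_ring_iff: "ideal J as_ring \<longleftrightarrow> sub_ideal J"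
proof
  assume J: "ideal J as_ring"
  interpret ideal J as_ring by (rule J)
  show "sub_ideal J"
  proof (rule sub_idealI)
    show "J \<subseteq> S" using a_subset by simp
    show "0 \<in> J" using additive_subgroup.zero_closed[OF additive_subgroup_axioms] by simp
    show "a + b \<in> J" if "a \<in> J" "b \<in> J" for a b using additive_subgroup.a_closed[OF additive_subgroup_axioms that] by simp
    show "s * a \<in> J" if "s \<in> S" "a \<in> J" for s a using I_l_closed[of a s] that by simp
  qed
next
  assume J: "sub_ideal J"
  interpret cring as_ring by (rule cring_as_ring)
  show "ideal J as_ring"
  proof (rule idealI[OF ring_as_ring])
    show "subgroup J (add_monoid as_ring)"
      using sub_idealD[OF J] sub_ideal_uminus[OF J]
      by unfold_locales (auto simp: a_inv_as_ring[unfolded a_inv_def, simplified])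
  qed (use sub_idealD[OF J] in auto)
qed

end

locale quotient_setting = comm_subring +
  fixes I :: "'a set"
  assumes I: "sub_ideal I"
begin

abbreviation Q where "Q \<equiv> as_ring Quot I"

definition proj :: "'a \<Rightarrow> 'a set" where
  "proj a = I +>\<^bsub>as_ring\<^esub> a"

lemma ideal_I: "ideal I as_ring"
  using I by (simp add: ideal_as_ring_iff)

lemma proj_hom: "proj \<in> ring_hom as_ring Q"
proof -
  have "proj = (+>\<^bsub>as_ring\<^esub>) I" by (auto simp: proj_def)
  then show ?thesis using ideal.rcos_ring_hom[OF ideal_I] by simp
qed

lemma proj_eq: "proj = (+>\<^bsub>as_ring\<^esub>) I"
  by (auto simp: proj_def)

lemma carrier_Q: "carrier Q = proj ` S"
  unfolding FactRing_def A_RCOSETS_def' proj_def by auto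

lemma cring_Q: "cring Q"
  using ideal.quotient_is_cring[OF ideal_I cring_as_ring] .

lemma proj_mult: "\<lbrakk>a \<in> S; b \<in> S\<rbrakk> \<Longrightarrow> proj a \<otimes>\<^bsub>Q\<^esub> proj b = proj (a * b)"
  using ring_hom_mult[OF proj_hom] by simp

lemma proj_mem_iff:
  assumes "sub_ideal J" "I \<subseteq> J" "a \<in> S"
  shows "proj a \<in> proj ` J \<longleftrightarrow> a \<in> J"
proof -
  interpret A: ring as_ring by (rule ring_as_ring)
  have J: "ideal J as_ring" using assms by (simp add: ideal_as_ring_iff)
  have "J = \<Union>(proj ` J)"
    using A.ideal_incl_iff[OF ideal_I J] assms(2) unfolding proj_def by simp
  moreover have "proj ` J \<subseteq> carrier Q" using sub_idealD(1)[OF assms(1)] carrier_Q by blast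
  ultimately show ?thesis
    using A.canonical_proj_vimage_mem_iff[OF ideal_I, of "proj ` J" a] assms(3)
    unfolding proj_eq by auto
qed

lemma ideal_proj: "sub_ideal J \<Longrightarrow> ideal (proj ` J) Q"
  using ring.ring_ideal_imp_quot_ideal[OF ring_as_ring ideal_I] unfolding proj_eq
  by (simp add: ideal_as_ring_iff)

lemma ideal_Q_obtain:
  assumes "ideal K Q"
  obtains J where "sub_ideal J" "I \<subseteq> J" "K = proj ` J"
proof -
  have "K \<in> (\<lambda>J. (+>\<^bsub>as_ring\<^esub>) I ` J) ` {J. ideal J as_ring \<and> I \<subseteq> J}"
    using ring.quot_ideal_correspondence[OF ring_as_ring ideal_I] assms
    unfolding bij_betw_def by simp
  then show thesis using that unfolding proj_eq by (auto simp: ideal_as_ring_iff)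
qed

lemma proj_image_mono_iff:
  assumes "sub_ideal J" "I \<subseteq> J" "A \<subseteq> S"
  shows "proj ` A \<subseteq> proj ` J \<longleftrightarrow> A \<subseteq> J"
  using proj_mem_iff[OF assms(1,2)] assms(3) by blast

lemma noetherian_over_if_quotient:
  assumes "noetherian_ring Q"
  shows "noetherian_over S I"
proof unfold_locales
  fix J assume J: "sub_ideal J" "I \<subseteq> J"
  obtain A where A: "A \<subseteq> carrier Q" "finite A" "proj ` J = Idl\<^bsub>Q\<^esub> A"
    using noetherian_ring.finetely_gen[OF assms ideal_proj[OF J(1)]] by auto
  obtain F where F: "F \<subseteq> S" "finite F" "A = proj ` F"
    using A(1,2) unfolding carrier_Q by (meson finite_subset_image)
  interpret Qr: cring Q by (rule cring_Q)
  have "proj ` F \<subseteq> proj ` J" using Qr.genideal_self[OF A(1)] A(3) F(3) by simp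
  then have FJ: "F \<subseteq> J" using proj_image_mono_iff[OF J F(1)] by simp
  show "\<exists>F. finite F \<and> F \<subseteq> J \<and> (\<forall>J'. sub_ideal J' \<and> I \<subseteq> J' \<and> F \<subseteq> J' \<longrightarrow> J \<subseteq> J')"
  proof (intro exI[of _ F] conjI allI impI)
    fix J' assume J': "sub_ideal J' \<and> I \<subseteq> J' \<and> F \<subseteq> J'"
    have "Idl\<^bsub>Q\<^esub> A \<subseteq> proj ` J'"
      by (rule Qr.genideal_minimal) (use J' F(3) ideal_proj in auto)
    then show "J \<subseteq> J'"
      using A(3) proj_image_mono_iff[of J' J] J' sub_idealD(1)[OF J(1)] by (metis subsetI)
  qed (use F FJ in auto)
qed

lemma genideal_proj:
  assumes "set ys \<subseteq> S"
  shows "Idl\<^bsub>Q\<^esub> (proj ` set ys) = proj ` extends I ys"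
proof
  interpret Qr: cring Q by (rule cring_Q)
  have car: "proj ` set ys \<subseteq> carrier Q" using assms carrier_Q by auto
  show "Idl\<^bsub>Q\<^esub> (proj ` set ys) \<subseteq> proj ` extends I ys"
    by (rule Qr.genideal_minimal)
      (use ideal_proj[OF extends_ideal[OF I assms]] extends_set[OF I assms] in auto)
  obtain J where J: "sub_ideal J" "I \<subseteq> J" "Idl\<^bsub>Q\<^esub> (proj ` set ys) = proj ` J"
    using ideal_Q_obtain[OF Qr.genideal_ideal[OF car]] by blast
  have "set ys \<subseteq> J"
    using Qr.genideal_self[OF car] J(3) proj_image_mono_iff[OF J(1,2) assms] by simp
  then show "proj ` extends I ys \<subseteq> Idl\<^bsub>Q\<^esub> (proj ` set ys)"
    using extends_least[OF J(1,2)] J(3) by blast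
qed

text \<open>Depth is defined in the quotient, whereas the exchange argument runs in
  \<open>S\<close>. The ideal of the first \<open>i\<close> classes has
  \<open>extends I (take i ys)\<close> as its preimage, so regularity can be read off there.\<close>

lemma regular_sequence_lift:
  assumes "regular_sequence Q xs" "set xs \<subseteq> proj ` M" "M \<subseteq> S"
  obtains ys where "xs = map proj ys" "set ys \<subseteq> M" "regular_seq I ys"
proof -
  have "\<exists>ys. xs = map proj ys \<and> set ys \<subseteq> M"
    using assms(2)
  proof (induction xs)
    case (Cons x xs)
    then obtain y ys where "x = proj y" "y \<in> M" "xs = map proj ys" "set ys \<subseteq> M" by auto
    then show ?case by (intro exI[of _ "y # ys"]) simp
  qed simp
  then obtain ys where ys: "xs = map proj ys" "set ys \<subseteq> M" by blast
  have yS: "set ys \<subseteq> S" using ys(2) assms(3) by blast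
  have "regular_on (extends I (take i ys)) (ys ! i)" if i: "i < length ys" for i
    unfolding regular_on_def
  proof (intro ballI impI)
    fix a assume a: "a \<in> S" "ys ! i * a \<in> extends I (take i ys)"
    have tk: "set (take i ys) \<subseteq> S" using yS set_take_subset by fast
    have yi: "ys ! i \<in> S" using i yS by auto
    have id: "Idl\<^bsub>Q\<^esub> (set (take i xs)) = proj ` extends I (take i ys)"
      using genideal_proj[OF tk] ys(1) by (simp add: take_map)
    have "xs ! i \<otimes>\<^bsub>Q\<^esub> proj a = proj (ys ! i * a)"
      using proj_mult yi a(1) i ys(1) by simp
    then have "xs ! i \<otimes>\<^bsub>Q\<^esub> proj a \<in> Idl\<^bsub>Q\<^esub> (set (take i xs))" using a(2) id by simp
    then have "proj a \<in> proj ` extends I (take i ys)"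
      using assms(1) i ys(1) a(1) carrier_Q id unfolding regular_sequence_def by auto
    then show "a \<in> extends I (take i ys)"
      using proj_mem_iff[OF extends_ideal[OF I tk] extends_mono a(1)] by simp
  qed
  then show thesis using that ys yS by (auto simp: regular_seq_iff)
qed

lemma primeideal_proj:
  assumes "sub_prime P" "I \<subseteq> P"
  shows "primeideal (proj ` P) Q"
proof -
  have P: "sub_ideal P" "1 \<notin> P" "\<And>a b. \<lbrakk>a \<in> S; b \<in> S; a * b \<in> P\<rbrakk> \<Longrightarrow> a \<in> P \<or> b \<in> P"
    using assms(1) unfolding sub_prime_def by auto
  note mem = proj_mem_iff[OF P(1) assms(2)]
  show ?thesis
  proof (rule primeidealI[OF ideal_proj[OF P(1)] cring_Q])
    show "carrier Q \<noteq> proj ` P" using mem[of 1] P(2) carrier_Q one_in by blast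
    fix a b assume "a \<in> carrier Q" "b \<in> carrier Q" "a \<otimes>\<^bsub>Q\<^esub> b \<in> proj ` P"
    then obtain x y where xy: "a = proj x" "b = proj y" "x \<in> S" "y \<in> S" "proj (x * y) \<in> proj ` P"
      unfolding carrier_Q by (auto simp: proj_mult)
    then have "x * y \<in> P" using mem[of "x * y"] by simp
    then show "a \<in> proj ` P \<or> b \<in> proj ` P" using P(3) xy by blast
  qed
qed

lemma maximalideal_proj:
  assumes M: "sub_ideal M" "I \<subseteq> M" "1 \<notin> M"
    and inv: "\<And>f. \<lbrakk>f \<in> S; f \<notin> M\<rbrakk> \<Longrightarrow> \<exists>c\<in>S. c * f - 1 \<in> M"
  shows "maximalideal (proj ` M) Q"
proof (rule maximalidealI[OF ideal_proj[OF M(1)]])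
  show "carrier Q \<noteq> proj ` M" using proj_mem_iff[OF M(1,2), of 1] M(3) carrier_Q one_in by blast
  fix K assume K: "ideal K Q" "proj ` M \<subseteq> K" "K \<subseteq> carrier Q"
  obtain J where J: "sub_ideal J" "I \<subseteq> J" "K = proj ` J" using ideal_Q_obtain[OF K(1)] by blast
  have MJ: "M \<subseteq> J"
    using K(2) J(3) proj_image_mono_iff[OF J(1,2), of M] sub_idealD(1)[OF M(1)] by auto
  show "K = proj ` M \<or> K = carrier Q"
  proof (cases "J = M")
    case False
    then obtain f where f: "f \<in> J" "f \<notin> M" using MJ by blast
    then obtain c where c: "c \<in> S" "c * f - 1 \<in> M" using inv sub_idealD(1)[OF J(1)] by blast
    have "c * f - (c * f - 1) \<in> J"
      using sub_ideal_diff[OF J(1)] sub_idealD(4)[OF J(1) c(1) f(1)] c(2) MJ by blast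
    then have "J = S" using sub_idealD(1,4)[OF J(1)] by (metis diff_diff_eq2 add_diff_cancel_left' mult.right_neutral subsetI subset_antisym)
    then show ?thesis using J(3) carrier_Q by simp
  qed (use J in simp)
qed

text \<open>The chain \<open>P\<close> bounds the height of the maximal ideal from below;
  \<open>hs\<close>, which cannot be prolonged inside \<open>M\<close>, bounds its depth from above;
  Cohen-Macaulayness equates the two.\<close>

theorem cohen_macaulay_chain_le:
  assumes CM: "cohen_macaulay_ring Q"
    and M: "sub_ideal M" "I \<subseteq> M" "1 \<notin> M"
      "\<And>f. \<lbrakk>f \<in> S; f \<notin> M\<rbrakk> \<Longrightarrow> \<exists>c\<in>S. c * f - 1 \<in> M"
    and hs: "set hs \<subseteq> M" "regular_seq I hs" "associated M (extends I hs)"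
    and P: "\<And>i. i \<le> k \<Longrightarrow> sub_prime (P i)" "I \<subseteq> P 0" "\<And>i. i < k \<Longrightarrow> P i \<subset> P (Suc i)" "P k = M"
  shows "k \<le> length hs"
proof -
  have noeth: "noetherian_ring Q" using CM by (simp add: cohen_macaulay_ring_def)
  interpret noetherian_over S I by (rule noetherian_over_if_quotient[OF noeth])
  have IP: "I \<subseteq> P i" if "i \<le> k" for i
    using that
  proof (induction i)
    case (Suc i)
    then show ?case using P(3)[of i] by auto
  qed (use P(2) in simp)
  have "enat k \<le> prime_height Q (proj ` M)"
    unfolding prime_height_def
  proof (rule Sup_upper, rule CollectI, intro exI conjI allI impI)
    show "enat k = enat k" ..
    show "primeideal ((\<lambda>i. proj ` P i) i) Q" if "i \<le> k" for i
      using primeideal_proj P(1) IP that by simp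
    show "(\<lambda>i. proj ` P i) i \<subset> (\<lambda>i. proj ` P i) (Suc i)" if i: "i < k" for i
    proof -
      have "sub_ideal (P i)" "sub_ideal (P (Suc i))" using P(1) i unfolding sub_prime_def by auto
      moreover have "P i \<subseteq> S" "P (Suc i) \<subseteq> S" using calculation sub_idealD(1) by blast+
      ultimately show ?thesis
        using proj_image_mono_iff[of "P i" "P (Suc i)"] proj_image_mono_iff[of "P (Suc i)" "P i"]
          IP[of i] IP[of "Suc i"] P(3)[OF i] i by (auto simp: less_le_not_le)
    qed
    show "(\<lambda>i. proj ` P i) k = proj ` M" using P(4) by simp
  qed
  also have "\<dots> = ideal_depth Q (proj ` M)"
    using CM maximalideal_proj[OF M] by (simp add: cohen_macaulay_ring_def)
  also have "\<dots> \<le> enat (length hs)"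
    unfolding ideal_depth_def
  proof (rule Sup_least)
    fix e assume "e \<in> {enat (length xs) |xs. regular_sequence Q xs \<and> set xs \<subseteq> proj ` M}"
    then obtain xs where xs: "e = enat (length xs)" "regular_sequence Q xs" "set xs \<subseteq> proj ` M"
      by blast
    obtain ys where "xs = map proj ys" "set ys \<subseteq> M" "regular_seq I ys"
      using regular_sequence_lift[OF xs(2,3)] sub_idealD(1)[OF M(1)] by blast
    then show "e \<le> enat (length hs)"
      using regular_seq_length_le[OF M(1) I _ hs] xs(1) by simp
  qed
  finally show ?thesis by simp
qed

end

section \<open>Substitutions and gradings on polynomials\<close>

text \<open>The order on vertices only serves to make polynomials an instance of \<^class>\<open>idom\<close>.\<close>

instantiation vertex :: linorder
begin

fun vertex_code :: "vertex \<Rightarrow> nat" where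
  "vertex_code (X i) = 2 * i"
| "vertex_code (Y i) = 2 * i + 1"

definition less_eq_vertex :: "vertex \<Rightarrow> vertex \<Rightarrow> bool" where
  "less_eq_vertex v w \<longleftrightarrow> vertex_code v \<le> vertex_code w"

definition less_vertex :: "vertex \<Rightarrow> vertex \<Rightarrow> bool" where
  "less_vertex v w \<longleftrightarrow> vertex_code v < vertex_code w"

lemma vertex_code_inject: "vertex_code v = vertex_code w \<Longrightarrow> v = w"
  by (cases v; cases w) (simp_all, presburger+)

instance
  by standard
    (auto simp: less_eq_vertex_def less_vertex_def intro: vertex_code_inject)

end

lemma finite_Vn [simp]: "finite (Vn n)"
  by (simp add: Vn_def)

abbreviation lookup where "lookup \<equiv> Poly_Mapping.lookup"
abbreviation keys where "keys \<equiv> Poly_Mapping.keys"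
abbreviation single where "single \<equiv> Poly_Mapping.single"

lemma poly_mapping_sum_single: "(\<Sum>c\<in>keys f. single c (lookup f c)) = f"
proof (rule poly_mapping_eqI)
  fix d
  have "lookup (\<Sum>c\<in>keys f. single c (lookup f c)) d =
    (\<Sum>c\<in>keys f. if c = d then lookup f c else 0)"
    by (simp add: lookup_sum lookup_single when_def)
  also have "\<dots> = lookup f d"
    by (simp add: in_keys_iff)
  finally show "lookup (\<Sum>c\<in>keys f. single c (lookup f c)) d = lookup f d" .
qed

lemma poly_mapping_additive_induct [case_names single add]:
  fixes f :: "'a \<Rightarrow>\<^sub>0 'b::comm_monoid_add"
  assumes "\<And>c a. P (single c a)" "\<And>f g. \<lbrakk>P f; P g\<rbrakk> \<Longrightarrow> P (f + g)"
  shows "P f"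
proof -
  have "P (\<Sum>c\<in>A. single c (lookup f c))" if "finite A" for A
    using that
  proof (induction A)
    case empty
    then show ?case using assms(1)[of undefined 0] by simp
  next
    case (insert c A)
    then show ?case using assms by simp
  qed
  then show ?thesis using poly_mapping_sum_single[of f] finite_keys[of f] by metis
qed

section \<open>Substitution homomorphisms\<close>

definition mono_subst :: "nat \<Rightarrow> (vertex \<Rightarrow> 'k::field vpoly) \<Rightarrow> (vertex \<Rightarrow>\<^sub>0 nat) \<Rightarrow> 'k vpoly" where
  "mono_subst n \<sigma> c = (\<Prod>v\<in>Vn n. \<sigma> v ^ lookup c v)"

text \<open>Variables outside \<open>Vn n\<close> are left out of \<open>mono_subst\<close> and are
  thus sent to 1. So \<open>subst\<close> is a ring homomorphism on the whole type, and its rules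
  for sums and products carry no membership conditions.\<close>

definition subst :: "nat \<Rightarrow> (vertex \<Rightarrow> 'k::field vpoly) \<Rightarrow> 'k vpoly \<Rightarrow> 'k vpoly" where
  "subst n \<sigma> f = (\<Sum>c\<in>keys f. single 0 (lookup f c) * mono_subst n \<sigma> c)"

lemma mono_subst_add: "mono_subst n \<sigma> (c + d) = mono_subst n \<sigma> c * mono_subst n \<sigma> d"
  by (simp add: mono_subst_def lookup_add power_add prod.distrib)

lemma mono_subst_zero [simp]: "mono_subst n \<sigma> 0 = 1"
  by (simp add: mono_subst_def)

lemma subst_superset:
  assumes "finite B" "keys f \<subseteq> B"
  shows "subst n \<sigma> f = (\<Sum>c\<in>B. single 0 (lookup f c) * mono_subst n \<sigma> c)"
  unfolding subst_def using assms
  by (intro sum.mono_neutral_left) (auto simp: in_keys_iff)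

lemma subst_single [simp]:
  "subst n \<sigma> (single c a) = single 0 a * mono_subst n \<sigma> c"
  by (subst subst_superset[of "{c}"]) auto

lemma subst_add [simp]: "subst n \<sigma> (f + g) = subst n \<sigma> f + subst n \<sigma> g"
proof -
  let ?B = "keys f \<union> keys g"
  have "keys (f + g) \<subseteq> ?B" by (rule Poly_Mapping.keys_add)
  then show ?thesis
    by (simp add: subst_superset[of ?B] lookup_add single_add distrib_right sum.distrib)
qed

lemma subst_zero [simp]: "subst n \<sigma> 0 = 0"
  by (simp add: subst_def)

lemma subst_uminus [simp]: "subst n \<sigma> (- f) = - subst n \<sigma> f"
  using subst_add[of n \<sigma> f "- f"] by (simp add: eq_neg_iff_add_eq_0 add.commute)

lemma subst_diff [simp]: "subst n \<sigma> (f - g) = subst n \<sigma> f - subst n \<sigma> g"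
  using subst_add[of n \<sigma> f "- g"] by simp

lemma subst_const: "subst n \<sigma> (single 0 a) = single 0 a"
  by simp

lemma subst_one [simp]: "subst n \<sigma> 1 = 1"
  using subst_const[of n \<sigma> 1] by (simp del: subst_single)

lemma subst_mult [simp]: "subst n \<sigma> (f * g) = subst n \<sigma> f * subst n \<sigma> g"
proof (induction f rule: poly_mapping_additive_induct)
  case (single c a)
  show ?case
  proof (induction g rule: poly_mapping_additive_induct)
    case (single d b)
    have "single (0 :: vertex \<Rightarrow>\<^sub>0 nat) (a * b) =
        single 0 a * single 0 b"
      by (simp add: mult_single)
    then show ?case by (simp add: mult_single mono_subst_add)
  qed (simp add: distrib_left)
qed (simp add: distrib_right)

lemma single_power:
  "single c (1 :: 'k::comm_semiring_1) ^ k = single (\<Sum>i<k. c) 1"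
  by (induction k) (simp_all add: mult_single add.commute)

lemma prod_single:
  "(\<Prod>v\<in>A. single (f v) (1 :: 'k::comm_semiring_1)) =
    single (\<Sum>v\<in>A. f v :: 'b :: comm_monoid_add) 1"
  by (induction A rule: infinite_finite_induct) (simp_all add: mult_single)

lemma Var_power: "Var v ^ k = vmonomial (single v k)"
proof -
  have "(\<Sum>i<k. single v (1::nat)) = single v k"
    by (induction k) (simp_all flip: single_add)
  then show ?thesis by (simp add: Var_def vmonomial_def single_power)
qed

lemma mono_subst_Var:
  assumes "keys c \<subseteq> Vn n"
  shows "mono_subst n Var c = vmonomial c"
proof -
  have "(\<Sum>v\<in>Vn n. single v (lookup c v)) = c"
    using poly_mapping_sum_single[of c] assms
      sum.mono_neutral_left[of "Vn n" "keys c" "\<lambda>v. single v (lookup c v)"]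
    by (auto simp: in_keys_iff)
  then show ?thesis
    by (simp add: mono_subst_def Var_power vmonomial_def prod_single)
qed

lemma mono_subst_single:
  assumes "v \<in> Vn n"
  shows "mono_subst n \<sigma> (single v k) = \<sigma> v ^ k"
proof -
  have "mono_subst n \<sigma> (single v k) = (\<Prod>w\<in>Vn n. if w = v then \<sigma> v ^ k else 1)"
    unfolding mono_subst_def by (rule prod.cong) (auto simp: lookup_single when_def)
  then show ?thesis using assms by simp
qed

lemma subst_Var [simp]: "v \<in> Vn n \<Longrightarrow> subst n \<sigma> (Var v) = \<sigma> v"
  by (simp add: Var_def vmonomial_def mono_subst_single)

lemma Var_neq_zero [simp]: "Var v \<noteq> 0"
  unfolding Var_def vmonomial_def by (metis lookup_single_eq lookup_zero one_neq_zero)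

locale vertex_ring =
  fixes n :: nat and K :: "'k::field itself"
begin

definition S :: "'k vpoly set" where
  "S = carrier (poly_ring n)"

lemma mem_S: "f \<in> S \<longleftrightarrow> (\<forall>c\<in>keys f. keys c \<subseteq> Vn n)"
  by (simp add: S_def poly_ring_def)

sublocale comm_subring S
proof
  show "1 \<in> S" by (simp add: mem_S)
  fix f g assume fg: "f \<in> S" "g \<in> S"
  have "keys (f - g) \<subseteq> keys f \<union> keys g"
    by (auto simp: in_keys_iff lookup_minus)
  then show "f - g \<in> S" using fg by (auto simp: mem_S)
  show "f * g \<in> S"
    unfolding mem_S
  proof
    fix c assume "c \<in> keys (f * g)"
    then obtain a b where "c = a + b" "a \<in> keys f" "b \<in> keys g" using keys_mult by blast
    then show "keys c \<subseteq> Vn n" using fg Poly_Mapping.keys_add[of a b] unfolding mem_S by blast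
  qed
qed

lemma poly_ring_eq: "poly_ring n = as_ring"
  unfolding as_ring_def by (simp add: S_def poly_ring_def)

lemma const_in [simp]: "single 0 a \<in> S"
  by (simp add: mem_S)

lemma Var_in [simp]: "v \<in> Vn n \<Longrightarrow> Var v \<in> S"
  by (simp add: mem_S Var_def vmonomial_def)

lemma power_in [simp]: "f \<in> S \<Longrightarrow> f ^ k \<in> S"
  by (induction k) auto

lemma sum_in: "(\<And>i. i \<in> A \<Longrightarrow> f i \<in> S) \<Longrightarrow> sum f A \<in> S"
  by (induction A rule: infinite_finite_induct) auto

lemma prod_in: "(\<And>i. i \<in> A \<Longrightarrow> f i \<in> S) \<Longrightarrow> prod f A \<in> S"
  by (induction A rule: infinite_finite_induct) auto

lemma subst_in: "(\<And>v. v \<in> Vn n \<Longrightarrow> \<sigma> v \<in> S) \<Longrightarrow> subst n \<sigma> f \<in> S"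
  unfolding subst_def mono_subst_def by (intro sum_in mult_in prod_in const_in power_in)

lemma subst_Var_id: "f \<in> S \<Longrightarrow> subst n Var f = f"
proof -
  assume f: "f \<in> S"
  have "subst n Var f = (\<Sum>c\<in>keys f. single c (lookup f c))"
    unfolding subst_def using f
    by (intro sum.cong) (simp_all add: mem_S mono_subst_Var vmonomial_def mult_single)
  then show ?thesis by (simp add: poly_mapping_sum_single)
qed

text \<open>The identity substitution writes \<open>f\<close> as a sum of constants times products
  of powers of variables, through which \<open>P\<close> is carried.\<close>

lemma S_induct [consumes 1, case_names const Var add mult]:
  assumes "f \<in> S"
    and const: "\<And>a. P (single 0 a)"
    and var: "\<And>v. v \<in> Vn n \<Longrightarrow> P (Var v)"
    and add: "\<And>f g. \<lbrakk>f \<in> S; g \<in> S; P f; P g\<rbrakk> \<Longrightarrow> P (f + g)"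
    and mult: "\<And>f g. \<lbrakk>f \<in> S; g \<in> S; P f; P g\<rbrakk> \<Longrightarrow> P (f * g)"
  shows "P f"
proof -
  have one: "P 1" using const[of 1] by simp
  have zero: "P 0" using const[of 0] by simp
  have pow: "f ^ k \<in> S \<and> P (f ^ k)" if "f \<in> S" "P f" for f k
    using that by (induction k) (auto simp: one intro: mult)
  have pr: "prod g A \<in> S \<and> P (prod g A)" if "\<And>i. i \<in> A \<Longrightarrow> g i \<in> S \<and> P (g i)" for A :: "vertex set" and g
    using that by (induction A rule: infinite_finite_induct) (auto simp: one intro: mult)
  have su: "sum g A \<in> S \<and> P (sum g A)" if "\<And>i. i \<in> A \<Longrightarrow> g i \<in> S \<and> P (g i)"
    for A :: "(vertex \<Rightarrow>\<^sub>0 nat) set" and g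
    using that by (induction A rule: infinite_finite_induct) (auto simp: zero intro: add)
  have mo: "mono_subst n Var c \<in> S \<and> P (mono_subst n Var c)" for c
    unfolding mono_subst_def by (rule pr) (rule pow; simp add: var)
  have "single 0 a * mono_subst n Var c \<in> S \<and>
      P (single 0 a * mono_subst n Var c)" for a c
    using mo[of c] const[of a] mult const_in mult_in by blast
  then have "subst n Var f \<in> S \<and> P (subst n Var f)" unfolding subst_def by (rule su)
  then show ?thesis using subst_Var_id[OF assms(1)] by simp
qed

text \<open>Modulo \<open>L\<close>, the identity and \<open>subst n \<sigma>\<close> are
  homomorphisms on \<open>S\<close> that agree on constants and on variables. This turns
  computations modulo an ideal into evaluations.\<close>

lemma subst_cong_mod:
  assumes L: "sub_ideal L" and \<sigma>: "\<And>v. v \<in> Vn n \<Longrightarrow> \<sigma> v \<in> S" "\<And>v. v \<in> Vn n \<Longrightarrow> Var v - \<sigma> v \<in> L"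
    and "f \<in> S"
  shows "f - subst n \<sigma> f \<in> L"
  using assms(4)
proof (induction f rule: S_induct)
  case (add f g)
  then have "(f - subst n \<sigma> f) + (g - subst n \<sigma> g) \<in> L" using sub_idealD(3)[OF L] by blast
  then show ?case by (simp add: algebra_simps)
next
  case (mult f g)
  then have "f * (g - subst n \<sigma> g) + (f - subst n \<sigma> f) * subst n \<sigma> g \<in> L"
    using subst_in[of \<sigma> g, OF \<sigma>(1)] by (intro sub_idealD(3-5)[OF L]) auto
  then show ?case by (simp add: algebra_simps)
qed (use sub_idealD(2)[OF L] \<sigma>(2) in auto)

definition ker :: "(vertex \<Rightarrow> 'k vpoly) \<Rightarrow> 'k vpoly set" where
  "ker \<sigma> = {f \<in> S. subst n \<sigma> f = 0}"

text \<open>Polynomials over a field form an integral domain. Kernels of substitutions thus supply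
  primes without any discussion of generators.\<close>

lemma ker_prime: "sub_prime (ker \<sigma>)"
  unfolding sub_prime_def
proof (intro conjI)
  show "sub_ideal (ker \<sigma>)" by (rule sub_idealI) (auto simp: ker_def)
qed (auto simp: ker_def)

lemma ker_ideal: "sub_ideal (ker \<sigma>)"
  using ker_prime unfolding sub_prime_def by blast

section \<open>The grading by the exponent of one variable\<close>

definition part :: "vertex \<Rightarrow> nat \<Rightarrow> 'k vpoly \<Rightarrow> 'k vpoly" where
  "part v i f = (\<Sum>c\<in>keys f. if lookup c v = i then single c (lookup f c) else 0)"

lemma lookup_part: "lookup (part v i f) c = (if lookup c v = i then lookup f c else 0)"
proof -
  have "lookup (part v i f) c = (\<Sum>d\<in>keys f. if d = c \<and> lookup c v = i then lookup f c else 0)"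
    unfolding part_def lookup_sum by (rule sum.cong) (auto simp: lookup_single when_def)
  then show ?thesis by (cases "lookup c v = i") (simp_all add: in_keys_iff)
qed

lemma part_add [simp]: "part v i (f + g) = part v i f + part v i g"
  by (rule poly_mapping_eqI) (simp add: lookup_part lookup_add)

lemma part_diff [simp]: "part v i (f - g) = part v i f - part v i g"
  by (rule poly_mapping_eqI) (simp add: lookup_part lookup_minus)

lemma part_zero [simp]: "part v i 0 = 0"
  by (rule poly_mapping_eqI) (simp add: lookup_part)

lemma part_single: "part v i (single c a) =
    (if lookup c v = i then single c a else 0)"
  by (rule poly_mapping_eqI) (auto simp: lookup_part lookup_single when_def)

lemma part_const_mult:
  "part v i (single 0 a * f) = single 0 a * part v i f"
  by (induction f rule: poly_mapping_additive_induct)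
    (simp_all add: part_single mult_single distrib_left)

lemma part_Var_mult:
  "part v i (Var w * f) =
    (if w = v then if i = 0 then 0 else Var w * part v (i - 1) f else Var w * part v i f)"
proof (induction f rule: poly_mapping_additive_induct)
  case (single c a)
  have "lookup (single w 1 + c) v = (if w = v then 1 else 0) + lookup c v"
    by (simp add: lookup_add lookup_single when_def)
  then show ?case
    by (cases i) (simp_all add: Var_def vmonomial_def mult_single part_single)
qed (simp add: distrib_left)

lemma part_Var: "part v i (Var w) = (if (if w = v then i = 1 else i = 0) then Var w else 0)"
  by (auto simp: Var_def vmonomial_def part_single lookup_single)

lemma part_one: "part v i 1 = (if i = 0 then 1 else 0)"
proof -
  have "part v i (single 0 1) = (if 0 = i then single 0 1 else 0)"
    by (simp only: part_single lookup_zero)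
  then show ?thesis by (cases "i = 0") simp_all
qed

lemma sum_parts:
  obtains B where "finite B" "f = (\<Sum>i\<in>B. part v i f)"
proof
  let ?B = "(\<lambda>c. lookup c v) ` keys f"
  show "finite ?B" by simp
  show "f = (\<Sum>i\<in>?B. part v i f)"
  proof (rule poly_mapping_eqI)
    fix c
    show "lookup f c = lookup (\<Sum>i\<in>?B. part v i f) c"
      by (simp add: lookup_sum lookup_part) (metis imageI in_keys_iff)
  qed
qed

text \<open>Homogeneity in the single variable \<open>v\<close>: an element \<open>Var a - 1\<close>
  for another vertex \<open>a\<close> has degree 0 here, while it is not homogeneous for the total
  degree.\<close>

definition graded :: "vertex \<Rightarrow> 'k vpoly set \<Rightarrow> bool" where
  "graded v J \<longleftrightarrow> (\<forall>f\<in>J. \<forall>i. part v i f \<in> J)"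

text \<open>This is the largest subideal of \<open>J\<close> that is homogeneous in
  \<open>v\<close>. Hence homogeneity of \<open>J\<close> can be tested on generators.\<close>

lemma graded_core_ideal:
  assumes J: "sub_ideal J"
  shows "sub_ideal {f \<in> S. \<forall>i. part v i f \<in> J}"
proof (rule sub_idealI)
  fix s f assume "s \<in> S" "f \<in> {f \<in> S. \<forall>i. part v i f \<in> J}"
  then have "s * f \<in> S \<and> (\<forall>i. part v i (s * f) \<in> J)"
  proof (induction s arbitrary: f rule: S_induct)
    case (const a)
    then show ?case using sub_idealD(4)[OF J] by (simp add: part_const_mult)
  next
    case (Var w)
    then show ?case using sub_idealD(2,4)[OF J] by (auto simp: part_Var_mult)
  next
    case (add s t)
    then show ?case using sub_idealD(3)[OF J] by (simp add: distrib_right)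
  next
    case (mult s t)
    then show ?case by (simp add: mult.assoc)
  qed
  then show "s * f \<in> {f \<in> S. \<forall>i. part v i f \<in> J}" by simp
qed (use sub_idealD(2,3)[OF J] in auto)

text \<open>Component \<open>i\<close> of \<open>(Var v - 1) * f\<close> is \<open>Var v\<close>
  times component \<open>i - 1\<close> of \<open>f\<close>, minus component \<open>i\<close> of
  \<open>f\<close>. As all of these lie in \<open>J\<close>, the components of \<open>f\<close>
  follow from degree 0 upwards.\<close>

lemma regular_on_Var_minus_one:
  assumes J: "sub_ideal J" "graded v J" and v: "v \<in> Vn n"
  shows "regular_on J (Var v - 1)"
  unfolding regular_on_def
proof (intro ballI impI)
  fix f assume f: "f \<in> S" "(Var v - 1) * f \<in> J"
  have parts: "part v i ((Var v - 1) * f) = (if i = 0 then 0 else Var v * part v (i - 1) f) - part v i f" for i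
    by (simp add: left_diff_distrib part_Var_mult)
  have inJ: "(if i = 0 then 0 else Var v * part v (i - 1) f) - part v i f \<in> J" for i
    using J(2) f(2) parts unfolding graded_def by metis
  have "part v i f \<in> J" for i
  proof (induction i)
    case 0
    then show ?case using sub_ideal_uminus[OF J(1) inJ[of 0]] by simp
  next
    case (Suc i)
    have "Var v * part v i f - (Var v * part v i f - part v (Suc i) f) \<in> J"
      using sub_ideal_diff[OF J(1) sub_idealD(4)[OF J(1) Var_in[OF v] Suc] inJ[of "Suc i"]] by simp
    then show ?case by simp
  qed
  moreover obtain B where "f = (\<Sum>i\<in>B. part v i f)" using sum_parts[of f v] by blast
  ultimately show "f \<in> J" using sub_ideal_sum[OF J(1), of B "\<lambda>i. part v i f"] by metis
qed

end

section \<open>Disconnected links\<close>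

context vertex_ring
begin

lemma edge_generators:
  assumes "\<And>v w. {v, w} \<in> E \<Longrightarrow> v \<in> Vn n \<and> w \<in> Vn n"
  shows "{Var v * Var w |v w. {v, w} \<in> E} \<subseteq> carrier as_ring"
  using assms by fastforce

lemma edge_ideal_ideal:
  assumes "\<And>v w. {v, w} \<in> E \<Longrightarrow> v \<in> Vn n \<and> w \<in> Vn n"
  shows "sub_ideal (edge_ideal n E :: 'k vpoly set)"
  using ring.genideal_ideal[OF ring_as_ring edge_generators[OF assms]]
  by (simp add: edge_ideal_def poly_ring_eq ideal_as_ring_iff)

lemma edge_ideal_mem:
  assumes "\<And>v w. {v, w} \<in> E \<Longrightarrow> v \<in> Vn n \<and> w \<in> Vn n" "{v, w} \<in> E"
  shows "Var v * Var w \<in> (edge_ideal n E :: 'k vpoly set)"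
  using ring.genideal_self[OF ring_as_ring edge_generators[of E, OF assms(1)]] assms(2)
  unfolding edge_ideal_def poly_ring_eq by blast

lemma edge_ideal_least:
  assumes "sub_ideal L" "\<And>v w. {v, w} \<in> E \<Longrightarrow> Var v * Var w \<in> L"
  shows "(edge_ideal n E :: 'k vpoly set) \<subseteq> L"
  unfolding edge_ideal_def poly_ring_eq
  by (rule ring.genideal_minimal[OF ring_as_ring])
    (use assms in \<open>auto simp: ideal_as_ring_iff\<close>)

end

text \<open>The configuration excluded by Cohen-Macaulayness: the link of the face \<open>A\<close> of the independence
  complex is the disjoint union of the simplices on \<open>B\<close> and on \<open>C\<close>.\<close>

locale disconnected_link = vertex_ring n K for n :: nat and K :: "'k::field itself" +
  fixes E :: "vertex set set" and A Z B C :: "vertex set"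
  assumes vertices: "Vn n = A \<union> Z \<union> B \<union> C"
    and disjoint: "A \<inter> Z = {}" "A \<inter> B = {}" "A \<inter> C = {}" "Z \<inter> B = {}" "Z \<inter> C = {}" "B \<inter> C = {}"
    and edges: "\<And>v w. {v, w} \<in> E \<Longrightarrow> v \<in> Vn n \<and> w \<in> Vn n \<and>
      (v \<in> Z \<or> w \<in> Z \<or> v \<in> B \<and> w \<in> C \<or> v \<in> C \<and> w \<in> B)"
    and complete: "\<And>b c. \<lbrakk>b \<in> B; c \<in> C\<rbrakk> \<Longrightarrow> {b, c} \<in> E"
    and dominated: "\<And>z. z \<in> Z \<Longrightarrow> \<exists>a\<in>A. {a, z} \<in> E"
    and nonempty: "B \<noteq> {}" "C \<noteq> {}"
begin

abbreviation I :: "'k vpoly set" where "I \<equiv> edge_ideal n E"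

lemma I_ideal: "sub_ideal I"
  by (rule edge_ideal_ideal) (use edges in blast)

lemma I_mem: "{v, w} \<in> E \<Longrightarrow> Var v * Var w \<in> I"
  by (rule edge_ideal_mem) (use edges in blast)

sublocale quotient_setting S I
  by unfold_locales (rule I_ideal)

definition xB where "xB = (SOME b. b \<in> B)"
definition xC where "xC = (SOME c. c \<in> C)"

lemma xB: "xB \<in> B" and xC: "xC \<in> C"
  using nonempty unfolding xB_def xC_def by (simp_all add: some_in_eq)

lemma in_V: "a \<in> A \<Longrightarrow> a \<in> Vn n" "z \<in> Z \<Longrightarrow> z \<in> Vn n" "b \<in> B \<Longrightarrow> b \<in> Vn n" "c \<in> C \<Longrightarrow> c \<in> Vn n"
  using vertices by auto

lemma finites: "finite A" "finite Z" "finite B" "finite C"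
  using finite_Vn[of n] unfolding vertices by auto

section \<open>The point of the face \<open>A\<close> and the primes below its maximal ideal\<close>

definition point :: "vertex \<Rightarrow> 'k vpoly" where
  "point v = (if v \<in> A then 1 else 0)"

text \<open>Partial evaluation: for \<open>T\<close> inside \<open>Vn n\<close>, its kernel is the
  ideal generated by the \<open>Var v - point v\<close> with \<open>v\<close> in \<open>T\<close>,
  that is, the ideal of an affine subspace through the point.\<close>

definition at_point :: "vertex set \<Rightarrow> vertex \<Rightarrow> 'k vpoly" where
  "at_point T v = (if v \<in> T then point v else Var v)"

lemma at_point_in: "v \<in> Vn n \<Longrightarrow> at_point T v \<in> S"
  by (simp add: at_point_def point_def)

lemma ker_at_point_mono:
  assumes "T \<subset> T'" "T' \<subseteq> Vn n"
  shows "ker (at_point T) \<subset> ker (at_point T')"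
proof
  show "ker (at_point T) \<subseteq> ker (at_point T')"
  proof
    fix f assume f: "f \<in> ker (at_point T)"
    then have fS: "f \<in> S" by (simp add: ker_def)
    \<comment> \<open>\<open>at_point T'\<close> factors through \<open>at_point T\<close>.\<close>
    have "subst n (at_point T') f - subst n (at_point T') (subst n (at_point T) f) = 0"
    proof -
      have "f - subst n (at_point T) f \<in> ker (at_point T')"
        by (rule subst_cong_mod[OF ker_ideal at_point_in _ fS])
          (use assms in \<open>auto simp: ker_def at_point_def point_def\<close>)
      then show ?thesis by (simp add: ker_def)
    qed
    then show "f \<in> ker (at_point T')" using f by (simp add: ker_def)
  qed
  obtain v where v: "v \<in> T'" "v \<notin> T" using assms by blast
  then have vV: "v \<in> Vn n" using assms by blast
  have "point v - Var v \<noteq> 0"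
  proof
    assume *: "point v - Var v = 0"
    \<comment> \<open>The value is \<open>2 * point v - 1\<close>, which is 1 or -1 and so nonzero
      in every characteristic.\<close>
    have "subst n (\<lambda>w. 1 - point w) (point v - Var v) \<noteq> 0"
      using vV by (auto simp: point_def)
    then show False using * by simp
  qed
  then have "Var v - point v \<in> ker (at_point T')" "Var v - point v \<notin> ker (at_point T)"
    using v vV by (auto simp: ker_def at_point_def point_def)
  then show "ker (at_point T) \<noteq> ker (at_point T')" by blast
qed

definition M where "M = ker (at_point (Vn n))"

lemma subst_at_all: "f \<in> S \<Longrightarrow> \<exists>a. subst n (at_point (Vn n)) f = single 0 a"
proof (induction f rule: S_induct)
  case (Var v)
  then show ?case
    by (auto simp: at_point_def point_def intro: exI[of _ 1] exI[of _ 0])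
next
  case (add f g)
  then show ?case by (auto simp flip: single_add)
next
  case (mult f g)
  then show ?case by (auto simp: mult_single)
qed auto

lemma M_max:
  assumes "f \<in> S" "f \<notin> M"
  shows "\<exists>c\<in>S. c * f - 1 \<in> M"
proof -
  obtain a where a: "subst n (at_point (Vn n)) f = single 0 a"
    using subst_at_all[OF assms(1)] by blast
  then have "a \<noteq> 0" using assms by (auto simp: M_def ker_def)
  then have "single 0 (1 / a) * f - 1 \<in> M"
    using assms a by (simp add: M_def ker_def mult_single)
  then show ?thesis using const_in by blast
qed

section \<open>A maximal regular sequence at the point\<close>

definition units :: "'k vpoly list" where
  "units = map (\<lambda>a. Var a - 1) (sorted_list_of_set A)"

text \<open>Setting the variables of \<open>A\<close> to 1 forces those of \<open>Z\<close> to
  vanish. The quotient by \<open>J\<close> is therefore the Stanley-Reisner ring of the link, with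
  the products \<open>Var b * Var c\<close> as its relations.\<close>

definition J where "J = extends I units"

lemma set_units: "set units = (\<lambda>a. Var a - 1) ` A"
  using finites by (simp add: units_def)

lemma units_S: "set units \<subseteq> S"
  using in_V by (auto simp: set_units)

lemma J_ideal: "sub_ideal J"
  unfolding J_def by (rule extends_ideal[OF I_ideal units_S])

lemma J_mem: "a \<in> A \<Longrightarrow> Var a - 1 \<in> J" "{v, w} \<in> E \<Longrightarrow> Var v * Var w \<in> J"
  using extends_set[OF I_ideal units_S] extends_mono[of I units] I_mem[of v w]
  unfolding J_def set_units by blast+

lemma J_least: "\<lbrakk>sub_ideal L; \<And>v w. {v, w} \<in> E \<Longrightarrow> Var v * Var w \<in> L;
    \<And>a. a \<in> A \<Longrightarrow> Var a - 1 \<in> L\<rbrakk> \<Longrightarrow> J \<subseteq> L"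
  unfolding J_def by (rule extends_least) (auto simp: set_units edge_ideal_least)

lemma J_mem_Z: "z \<in> Z \<Longrightarrow> Var z \<in> J"
proof -
  assume z: "z \<in> Z"
  then obtain a where a: "a \<in> A" "{a, z} \<in> E" using dominated by blast
  have "Var a * Var z - (Var a - 1) * Var z \<in> J"
    by (intro sub_ideal_diff[OF J_ideal] sub_idealD(5)[OF J_ideal] J_mem a Var_in in_V(2)[OF z])
  then show ?thesis by (simp add: algebra_simps)
qed

text \<open>For \<open>a\<close> other than \<open>v\<close>, \<open>Var a - 1\<close> is
  homogeneous of degree 0 in \<open>v\<close>, and the monomials of the edges are homogeneous in
  every variable.\<close>

lemma graded_units:
  assumes "v \<in> Vn n" "set vs \<subseteq> Vn n" "v \<notin> set vs"
  shows "graded v (extends I (map (\<lambda>a. Var a - 1) vs))"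
proof -
  let ?J = "extends I (map (\<lambda>a. Var a - 1) vs)"
  have S: "set (map (\<lambda>a. Var a - 1) vs) \<subseteq> S" using assms(2) by auto
  have J: "sub_ideal ?J" by (rule extends_ideal[OF I_ideal S])
  note mem = extends_set[OF I_ideal S]
  have "?J \<subseteq> {f \<in> S. \<forall>i. part v i f \<in> ?J}"
  proof (rule extends_least[OF graded_core_ideal[OF J]])
    show "I \<subseteq> {f \<in> S. \<forall>i. part v i f \<in> ?J}"
    proof (rule edge_ideal_least[OF graded_core_ideal[OF J]])
      fix a b assume ab: "{a, b} \<in> E"
      have "part v i (Var a * Var b) \<in> {0, Var a * Var b}" for i
        by (simp add: Var_def vmonomial_def mult_single part_single)
      moreover have "Var a * Var b \<in> ?J" using I_mem[OF ab] extends_mono[of I] by blast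
      ultimately show "Var a * Var b \<in> {f \<in> S. \<forall>i. part v i f \<in> ?J}"
        using sub_idealD(2)[OF J] edges[OF ab] by (auto; metis)
    qed
    show "set (map (\<lambda>a. Var a - 1) vs) \<subseteq> {f \<in> S. \<forall>i. part v i f \<in> ?J}"
      using mem sub_idealD(2)[OF J] assms by (auto simp: part_Var part_one)
  qed
  then show ?thesis unfolding graded_def by blast
qed

lemma regular_seq_units:
  assumes "set vs \<subseteq> Vn n" "distinct vs"
  shows "regular_seq I (map (\<lambda>a. Var a - 1) vs)"
  using assms
proof (induction vs rule: rev_induct)
  case (snoc v vs)
  have "regular_on (extends I (map (\<lambda>a. Var a - 1) vs)) (Var v - 1)"
  proof (rule regular_on_Var_minus_one)
    show "sub_ideal (extends I (map (\<lambda>a. Var a - 1) vs))"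
      by (rule extends_ideal[OF I_ideal]) (use snoc.prems in auto)
  qed (use snoc.prems graded_units in auto)
  then show ?case using snoc by (simp add: regular_seq_append)
qed simp

text \<open>\<open>on_B\<close> and \<open>on_C\<close> are the restrictions to the two components
  of the link; \<open>J\<close> turns out to be the intersection of their kernels.\<close>

definition on_B :: "vertex \<Rightarrow> 'k vpoly" where
  "on_B v = (if v \<in> A then 1 else if v \<in> B then Var v else 0)"
definition on_C :: "vertex \<Rightarrow> 'k vpoly" where
  "on_C v = (if v \<in> A then 1 else if v \<in> C then Var v else 0)"

lemma on_in: "v \<in> Vn n \<Longrightarrow> on_B v \<in> S" "v \<in> Vn n \<Longrightarrow> on_C v \<in> S"
  by (auto simp: on_B_def on_C_def)

lemma J_on: "J \<subseteq> ker on_B" "J \<subseteq> ker on_C"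
proof -
  have *: "v \<notin> A \<and> v \<notin> B \<or> w \<notin> A \<and> w \<notin> B" "v \<notin> A \<and> v \<notin> C \<or> w \<notin> A \<and> w \<notin> C"
    if "{v, w} \<in> E" for v w
    using edges[OF that] disjoint by blast+
  show "J \<subseteq> ker on_B"
  proof (rule J_least[OF ker_ideal])
    fix v w assume e: "{v, w} \<in> E"
    then have "on_B v = 0 \<or> on_B w = 0" using * unfolding on_B_def by auto
    then show "Var v * Var w \<in> ker on_B" using edges[OF e] by (auto simp: ker_def)
  qed (use in_V in \<open>simp add: ker_def on_B_def\<close>)
  show "J \<subseteq> ker on_C"
  proof (rule J_least[OF ker_ideal])
    fix v w assume e: "{v, w} \<in> E"
    then have "on_C v = 0 \<or> on_C w = 0" using * unfolding on_C_def by auto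
    then show "Var v * Var w \<in> ker on_C" using edges[OF e] by (auto simp: ker_def)
  qed (use in_V in \<open>simp add: ker_def on_C_def\<close>)
qed

text \<open>Modulo \<open>I\<close> and the \<open>Var a - 1\<close>, the ring embeds into the product of the polynomial rings in the
  variables of \<open>B\<close> and of \<open>C\<close>.\<close>

lemma J_if_on:
  assumes f: "f \<in> S" "subst n on_B f = 0" "subst n on_C f = 0"
  shows "f \<in> J"
proof -
  \<comment> \<open>\<open>L\<close> collects the elements all of whose multiples are determined
    modulo \<open>J\<close> by \<open>on_C\<close>; the multiplier \<open>q\<close> makes it an
    ideal. It will contain every \<open>Var v - on_B v\<close>, hence also \<open>f\<close>.\<close>
  define L where "L = {p \<in> S. \<forall>q\<in>S. q * p - subst n on_C (q * p) \<in> J}"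
  have L: "sub_ideal L"
  proof (rule sub_idealI)
    fix a b assume ab: "a \<in> L" "b \<in> L"
    have "q * (a + b) - subst n on_C (q * (a + b)) \<in> J" if "q \<in> S" for q
    proof -
      have "(q * a - subst n on_C (q * a)) + (q * b - subst n on_C (q * b)) \<in> J"
        using ab that sub_idealD(3)[OF J_ideal] unfolding L_def by blast
      then show ?thesis by (simp add: algebra_simps)
    qed
    then show "a + b \<in> L" using ab unfolding L_def by simp
  next
    fix s a assume "s \<in> S" "a \<in> L"
    then show "s * a \<in> L" unfolding L_def by (auto simp flip: mult.assoc subst_mult)
  qed (auto simp: L_def sub_idealD(2)[OF J_ideal])
  have JL: "J \<subseteq> L"
  proof
    fix p assume p: "p \<in> J"
    then have "q * p - subst n on_C (q * p) \<in> J" if "q \<in> S" for q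
      using J_on(2) sub_idealD(4)[OF J_ideal that p] by (auto simp: ker_def)
    then show "p \<in> L" using p sub_idealD(1)[OF J_ideal] unfolding L_def by blast
  qed
  \<comment> \<open>Multiplication by \<open>Var c\<close> sends every \<open>Var v - on_C v\<close>
    into \<open>J\<close>; for \<open>v\<close> in \<open>B\<close> this is because
    \<open>{v, c}\<close> is an edge.\<close>
  have C: "Var c \<in> L" if c: "c \<in> C" for c
  proof -
    have ann: "sub_ideal (annihilator J (Var c))"
      using annihilator_ideal[OF J_ideal] in_V(4)[OF c] by simp
    have "Var v - on_C v \<in> annihilator J (Var c)" if v: "v \<in> Vn n" for v
    proof -
      consider "v \<in> A" | "v \<in> Z" | "v \<in> B" | "v \<in> C" using v vertices by blast
      then have "(Var v - on_C v) * Var c \<in> J"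
      proof cases
        case 1
        then show ?thesis using sub_idealD(5)[OF J_ideal Var_in[OF in_V(4)[OF c]] J_mem(1)[OF 1]] by (simp add: on_C_def)
      next
        case 2
        then have "on_C v = 0" using disjoint by (auto simp: on_C_def)
        then show ?thesis using sub_idealD(5)[OF J_ideal Var_in[OF in_V(4)[OF c]] J_mem_Z[OF 2]] by simp
      next
        case 3
        then have "on_C v = 0" using disjoint by (auto simp: on_C_def)
        then show ?thesis using J_mem(2)[OF complete[OF 3 c]] by simp
      next
        case 4
        then have "on_C v = Var v" using disjoint by (auto simp: on_C_def)
        then show ?thesis using sub_idealD(2)[OF J_ideal] by simp
      qed
      then show ?thesis using v on_in by (simp add: annihilator_def)
    qed
    note mod = this
    have ann_q: "q - subst n on_C q \<in> annihilator J (Var c)" if "q \<in> S" for q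
      by (rule subst_cong_mod[OF ann on_in(2) mod that])
    have on_c: "on_C c = Var c" using c disjoint by (auto simp: on_C_def)
    have "q * Var c - subst n on_C (q * Var c) \<in> J" if "q \<in> S" for q
    proof -
      have "(q - subst n on_C q) * Var c \<in> J"
        using ann_q[OF that] unfolding annihilator_def by blast
      then show ?thesis using on_c in_V(4)[OF c] by (simp add: left_diff_distrib)
    qed
    then show ?thesis using in_V(4)[OF c] by (simp add: L_def del: subst_mult)
  qed
  have "f - subst n on_B f \<in> L"
  proof (rule subst_cong_mod[OF L on_in(1) _ f(1)])
    fix v assume "v \<in> Vn n"
    then consider "v \<in> A" | "v \<in> Z" | "v \<in> B" | "v \<in> C" using vertices by blast
    then show "Var v - on_B v \<in> L"
    proof cases
      case 1
      then show ?thesis using JL J_mem(1) by (auto simp: on_B_def)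
    next
      case 2
      then have "on_B v = 0" using disjoint by (auto simp: on_B_def)
      then show ?thesis using JL J_mem_Z[OF 2] by auto
    next
      case 3
      then have "on_B v = Var v" using disjoint by (auto simp: on_B_def)
      then show ?thesis using sub_idealD(2)[OF L] by simp
    next
      case 4
      then have "on_B v = 0" using disjoint by (auto simp: on_B_def)
      then show ?thesis using C[OF 4] by simp
    qed
  qed
  then have "f \<in> L" using f(2) by simp
  then have "1 * f - subst n on_C (1 * f) \<in> J" unfolding L_def using one_in by blast
  then show ?thesis using f(3) by simp
qed

text \<open>The difference becomes \<open>Var xB\<close> under \<open>on_B\<close> and
  \<open>- Var xC\<close> under \<open>on_C\<close>, both nonzero in a domain. Neither variable
  alone would do, since it vanishes on the other component.\<close>

lemma regular_on_difference: "regular_on J (Var xB - Var xC)"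
  unfolding regular_on_def
proof (intro ballI impI)
  fix f assume f: "f \<in> S" "(Var xB - Var xC) * f \<in> J"
  have V: "xB \<in> Vn n" "xC \<in> Vn n" using xB xC in_V by auto
  have on: "on_B xB = Var xB" "on_B xC = 0" "on_C xB = 0" "on_C xC = Var xC"
    using xB xC disjoint by (auto simp: on_B_def on_C_def)
  have "subst n on_B ((Var xB - Var xC) * f) = 0" "subst n on_C ((Var xB - Var xC) * f) = 0"
    using f(2) J_on by (auto simp: ker_def)
  then have "subst n on_B f = 0" "subst n on_C f = 0" using V on by auto
  then show "f \<in> J" by (rule J_if_on[OF f(1)])
qed

definition hs where "hs = units @ [Var xB - Var xC]"

lemma regular_hs: "regular_seq I hs"
proof -
  have "regular_seq I units"
    unfolding units_def by (rule regular_seq_units) (use finites in_V in auto)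
  moreover have "Var xB - Var xC \<in> S" using xB xC in_V by auto
  ultimately show ?thesis
    using regular_on_difference by (simp add: hs_def regular_seq_append J_def)
qed

lemma length_hs: "length hs = card A + 1"
  using finites by (simp add: hs_def units_def)

lemma hs_M: "set hs \<subseteq> M"
  using xB xC in_V disjoint
  by (auto simp: hs_def set_units M_def ker_def at_point_def point_def)

definition J' where "J' = extend J (Var xB - Var xC)"

lemma J'_ideal: "sub_ideal J'"
  unfolding J'_def using extend_ideal[OF J_ideal] xB xC in_V by simp

text \<open>Identifying \<open>xC\<close> with \<open>xB\<close>, setting the variables of
  \<open>A\<close> to 1 and all others to 0 maps \<open>J'\<close> into the multiples of
  \<open>(Var xB)\<^sup>2\<close>, to which \<open>Var xB\<close> does not belong.\<close>

lemma socle_not_in: "Var xB \<notin> J'"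
proof
  assume "Var xB \<in> J'"
  define \<tau> :: "vertex \<Rightarrow> 'k vpoly" where "\<tau> v = (if v \<in> A then 1 else if v \<in> {xB, xC} then Var xB else 0)" for v
  have VB: "xB \<in> Vn n" using xB in_V by auto
  define L :: "'k vpoly set" where "L = {f \<in> S. (Var xB)\<^sup>2 dvd subst n \<tau> f}"
  have "J' \<subseteq> L"
    unfolding J'_def
  proof (rule extend_least)
    show L: "sub_ideal L" unfolding L_def by (rule sub_idealI) (auto intro: dvd_mult)
    show "J \<subseteq> L"
    proof (rule J_least[OF L])
      fix v w assume e: "{v, w} \<in> E"
      have "\<tau> v * \<tau> w \<in> {0, (Var xB)\<^sup>2}"
        using edges[OF e] disjoint xB xC unfolding \<tau>_def power2_eq_square by auto
      then show "Var v * Var w \<in> L" using edges[OF e] unfolding L_def by auto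
    qed (use in_V in \<open>auto simp: L_def \<tau>_def\<close>)
    show "Var xB - Var xC \<in> L"
      using xB xC in_V disjoint by (auto simp: L_def \<tau>_def)
  qed
  then have "(Var xB)\<^sup>2 dvd subst n \<tau> (Var xB)" using \<open>Var xB \<in> J'\<close> unfolding L_def by blast
  moreover have "\<tau> xB = Var xB" using xB disjoint by (auto simp: \<tau>_def)
  ultimately have "(Var xB :: 'k vpoly) * Var xB dvd Var xB * 1" using VB by (simp add: power2_eq_square)
  then have "(Var xB :: 'k vpoly) dvd 1" by (subst (asm) dvd_mult_cancel_left) simp
  then obtain g where "1 = Var xB * (g :: 'k vpoly)" by (elim dvdE)
  then have "subst n (\<lambda>_. 0) (1 :: 'k vpoly) = subst n (\<lambda>_. 0) (Var xB * g)" by simp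
  then show False using VB by simp
qed

text \<open>The witness is \<open>Var xB\<close>. Modulo \<open>J'\<close> it agrees with
  \<open>Var xC\<close>, so its product with a variable of \<open>B\<close> becomes an edge
  monomial; its product with a variable of \<open>C\<close> is one already.\<close>

lemma socle: "associated M (extends I hs)"
proof -
  have VB: "xB \<in> Vn n" and VC: "xC \<in> Vn n" using xB xC in_V by auto
  have JJ: "J \<subseteq> J'" unfolding J'_def by (rule extend_mono)
  have ann: "sub_ideal (annihilator J' (Var xB))"
    using annihilator_ideal[OF J'_ideal] VB by simp
  have hJ: "Var xB - Var xC \<in> J'" unfolding J'_def by (rule extend_self[OF sub_idealD(2)[OF J_ideal]])
  have sq: "Var xB * Var xB \<in> J'"
  proof -
    have "(Var xB - Var xC) * Var xB + Var xB * Var xC \<in> J'"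
      using sub_idealD(3)[OF J'_ideal sub_idealD(5)[OF J'_ideal Var_in[OF VB] hJ]]
        J_mem(2)[OF complete[OF xB xC]] JJ by blast
    then show ?thesis by (simp add: algebra_simps)
  qed
  have mod: "Var v - at_point (Vn n) v \<in> annihilator J' (Var xB)" if v: "v \<in> Vn n" for v
  proof -
    consider "v \<in> A" | "v \<in> Z" | "v \<in> B" | "v \<in> C" using v vertices by blast
    then have "(Var v - point v) * Var xB \<in> J'"
    proof cases
      case 1
      then show ?thesis using sub_idealD(5)[OF J_ideal Var_in[OF VB] J_mem(1)[OF 1]] JJ by (auto simp: point_def)
    next
      case 2
      then have "point v = 0" using disjoint by (auto simp: point_def)
      then show ?thesis using sub_idealD(5)[OF J_ideal Var_in[OF VB] J_mem_Z[OF 2]] JJ by auto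
    next
      case 3
      then have p: "point v = 0" using disjoint by (auto simp: point_def)
      have "Var v * (Var xB - Var xC) + Var v * Var xC \<in> J'"
        using sub_idealD(3)[OF J'_ideal sub_idealD(4)[OF J'_ideal Var_in[OF v] hJ]]
          J_mem(2)[OF complete[OF 3 xC]] JJ by blast
      then show ?thesis using p by (simp add: algebra_simps)
    next
      case 4
      then have "point v = 0" using disjoint by (auto simp: point_def)
      then show ?thesis using J_mem(2)[OF complete[OF xB 4]] JJ by (auto simp: mult.commute)
    qed
    then show ?thesis using v by (simp add: annihilator_def at_point_def point_def)
  qed
  have "f - subst n (at_point (Vn n)) f \<in> annihilator J' (Var xB)" if "f \<in> S" for f
    by (rule subst_cong_mod[OF ann at_point_in mod that])
  then have "f * Var xB \<in> J'" if "f \<in> M" for f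
    using that by (fastforce simp: M_def ker_def annihilator_def)
  then show ?thesis
    unfolding associated_def hs_def extends_simps J_def[symmetric] J'_def[symmetric]
    using socle_not_in Var_in[OF VB] by blast
qed

text \<open>The chain of primes starts with the coordinate subspace of the face
  \<open>A \<union> B\<close> and fixes its coordinates at the point one after the other. This takes
  \<open>card A + card B\<close> steps, against \<open>length hs = card A + 1\<close>.\<close>

theorem card_le_one_if_cohen_macaulay:
  assumes "cohen_macaulay_graph TYPE('k) n E"
  shows "card B \<le> 1"
proof -
  let ?k = "card (A \<union> B)"
  have fin: "finite (A \<union> B)" using finites by simp
  obtain g where g: "bij_betw g {..<?k} (A \<union> B)"
    using ex_bij_betw_nat_finite[OF fin] by (auto simp: atLeast0LessThan)
  define T where "T i = Z \<union> C \<union> g ` {..<i}" for i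
  have gV: "g i \<in> A \<union> B" if "i < ?k" for i using g that bij_betwE by fast
  have TV: "T i \<subseteq> Vn n" if "i \<le> ?k" for i
  proof -
    have "g ` {..<i} \<subseteq> A \<union> B" using gV that by (meson image_subsetI lessThan_iff less_le_trans)
    then show ?thesis unfolding T_def vertices by blast
  qed
  have "?k \<le> length hs"
  proof (rule cohen_macaulay_chain_le[where M = M and P = "\<lambda>i. ker (at_point (T i))"])
    show "cohen_macaulay_ring (as_ring Quot I)"
      using assms by (simp add: cohen_macaulay_graph_def poly_ring_eq)
    show "sub_ideal M" unfolding M_def by (rule ker_ideal)
    show "1 \<notin> M" by (simp add: M_def ker_def)
    have IT: "I \<subseteq> ker (at_point U)" if U: "Z \<union> C \<subseteq> U" for U
    proof (rule edge_ideal_least[OF ker_ideal])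
      fix v w assume e: "{v, w} \<in> E"
      then have "at_point U v = 0 \<or> at_point U w = 0"
        using edges[OF e] U disjoint unfolding at_point_def point_def by auto
      then show "Var v * Var w \<in> ker (at_point U)" using edges[OF e] by (auto simp: ker_def)
    qed
    show "I \<subseteq> M" unfolding M_def by (rule IT) (auto simp: vertices)
    show "\<exists>c\<in>S. c * f - 1 \<in> M" if "f \<in> S" "f \<notin> M" for f using M_max that .
    show "set hs \<subseteq> M" "regular_seq I hs" "associated M (extends I hs)"
      by (rule hs_M regular_hs socle)+
    show "sub_prime (ker (at_point (T i)))" for i by (rule ker_prime)
    show "I \<subseteq> ker (at_point (T 0))"
      by (rule IT) (simp add: T_def)
    show "ker (at_point (T i)) \<subset> ker (at_point (T (Suc i)))" if i: "i < ?k" for i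
    proof (rule ker_at_point_mono)
      have "g i \<notin> g ` {..<i}"
        using bij_betw_imp_inj_on[OF g] i by (auto dest: inj_onD)
      then have "g i \<notin> T i" using gV[OF i] disjoint unfolding T_def by blast
      then show "T i \<subset> T (Suc i)" unfolding T_def by (auto simp: lessThan_Suc)
      show "T (Suc i) \<subseteq> Vn n" using TV i by simp
    qed
    have "T ?k = Vn n" unfolding T_def vertices using bij_betw_imp_surj_on[OF g] by blast
    then show "ker (at_point (T ?k)) = M" by (simp add: M_def)
  qed
  then show ?thesis using length_hs card_Un_disjoint[OF finites(1,3) disjoint(2)] by simp
qed

end

section \<open>Facets of the independence complex\<close>

locale bip_graph =
  fixes n :: nat and E :: "vertex set set"
  assumes bip: "bipartite_graph n E"
begin

abbreviation Xs where "Xs \<equiv> X ` {1..n}"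
abbreviation Ys where "Ys \<equiv> Y ` {1..n}"

lemma Vn_eq: "Vn n = Xs \<union> Ys"
  by (simp add: Vn_def)

lemma XY_disjoint: "Xs \<inter> Ys = {}"
  by auto

lemma edgeE:
  assumes "{v, w} \<in> E"
  shows "v \<in> Xs \<and> w \<in> Ys \<or> v \<in> Ys \<and> w \<in> Xs"
proof -
  obtain i j where "{v, w} = {X i, Y j}" "i \<in> {1..n}" "j \<in> {1..n}"
    using bip assms unfolding bipartite_graph_def by blast
  then show ?thesis by (auto simp: doubleton_eq_iff)
qed

lemma edge_pair:
  assumes "e \<in> E"
  obtains v w where "e = {v, w}" "v \<in> Xs" "w \<in> Ys"
  using bip assms unfolding bipartite_graph_def by blast

definition indep :: "vertex set \<Rightarrow> bool" where
  "indep A \<longleftrightarrow> A \<subseteq> Vn n \<and> (\<forall>v\<in>A. \<forall>w\<in>A. {v, w} \<notin> E)"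

definition facet :: "vertex set \<Rightarrow> bool" where
  "facet F \<longleftrightarrow> indep F \<and> (\<forall>v\<in>Vn n - F. \<exists>w\<in>F. {v, w} \<in> E)"

lemma facet_iff_cover:
  assumes "F \<subseteq> Vn n"
  shows "facet F \<longleftrightarrow> minimal_vertex_cover n E (Vn n - F)"
proof
  assume F: "facet F"
  have "vertex_cover n E (Vn n - F)"
    unfolding vertex_cover_def
  proof (intro conjI ballI)
    fix e assume e: "e \<in> E"
    obtain v w where vw: "e = {v, w}" "v \<in> Xs" "w \<in> Ys" using edge_pair[OF e] .
    then have "v \<notin> F \<or> w \<notin> F" using F e unfolding facet_def indep_def by blast
    moreover have "v \<in> Vn n" "w \<in> Vn n" using vw Vn_eq by auto
    ultimately show "e \<inter> (Vn n - F) \<noteq> {}" using vw(1) by blast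
  qed blast
  moreover have "\<not> vertex_cover n E D" if D: "D \<subset> Vn n - F" for D
  proof -
    obtain v where v: "v \<in> Vn n - F" "v \<notin> D" using D by blast
    then obtain w where w: "w \<in> F" "{v, w} \<in> E" using F unfolding facet_def by blast
    then have "{v, w} \<inter> D = {}" using v D by auto
    then show ?thesis using w(2) unfolding vertex_cover_def by metis
  qed
  ultimately show "minimal_vertex_cover n E (Vn n - F)" unfolding minimal_vertex_cover_def by blast
next
  assume C: "minimal_vertex_cover n E (Vn n - F)"
  have "indep F"
    unfolding indep_def
  proof (intro conjI ballI notI)
    fix v w assume "v \<in> F" "w \<in> F" "{v, w} \<in> E"
    then have "{v, w} \<inter> (Vn n - F) \<noteq> {}"
      using C unfolding minimal_vertex_cover_def vertex_cover_def by metis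
    then show False using \<open>v \<in> F\<close> \<open>w \<in> F\<close> by simp
  qed (rule assms)
  moreover have "\<exists>w\<in>F. {v, w} \<in> E" if v: "v \<in> Vn n - F" for v
  proof (rule ccontr)
    assume neg: "\<not> ?thesis"
    have "vertex_cover n E (Vn n - F - {v})"
      unfolding vertex_cover_def
    proof (intro conjI ballI)
      fix e assume e: "e \<in> E"
      obtain a b where ab: "e = {a, b}" "a \<in> Xs" "b \<in> Ys" using edge_pair[OF e] .
      then have ne: "a \<noteq> b" by blast
      have "e \<inter> (Vn n - F) \<noteq> {}"
        using C e unfolding minimal_vertex_cover_def vertex_cover_def by metis
      then show "e \<inter> (Vn n - F - {v}) \<noteq> {}"
        using ab ne e neg Vn_eq by (auto simp: insert_commute)
    qed blast
    moreover have "Vn n - F - {v} \<subset> Vn n - F" using v by blast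
    ultimately show False using C unfolding minimal_vertex_cover_def by metis
  qed
  ultimately show "facet F" unfolding facet_def by blast
qed

lemma facet_subset: "facet F \<Longrightarrow> F \<subseteq> Vn n"
  unfolding facet_def indep_def by blast

lemma bij_facets_covers:
  "bij_betw (\<lambda>F. Vn n - F) {F. facet F} {C. minimal_vertex_cover n E C}"
proof (rule bij_betw_byWitness[where f' = "\<lambda>C. Vn n - C"])
  have sub: "C \<subseteq> Vn n" if "minimal_vertex_cover n E C" for C
    using that unfolding minimal_vertex_cover_def vertex_cover_def by blast
  show "\<forall>F\<in>{F. facet F}. Vn n - (Vn n - F) = F" using facet_subset by auto
  show "\<forall>C\<in>{C. minimal_vertex_cover n E C}. Vn n - (Vn n - C) = C" using sub by auto
  show "(\<lambda>F. Vn n - F) ` {F. facet F} \<subseteq> {C. minimal_vertex_cover n E C}"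
    using facet_iff_cover facet_subset by auto
  show "(\<lambda>C. Vn n - C) ` {C. minimal_vertex_cover n E C} \<subseteq> {F. facet F}"
  proof (intro image_subsetI CollectI, elim CollectE)
    fix C assume C: "minimal_vertex_cover n E C"
    then have "Vn n - (Vn n - C) = C" using sub by auto
    then show "facet (Vn n - C)" using facet_iff_cover[of "Vn n - C"] C by simp
  qed
qed

lemma card_facets: "card {F. facet F} = card {C. minimal_vertex_cover n E C}"
  using bij_betw_same_card[OF bij_facets_covers] .

lemma finite_facets: "finite {F. facet F}"
proof (rule finite_subset)
  show "{F. facet F} \<subseteq> Pow (Vn n)" using facet_subset by blast
qed simp

lemma indep_extend:
  assumes "indep A"
  shows "\<exists>F. facet F \<and> A \<subseteq> F"
  using assms
proof (induction "card (Vn n - A)" arbitrary: A rule: less_induct)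
  case less
  show ?case
  proof (cases "facet A")
    case False
    then obtain v where v: "v \<in> Vn n - A" "\<And>w. w \<in> A \<Longrightarrow> {v, w} \<notin> E"
      using less.prems unfolding facet_def by blast
    have "indep (insert v A)"
      using less.prems v edgeE[of v v] unfolding indep_def by (auto simp: insert_commute)
    moreover have "card (Vn n - insert v A) < card (Vn n - A)"
      using v by (intro psubset_card_mono) auto
    ultimately show ?thesis using less.hyps[of "insert v A"] by blast
  qed blast
qed

section \<open>Facets joined through faces of codimension one\<close>

definition adjacent :: "vertex set \<Rightarrow> vertex set \<Rightarrow> bool" where
  "adjacent F G \<longleftrightarrow> facet F \<and> facet G \<and> (\<exists>x y. x \<in> F \<and> y \<notin> F \<and> G = insert y (F - {x}))"

text \<open>Induction on the number of vertices outside the common face \<open>A\<close>;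
  \<open>B\<close> and \<open>C\<close> are the two sides of its link. If all \<open>b\<close>,
  \<open>c\<close> are joined by edges, the hypothesis leaves only the facets
  \<open>insert b A\<close> and \<open>insert c A\<close>, which are adjacent. Otherwise a non-edge
  gives a facet meeting both sides, and all facets above \<open>A\<close> reach it through larger
  common faces.\<close>

lemma facets_connected:
  assumes link: "\<And>A Z B C. \<lbrakk>indep A; Z = {z \<in> Vn n. \<exists>a\<in>A. {a, z} \<in> E}; B = Xs - A - Z; C = Ys - A - Z;
      B \<noteq> {}; C \<noteq> {}; \<And>b c. \<lbrakk>b \<in> B; c \<in> C\<rbrakk> \<Longrightarrow> {b, c} \<in> E\<rbrakk> \<Longrightarrow> card B = 1 \<and> card C = 1"
    and "indep A" "facet F" "facet G" "A \<subseteq> F" "A \<subseteq> G"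
  shows "adjacent\<^sup>*\<^sup>* F G"
  using assms(2-)
proof (induction "card (Vn n - A)" arbitrary: A F G rule: less_induct)
  case less
  have IH: "adjacent\<^sup>*\<^sup>* F' G'" if "facet F'" "facet G'" "insert v A \<subseteq> F'" "insert v A \<subseteq> G'" "v \<notin> A" for F' G' v
  proof (rule less.hyps[OF _ _ that(1-4)])
    have "indep F'" using that(1) unfolding facet_def by blast
    then show "indep (insert v A)" using that(3) unfolding indep_def by (meson subset_iff)
    have "v \<in> Vn n" using that facet_subset by blast
    then show "card (Vn n - insert v A) < card (Vn n - A)"
      using that by (intro psubset_card_mono) auto
  qed
  define Z where "Z = {z \<in> Vn n. \<exists>a\<in>A. {a, z} \<in> E}"
  define B where "B = Xs - A - Z"
  define C where "C = Ys - A - Z"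
  have AV: "A \<subseteq> Vn n" using less.prems unfolding indep_def by blast
  have sub: "H \<subseteq> A \<union> B \<union> C" if H: "facet H" "A \<subseteq> H" for H
  proof
    fix v assume v: "v \<in> H"
    then have "v \<notin> Z" using H unfolding Z_def facet_def indep_def by blast
    then show "v \<in> A \<union> B \<union> C" using v facet_subset[OF H(1)] Vn_eq unfolding B_def C_def by blast
  qed
  have indepB: "indep (A \<union> B)" and indepC: "indep (A \<union> C)"
  proof -
    have *: "{v, w} \<notin> E" if "v \<in> A" "w \<in> B \<union> C" for v w
      using that Vn_eq unfolding B_def C_def Z_def by blast
    have "{v, w} \<notin> E" if "v \<in> B" "w \<in> B" for v w
      using that edgeE[of v w] XY_disjoint unfolding B_def by blast
    then show "indep (A \<union> B)" using less.prems(1) * Vn_eq unfolding indep_def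
      by (auto simp: insert_commute B_def)
    have "{v, w} \<notin> E" if "v \<in> C" "w \<in> C" for v w
      using that edgeE[of v w] XY_disjoint unfolding C_def by blast
    then show "indep (A \<union> C)" using less.prems(1) * Vn_eq unfolding indep_def
      by (auto simp: insert_commute C_def)
  qed
  \<comment> \<open>An independent \<open>A \<union> B \<union> C\<close> is the only facet above
    \<open>A\<close>; this disposes of the case that one side is empty.\<close>
  have eq_if: "F = G" if D: "D = A \<union> B \<union> C" "indep D"
  for D
  proof -
    have "H = D" if H: "facet H" "A \<subseteq> H" for H
    proof
      show "H \<subseteq> D" using sub[OF H] D by simp
      show "D \<subseteq> H"
      proof
        fix v assume v: "v \<in> D"
        show "v \<in> H"
        proof (rule ccontr)
          assume "v \<notin> H"
          then obtain w where "w \<in> H" "{v, w} \<in> E"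
            using H v D(2) unfolding facet_def indep_def by blast
          then show False using v D(2) \<open>H \<subseteq> D\<close> unfolding indep_def by blast
        qed
      qed
    qed
    then show ?thesis using less.prems by metis
  qed
  show ?case
  proof (cases "F = G")
    case False
    have BC: "B \<noteq> {}" "C \<noteq> {}"
      using eq_if[of "A \<union> B \<union> C"] indepB indepC False by auto
    have proper: "\<exists>u. u \<in> H \<and> u \<in> B \<union> C" if H: "facet H" "A \<subseteq> H" for H
    proof (rule ccontr)
      assume "\<not> ?thesis"
      then have HA: "H = A" using sub[OF H] H by blast
      obtain b where b: "b \<in> B" using BC by blast
      then have "b \<in> Vn n - H" using HA unfolding B_def Vn_eq by blast
      then obtain w where "w \<in> A" "{b, w} \<in> E" using H HA unfolding facet_def by blast
      then show False using b indepB unfolding indep_def by blast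
    qed
    have notA: "v \<notin> A" if "v \<in> B \<union> C" for v using that unfolding B_def C_def by blast
    show ?thesis
    proof (cases "\<forall>b\<in>B. \<forall>c\<in>C. {b, c} \<in> E")
      case True
      then have "card B = 1 \<and> card C = 1"
        using link[OF less.prems(1) Z_def B_def C_def BC] by blast
      then obtain b c where bc: "B = {b}" "C = {c}" by (meson card_1_singletonE)
      have "{b, c} \<in> E" using True bc by blast
      have form: "H = insert b A \<or> H = insert c A" if H: "facet H" "A \<subseteq> H" for H
      proof -
        have "\<not> (b \<in> H \<and> c \<in> H)" using H \<open>{b, c} \<in> E\<close> unfolding facet_def indep_def by blast
        then show ?thesis using proper[OF H] sub[OF H] H bc by blast
      qed
      have ne: "b \<noteq> c" using bc XY_disjoint unfolding B_def C_def by blast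
      have nA: "b \<notin> A" "c \<notin> A" using notA bc by auto
      have "adjacent F G"
      proof (cases "F = insert b A")
        case True
        then have "G = insert c (F - {b})"
          using form[of G] less.prems \<open>F \<noteq> G\<close> nA by auto
        moreover have "b \<in> F" "c \<notin> F" using True ne nA by auto
        ultimately show ?thesis using less.prems unfolding adjacent_def by blast
      next
        case False
        then have F: "F = insert c A" using form[of F] less.prems by blast
        then have "G = insert b (F - {c})"
          using form[of G] less.prems \<open>F \<noteq> G\<close> nA by auto
        moreover have "c \<in> F" "b \<notin> F" using F ne nA by auto
        ultimately show ?thesis using less.prems unfolding adjacent_def by blast
      qed
      then show ?thesis by blast
    next
      case False
      then obtain b c where bc: "b \<in> B" "c \<in> C" "{b, c} \<notin> E" by blast
      have "indep (insert b (insert c A))"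
        using indepB indepC bc edgeE[of b b] edgeE[of c c] XY_disjoint
        unfolding indep_def by (auto simp: insert_commute)
      then obtain M where M: "facet M" "insert b (insert c A) \<subseteq> M" using indep_extend by blast
      obtain HB where HB: "facet HB" "A \<union> B \<subseteq> HB" using indep_extend[OF indepB] by blast
      obtain HC where HC: "facet HC" "A \<union> C \<subseteq> HC" using indep_extend[OF indepC] by blast
      \<comment> \<open>\<open>H\<close> shares a vertex \<open>u\<close> of the link with
        \<open>HB\<close> or \<open>HC\<close>, and these share \<open>b\<close> or \<open>c\<close>
        with \<open>M\<close>; each of the common faces is larger than \<open>A\<close>.\<close>
      have via: "adjacent\<^sup>*\<^sup>* H M \<and> adjacent\<^sup>*\<^sup>* M H" if H: "facet H" "A \<subseteq> H" for H
      proof -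
        obtain u where u: "u \<in> H" "u \<in> B \<union> C" using proper[OF H] by blast
        show ?thesis
        proof (cases "u \<in> B")
          case True
          have "adjacent\<^sup>*\<^sup>* H HB" "adjacent\<^sup>*\<^sup>* HB H"
            using IH[of H HB u] IH[of HB H u] H HB u notA[OF u(2)] True by auto
          moreover have "adjacent\<^sup>*\<^sup>* HB M" "adjacent\<^sup>*\<^sup>* M HB"
            using IH[of M HB b] IH[of HB M b] M HB bc notA[of b] by auto
          ultimately show ?thesis by (meson rtranclp_trans)
        next
          case False
          then have "u \<in> C" using u by blast
          then have "adjacent\<^sup>*\<^sup>* H HC" "adjacent\<^sup>*\<^sup>* HC H"
            using IH[of H HC u] IH[of HC H u] H HC u notA[OF u(2)] by auto
          moreover have "adjacent\<^sup>*\<^sup>* HC M" "adjacent\<^sup>*\<^sup>* M HC"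
            using IH[of M HC c] IH[of HC M c] M HC bc notA[of c] by auto
          ultimately show ?thesis by (meson rtranclp_trans)
        qed
      qed
      then show ?thesis using less.prems by (meson rtranclp_trans)
    qed
  qed simp
qed

text \<open>The ring-theoretic bound concerns one side of the link, so it is applied twice, with
  \<open>B\<close> and \<open>C\<close> exchanged.\<close>

lemma link_if_cohen_macaulay:
  assumes CM: "cohen_macaulay_graph TYPE('k::field) n E"
    and A: "indep A" and Z: "Z = {z \<in> Vn n. \<exists>a\<in>A. {a, z} \<in> E}"
    and B: "B = Xs - A - Z" and C: "C = Ys - A - Z"
    and ne: "B \<noteq> {}" "C \<noteq> {}" and complete: "\<And>b c. \<lbrakk>b \<in> B; c \<in> C\<rbrakk> \<Longrightarrow> {b, c} \<in> E"
  shows "card B = 1 \<and> card C = 1"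
proof -
  have AZ: "A \<inter> Z = {}" using A unfolding Z indep_def by blast
  have verts: "Vn n = A \<union> Z \<union> B \<union> C" using A unfolding B C Z indep_def Vn_eq by blast
  have disj: "A \<inter> B = {}" "A \<inter> C = {}" "Z \<inter> B = {}" "Z \<inter> C = {}" "B \<inter> C = {}"
    using XY_disjoint unfolding B C by blast+
  have edges: "v \<in> Vn n \<and> w \<in> Vn n \<and> (v \<in> Z \<or> w \<in> Z \<or> v \<in> B \<and> w \<in> C \<or> v \<in> C \<and> w \<in> B)"
    if e: "{v, w} \<in> E" for v w
  proof -
    have V: "v \<in> Vn n" "w \<in> Vn n" using edgeE[OF e] Vn_eq by auto
    have "v \<in> A \<Longrightarrow> w \<in> Z" "w \<in> A \<Longrightarrow> v \<in> Z"
      using e V unfolding Z by (auto simp: insert_commute)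
    then show ?thesis using edgeE[OF e] V unfolding B C by blast
  qed
  have dom: "\<exists>a\<in>A. {a, z} \<in> E" if "z \<in> Z" for z using that unfolding Z by blast
  interpret BC: disconnected_link n "TYPE('k)" E A Z B C
    by unfold_locales (fact verts AZ disj edges complete dom ne)+
  have verts': "Vn n = A \<union> Z \<union> C \<union> B" using verts by blast
  interpret CB: disconnected_link n "TYPE('k)" E A Z C B
  proof unfold_locales
    show "v \<in> Vn n \<and> w \<in> Vn n \<and> (v \<in> Z \<or> w \<in> Z \<or> v \<in> C \<and> w \<in> B \<or> v \<in> B \<and> w \<in> C)"
      if "{v, w} \<in> E" for v w using edges[OF that] by (elim conjE disjE) simp_all
    show "{c, b} \<in> E" if "c \<in> C" "b \<in> B" for c b
      using complete[OF that(2,1)] by (simp add: insert_commute)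
    show "C \<inter> B = {}" using disj by blast
  qed (fact verts' AZ disj dom ne)+
  have "card B \<noteq> 0" "card C \<noteq> 0" using ne BC.finites by auto
  then show ?thesis
    using BC.card_le_one_if_cohen_macaulay[OF CM] CB.card_le_one_if_cohen_macaulay[OF CM] by linarith
qed

end

section \<open>Counting facets\<close>

lemma equal_up_to_relabellingI:
  assumes "bij_betw \<psi> (Vn n) (Vn n)" "\<And>e. e \<in> F \<Longrightarrow> e \<subseteq> Vn n"
  shows "equal_up_to_relabelling n ((`) \<psi> ` F) F"
  unfolding equal_up_to_relabelling_def
proof (intro exI conjI)
  show "bij_betw (inv_into (Vn n) \<psi>) (Vn n) (Vn n)" using assms(1) by (rule bij_betw_inv_into)
  have "inv_into (Vn n) \<psi> ` \<psi> ` e = e" if "e \<in> F" for e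
    using assms that bij_betw_imp_inj_on by (intro inv_into_image_cancel) blast+
  then show "(\<lambda>e. inv_into (Vn n) \<psi> ` e) ` (`) \<psi> ` F = F"
    unfolding image_image by simp
qed

lemma equal_up_to_relabellingE:
  assumes "equal_up_to_relabelling n E F" "\<And>e. e \<in> E \<Longrightarrow> e \<subseteq> Vn n"
  obtains \<psi> where "bij_betw \<psi> (Vn n) (Vn n)" "E = (`) \<psi> ` F"
proof -
  obtain \<phi> where \<phi>: "bij_betw \<phi> (Vn n) (Vn n)" "(\<lambda>e. \<phi> ` e) ` E = F"
    using assms(1) unfolding equal_up_to_relabelling_def by blast
  have "inv_into (Vn n) \<phi> ` \<phi> ` e = e" if "e \<in> E" for e
    using assms(2) \<phi>(1) that bij_betw_imp_inj_on by (intro inv_into_image_cancel) blast+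
  then have "(`) (inv_into (Vn n) \<phi>) ` F = E"
    unfolding \<phi>(2)[symmetric] image_image by simp
  then show thesis using that bij_betw_inv_into[OF \<phi>(1)] by blast
qed

lemma card_X_image [simp]: "card (X ` A) = card A" and card_Y_image [simp]: "card (Y ` A) = card A"
  by (simp_all add: card_image inj_on_def)

context bip_graph
begin

lemma poset_graph_subset_Vn:
  "\<lbrakk>r \<subseteq> {1..n} \<times> {1..n}; e \<in> poset_graph r\<rbrakk> \<Longrightarrow> e \<subseteq> Vn n"
  by (auto simp: poset_graph_def Vn_def)

lemma relabelled_poset_graphI:
  assumes p: "bij_betw p {1..n} Xs" and q: "bij_betw q {1..n} Ys"
    and r: "r \<subseteq> {1..n} \<times> {1..n}" and E: "\<And>i j. \<lbrakk>i \<in> {1..n}; j \<in> {1..n}\<rbrakk> \<Longrightarrow> {p i, q j} \<in> E \<longleftrightarrow> (i, j) \<in> r"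
  shows "equal_up_to_relabelling n E (poset_graph r)"
proof -
  define \<psi> where "\<psi> = case_vertex p q"
  have "bij_betw \<psi> Xs Xs"
  proof (rule bij_betw_imageI)
    show "inj_on \<psi> Xs" using bij_betw_imp_inj_on[OF p]
      by (intro inj_on_imageI) (simp add: \<psi>_def comp_def)
    show "\<psi> ` Xs = Xs" using bij_betw_imp_surj_on[OF p] by (simp add: \<psi>_def image_image)
  qed
  moreover have "bij_betw \<psi> Ys Ys"
  proof (rule bij_betw_imageI)
    show "inj_on \<psi> Ys" using bij_betw_imp_inj_on[OF q]
      by (intro inj_on_imageI) (simp add: \<psi>_def comp_def)
    show "\<psi> ` Ys = Ys" using bij_betw_imp_surj_on[OF q] by (simp add: \<psi>_def image_image)
  qed
  ultimately have \<psi>: "bij_betw \<psi> (Vn n) (Vn n)"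
    unfolding Vn_eq using XY_disjoint by (intro bij_betw_combine)
  have "E = (`) \<psi> ` poset_graph r"
  proof (intro equalityI subsetI)
    fix e assume e: "e \<in> E"
    then obtain v w where vw: "e = {v, w}" "v \<in> Xs" "w \<in> Ys" using edge_pair by blast
    obtain i j where ij: "i \<in> {1..n}" "v = p i" "j \<in> {1..n}" "w = q j"
      using vw p q unfolding bij_betw_def by (metis imageE)
    then have "(i, j) \<in> r" using E e vw by simp
    then have "{X i, Y j} \<in> poset_graph r" unfolding poset_graph_def by blast
    moreover have "e = \<psi> ` {X i, Y j}" using ij vw by (simp add: \<psi>_def)
    ultimately show "e \<in> (`) \<psi> ` poset_graph r" by blast
  next
    fix e assume "e \<in> (`) \<psi> ` poset_graph r"
    then obtain i j where ij: "(i, j) \<in> r" "e = \<psi> ` {X i, Y j}" unfolding poset_graph_def by auto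
    then have "e = {p i, q j}" by (simp add: \<psi>_def)
    then show "e \<in> E" using E[of i j] ij(1) r by auto
  qed
  then show ?thesis using equal_up_to_relabellingI[OF \<psi>] poset_graph_subset_Vn[OF r] by simp
qed

section \<open>A path of facets from one side of the graph to the other\<close>

definition level :: "vertex set \<Rightarrow> nat" where
  "level F = card (F \<inter> Ys)"

text \<open>Only one vertex enters, so the level cannot rise by more than one, and it rises only if
  the entering vertex is in \<open>Ys\<close> and the leaving one is not.\<close>

lemma adjacentE:
  assumes "adjacent F G" "level F < level G"
  obtains x y where "x \<in> F" "x \<in> Xs" "y \<in> Ys" "y \<notin> F" "G = insert y (F - {x})" "level G = Suc (level F)"
proof -
  obtain x y where xy: "x \<in> F" "y \<notin> F" "G = insert y (F - {x})" and fac: "facet F" "facet G"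
    using assms(1) unfolding adjacent_def by blast
  have fin: "finite (F \<inter> Ys)" by simp
  have y: "y \<in> Ys"
  proof (rule ccontr)
    assume "y \<notin> Ys"
    then have "G \<inter> Ys \<subseteq> F \<inter> Ys" unfolding xy(3) by blast
    then have "card (G \<inter> Ys) \<le> card (F \<inter> Ys)" by (rule card_mono[OF fin])
    then show False using assms(2) unfolding level_def by simp
  qed
  have x: "x \<notin> Ys"
  proof
    assume "x \<in> Ys"
    then have "G \<inter> Ys = insert y (F \<inter> Ys - {x})" "x \<in> F \<inter> Ys" using xy y by auto
    then have "level G = level F"
      unfolding level_def using fin xy card_Suc_Diff1[of "F \<inter> Ys" x] by simp
    then show False using assms(2) by simp
  qed
  then have "G \<inter> Ys = insert y (F \<inter> Ys)" using xy y by auto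
  then have "level G = Suc (level F)" unfolding level_def using fin xy by simp
  moreover have "x \<in> Xs" using x xy facet_subset[OF fac(1)] Vn_eq by blast
  ultimately show thesis using that xy y by blast
qed

text \<open>A discrete intermediate value argument: a path of exchanges cannot skip a level on its
  way up.\<close>

lemma level_crossing:
  assumes "adjacent\<^sup>*\<^sup>* F G" "level F \<le> k" "k < level G"
  shows "\<exists>F' G'. adjacent F' G' \<and> level F' = k \<and> level G' = Suc k"
  using assms
proof (induction rule: rtranclp_induct)
  case (step G H)
  show ?case
  proof (cases "k < level G")
    case False
    then have "level G < level H" using step.prems by simp
    then have "level H = Suc (level G)" using adjacentE[OF step.hyps(2)] by metis
    then show ?thesis using False step by (intro exI[of _ G] exI[of _ H]) auto
  qed (use step in blast)
qed simp

lemma facet_Xs_Ys: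
  assumes "no_isolated_vertices n E"
  shows "facet Xs" "facet Ys"
proof -
  have *: "\<exists>w. {v, w} \<in> E" if v: "v \<in> Vn n" for v
  proof -
    obtain e where e: "e \<in> E" "v \<in> e" using assms v unfolding no_isolated_vertices_def by blast
    then obtain a b where "e = {a, b}" using edge_pair by metis
    then show ?thesis using e by (auto simp: insert_commute)
  qed
  have "\<exists>w\<in>Xs. {v, w} \<in> E" if v: "v \<in> Vn n - Xs" for v
  proof -
    obtain w where w: "{v, w} \<in> E" using * v by blast
    then have "w \<in> Xs" using edgeE[OF w] v by blast
    then show ?thesis using w by blast
  qed
  moreover have "\<exists>w\<in>Ys. {v, w} \<in> E" if v: "v \<in> Vn n - Ys" for v
  proof -
    obtain w where w: "{v, w} \<in> E" using * v by blast
    then have "w \<in> Ys" using edgeE[OF w] v by blast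
    then show ?thesis using w by blast
  qed
  moreover have "indep Xs" "indep Ys"
    unfolding indep_def using Vn_eq edgeE XY_disjoint by blast+
  ultimately show "facet Xs" "facet Ys" unfolding facet_def by blast+
qed

text \<open>The path meets all n + 1 levels, so each level holds exactly one facet and consecutive
  facets differ by an exchange. The order in which vertices leave and enter is the labelling:
  \<open>p i\<close> and \<open>q j\<close> lie in a common facet iff \<open>j < i\<close>, so they
  are joined iff \<open>i \<le> j\<close>.\<close>

lemma chain_if_card_facets:
  assumes iso: "no_isolated_vertices n E" and conn: "adjacent\<^sup>*\<^sup>* Xs Ys"
    and card: "card {F. facet F} = n + 1"
  shows "comes_from_chain n E"
proof -
  have lev: "level Xs = 0" "level Ys = n"
    using XY_disjoint by (simp_all add: level_def)
  have le: "level F \<le> n" for F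
  proof -
    have "card (F \<inter> Ys) \<le> card Ys" by (rule card_mono) auto
    then show ?thesis by (simp add: level_def)
  qed
  have cross: "\<exists>F G. adjacent F G \<and> level F = k \<and> level G = Suc k" if "k < n" for k
    using level_crossing[OF conn] lev that by simp
  have "{0..n} \<subseteq> level ` {F. facet F}"
  proof
    fix k assume k: "k \<in> {0..n}"
    show "k \<in> level ` {F. facet F}"
    proof (cases "k = n")
      case True
      then show ?thesis using facet_Xs_Ys(2)[OF iso] lev by force
    next
      case False
      then show ?thesis using cross[of k] k unfolding adjacent_def by force
    qed
  qed
  then have img: "level ` {F. facet F} = {0..n}" using le by auto
  then have inj: "inj_on level {F. facet F}"
    using card finite_facets by (intro eq_card_imp_inj_on) simp_all
  have uniq: "F = G" if "facet F" "facet G" "level F = level G" for F G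
    using inj that unfolding inj_on_def by blast
  have "\<exists>F. facet F \<and> level F = k" if "k \<le> n" for k
  proof -
    have "k \<in> level ` {F. facet F}" using img that by simp
    then show ?thesis by blast
  qed
  then obtain Fc where Fc: "\<And>k. k \<le> n \<Longrightarrow> facet (Fc k) \<and> level (Fc k) = k" by metis
  have "\<exists>x y. x \<in> Fc k \<and> x \<in> Xs \<and> y \<in> Ys \<and> y \<notin> Fc k \<and> Fc (Suc k) = insert y (Fc k - {x})"
    if k: "k < n" for k
  proof -
    obtain F G where FG: "adjacent F G" "level F = k" "level G = Suc k" using cross[OF k] by blast
    then have "F = Fc k" "G = Fc (Suc k)"
      using uniq Fc k unfolding adjacent_def by auto
    then show ?thesis using adjacentE[OF FG(1)] FG by (metis lessI)
  qed
  then obtain x y where xy: "\<And>k. k < n \<Longrightarrow> x k \<in> Fc k \<and> x k \<in> Xs \<and> y k \<in> Ys \<and> y k \<notin> Fc k \<and>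
      Fc (Suc k) = insert (y k) (Fc k - {x k})" by metis
  \<comment> \<open>Index shift: the step from level \<open>i - 1\<close> to level \<open>i\<close>
    replaces \<open>p i\<close> by \<open>q i\<close>, so labels start at 1.\<close>
  define p where "p i = x (i - 1)" for i
  define q where "q i = y (i - 1)" for i
  have struct: "Fc k = q ` {1..k} \<union> (Xs - p ` {1..k}) \<and> inj_on p {1..k} \<and> inj_on q {1..k} \<and>
      p ` {1..k} \<subseteq> Xs \<and> q ` {1..k} \<subseteq> Ys" if "k \<le> n" for k
    using that
  proof (induction k)
    case 0
    then show ?case using uniq[of "Fc 0" Xs] Fc[of 0] facet_Xs_Ys[OF iso] lev by simp
  next
    case (Suc k)
    note IH = Suc.IH[OF Suc_leD[OF Suc.prems]]
    have k: "k < n" using Suc.prems by simp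
    have pq: "p (Suc k) = x k" "q (Suc k) = y k" by (simp_all add: p_def q_def)
    have new: "p (Suc k) \<notin> p ` {1..k}" "q (Suc k) \<notin> q ` {1..k}" "p (Suc k) \<in> Xs" "q (Suc k) \<in> Ys"
    proof -
      have IH': "Fc k = q ` {1..k} \<union> (Xs - p ` {1..k})" "q ` {1..k} \<subseteq> Ys" using IH by blast+
      show "q (Suc k) \<notin> q ` {1..k}" "p (Suc k) \<in> Xs" "q (Suc k) \<in> Ys"
        using xy[OF k] IH'(1) unfolding pq by blast+
      have "p (Suc k) \<in> Fc k" "p (Suc k) \<in> Xs" using xy[OF k] unfolding pq by blast+
      then show "p (Suc k) \<notin> p ` {1..k}" using IH' XY_disjoint by blast
    qed
    have at: "{1..Suc k} = insert (Suc k) {1..k}" by auto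
    have "Fc (Suc k) = insert (q (Suc k)) (Fc k - {p (Suc k)})" using xy[OF k] unfolding pq by blast
    also have "\<dots> = q ` {1..Suc k} \<union> (Xs - p ` {1..Suc k})"
    proof -
      have "Fc k = q ` {1..k} \<union> (Xs - p ` {1..k})" "p (Suc k) \<notin> q ` {1..k}"
        using IH new(3) XY_disjoint by blast+
      then show ?thesis unfolding at image_insert by blast
    qed
    finally show ?case using IH new unfolding at by (auto simp: inj_on_insert)
  qed
  have pb: "bij_betw p {1..n} Xs" and qb: "bij_betw q {1..n} Ys"
    using struct[of n] by (simp_all add: bij_betw_def card_image card_subset_eq)
  define r where "r = {(i, j). 1 \<le> i \<and> i \<le> j \<and> j \<le> n}"
  have iff: "{p i, q j} \<in> E \<longleftrightarrow> (i, j) \<in> r" if ij: "i \<in> {1..n}" "j \<in> {1..n}" for i j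
  proof -
    have mem: "q j \<in> Fc k \<longleftrightarrow> j \<le> k" "p i \<in> Fc k \<longleftrightarrow> k < i" if k: "k \<le> n" for k
    proof -
      have X: "p i \<in> Xs" "q j \<in> Ys" using ij pb qb bij_betwE by blast+
      have "q j \<in> q ` {1..k} \<longleftrightarrow> j \<in> {1..k}"
        using inj_on_image_mem_iff[OF bij_betw_imp_inj_on[OF qb] ij(2), of "{1..k}"] k by auto
      then show "q j \<in> Fc k \<longleftrightarrow> j \<le> k" using struct[OF k] X XY_disjoint ij by auto
      have "p i \<in> p ` {1..k} \<longleftrightarrow> i \<in> {1..k}"
        using inj_on_image_mem_iff[OF bij_betw_imp_inj_on[OF pb] ij(1), of "{1..k}"] k by auto
      then show "p i \<in> Fc k \<longleftrightarrow> k < i" using struct[OF k] X XY_disjoint ij by auto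
    qed
    have XY: "p i \<in> Xs" "q j \<in> Ys" using ij pb qb bij_betwE by blast+
    show ?thesis
    proof (cases "i \<le> j")
      case False
      then have "p i \<in> Fc j" "q j \<in> Fc j" using mem[of j] ij by auto
      then have "{p i, q j} \<notin> E" using Fc[of j] ij unfolding facet_def indep_def by auto
      then show ?thesis using False by (simp add: r_def)
    next
      case True
      \<comment> \<open>A non-edge would extend to a facet, which is \<open>Fc k\<close> for its
        level \<open>k\<close>; then \<open>j \<le> k\<close> and \<open>k < i\<close>, against
        \<open>i \<le> j\<close>.\<close>
      have "{p i, q j} \<in> E"
      proof (rule ccontr)
        assume "{p i, q j} \<notin> E"
        then have "indep {p i, q j}"
          using XY edgeE[of "p i" "p i"] edgeE[of "q j" "q j"] XY_disjoint Vn_eq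
          unfolding indep_def by (auto simp: insert_commute)
        then obtain F where F: "facet F" "{p i, q j} \<subseteq> F" using indep_extend by blast
        have "F = Fc (level F)" using uniq Fc le F by metis
        then have "j \<le> level F" "level F < i" using mem[of "level F"] le F by auto
        then show False using True by simp
      qed
      then show ?thesis using True ij by (simp add: r_def)
    qed
  qed
  have sub: "r \<subseteq> {1..n} \<times> {1..n}" by (auto simp: r_def)
  have "naturally_labelled_poset n r"
    unfolding naturally_labelled_poset_def partial_order_on_def preorder_on_def
    by (auto simp: r_def refl_on_def trans_def antisym_def)
  moreover have "total_on {1..n} r" by (auto simp: total_on_def r_def)
  ultimately show ?thesis
    unfolding comes_from_chain_def using relabelled_poset_graphI[OF pb qb sub iff] by blast
qed

section \<open>Graphs with the largest possible number of facets\<close>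

lemma facet_determined:
  assumes "facet F" "facet G" "F \<inter> Xs = G \<inter> Xs"
  shows "F \<subseteq> G"
proof
  fix v assume v: "v \<in> F"
  show "v \<in> G"
  proof (rule ccontr)
    assume "v \<notin> G"
    moreover have "v \<in> Vn n" using v facet_subset[OF assms(1)] by blast
    ultimately have vY: "v \<in> Ys" "v \<in> Vn n - G" using v assms(3) unfolding Vn_eq by auto
    then obtain w where w: "w \<in> G" "{v, w} \<in> E" using assms(2) unfolding facet_def by blast
    then have "w \<in> F" using edgeE[OF w(2)] vY XY_disjoint assms(3) by blast
    then show False using assms(1) v w unfolding facet_def indep_def by blast
  qed
qed

text \<open>A vertex of \<open>Ys\<close> belongs to a facet iff none of its neighbours does, so the
  part in \<open>Xs\<close> determines the facet.\<close>

lemma inj_facet_X: "inj_on (\<lambda>F. F \<inter> Xs) {F. facet F}"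
  by (rule inj_onI) (simp add: facet_determined subset_antisym)

lemma card_facets_le: "card {F. facet F} \<le> 2 ^ n"
proof -
  have "card ((\<lambda>F. F \<inter> Xs) ` {F. facet F}) \<le> card (Pow Xs)" by (rule card_mono) auto
  then show ?thesis using card_image[OF inj_facet_X] by (simp add: card_Pow)
qed

text \<open>Every subset of \<open>Xs\<close> is the part of some facet. In the facet with part
  \<open>Xs - {X i}\<close>, the vertex \<open>X i\<close> is missing because of a neighbour
  \<open>Y j\<close>, and independence leaves \<open>Y j\<close> no neighbour other than
  \<open>X i\<close>.\<close>

lemma antichain_if_card_facets:
  assumes card: "card {F. facet F} = 2 ^ n"
  shows "comes_from_antichain n E"
proof -
  have "(\<lambda>F. F \<inter> Xs) ` {F. facet F} = Pow Xs"
  proof (rule card_subset_eq)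
    show "card ((\<lambda>F. F \<inter> Xs) ` {F. facet F}) = card (Pow Xs)"
      using card_image[OF inj_facet_X] card by (simp add: card_Pow)
  qed auto
  then have ex: "\<exists>F. facet F \<and> F \<inter> Xs = T" if "T \<subseteq> Xs" for T using that by (auto simp: image_iff set_eq_iff) metis
  have "\<exists>j\<in>{1..n}. \<forall>k\<in>{1..n}. {X k, Y j} \<in> E \<longleftrightarrow> k = i" if i: "i \<in> {1..n}" for i
  proof -
    obtain F where F: "facet F" "F \<inter> Xs = Xs - {X i}" using ex[of "Xs - {X i}"] by blast
    have "X i \<in> Vn n - F" using i F Vn_eq by auto
    then obtain w where w: "w \<in> F" "{X i, w} \<in> E" using F unfolding facet_def by blast
    then obtain j where j: "w = Y j" "j \<in> {1..n}" using edgeE[OF w(2)] by auto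
    have "{X k, Y j} \<notin> E" if k: "k \<in> {1..n}" "k \<noteq> i" for k
    proof -
      have "X k \<in> F" using F(2) k by auto
      then show ?thesis using F(1) w j unfolding facet_def indep_def by auto
    qed
    then show ?thesis using w j by blast
  qed
  then obtain s where s: "\<And>i. i \<in> {1..n} \<Longrightarrow> s i \<in> {1..n}"
    "\<And>i k. \<lbrakk>i \<in> {1..n}; k \<in> {1..n}\<rbrakk> \<Longrightarrow> {X k, Y (s i)} \<in> E \<longleftrightarrow> k = i"
    by metis
  \<comment> \<open>\<open>X i\<close> is recovered as the only neighbour of
    \<open>Y (s i)\<close>.\<close>
  have inj: "inj_on s {1..n}" using s(2) by (intro inj_onI) metis
  moreover have "s ` {1..n} = {1..n}"
    using s(1) by (intro endo_inj_surj[OF _ _ inj]) auto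
  ultimately have sb: "bij_betw s {1..n} {1..n}" by (simp add: bij_betw_def)
  have qb: "bij_betw (\<lambda>i. Y (s i)) {1..n} Ys"
  proof -
    have "bij_betw Y {1..n} Ys" by (simp add: bij_betw_def inj_on_def)
    from bij_betw_trans[OF sb this] show ?thesis by (simp add: comp_def)
  qed
  have pb: "bij_betw X {1..n} Xs" by (simp add: bij_betw_def inj_on_def)
  define r where "r = {(i, i) |i. i \<in> {1..n}}"
  have "equal_up_to_relabelling n E (poset_graph r)"
    by (rule relabelled_poset_graphI[OF pb qb]) (use s(2) in \<open>auto simp: r_def\<close>)
  moreover have "naturally_labelled_poset n r"
    unfolding naturally_labelled_poset_def partial_order_on_def preorder_on_def
    by (auto simp: r_def refl_on_def trans_def antisym_def)
  moreover have "\<forall>i j. (i, j) \<in> r \<longrightarrow> i = j" by (auto simp: r_def)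
  ultimately show ?thesis unfolding comes_from_antichain_def by blast
qed

end

section \<open>Monomials of the vertex cover algebra\<close>

type_synonym expo = "(vertex \<Rightarrow>\<^sub>0 nat) \<times> nat"

text \<open>A pair \<open>(c, k)\<close> stands for the monomial with exponent vector \<open>c\<close> times \<open>t ^ k\<close>.\<close>

definition mon :: "expo \<Rightarrow> 'k::field vpoly poly" where
  "mon e = Polynomial.monom (vmonomial (fst e)) (snd e)"

definition indic :: "vertex set \<Rightarrow> (vertex \<Rightarrow>\<^sub>0 nat)" where
  "indic C = (\<Sum>v\<in>C. single v 1)"

definition gen_expos :: "nat \<Rightarrow> vertex set set \<Rightarrow> expo set" where
  "gen_expos n E = (\<lambda>v. (single v 1, 0)) ` Vn n \<union>
     (\<lambda>C. (indic C, 1)) ` {C. minimal_vertex_cover n E C}"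

definition expos :: "nat \<Rightarrow> vertex set set \<Rightarrow> nat \<Rightarrow> expo set" where
  "expos n E d = {sum_list es |es. length es = d \<and> set es \<subseteq> gen_expos n E}"

lemma lookup_indic: "finite C \<Longrightarrow> lookup (indic C) v = (if v \<in> C then 1 else 0)"
  by (simp add: indic_def lookup_sum lookup_single when_def)

lemma mon_add: "mon (p + q) = mon p * mon q"
  by (simp add: mon_def mult_monom vmonomial_def mult_single)

lemma mon_zero: "mon 0 = 1"
  by (simp add: mon_def vmonomial_def)

lemma mon_sum_list: "mon (sum_list es) = prod_list (map mon es)"
  by (induction es) (simp_all add: mon_zero mon_add)

lemma minimal_cover_finite: "minimal_vertex_cover n E C \<Longrightarrow> finite C"
  unfolding minimal_vertex_cover_def vertex_cover_def using finite_subset[OF _ finite_Vn] by blast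

lemma prod_Var: "(\<Prod>v\<in>C. Var v :: 'k::field vpoly) = vmonomial (indic C)"
  unfolding Var_def vmonomial_def prod_single indic_def ..

lemma degree_one_generators_eq:
  "degree_one_generators n E = (mon ` gen_expos n E :: 'k::field vpoly poly set)"
proof -
  have "mon (single v 1, 0) = ([:Var v:] :: 'k vpoly poly)" for v
    by (simp add: mon_def Var_def monom_0)
  moreover have "mon (indic C, 1) = Polynomial.monom (\<Prod>v\<in>C. Var v :: 'k vpoly) 1" for C
    by (simp add: mon_def prod_Var)
  ultimately show ?thesis
    unfolding degree_one_generators_def gen_expos_def image_Un image_image by auto
qed

lemma products_eq:
  "{prod_list gs |gs. length gs = d \<and> set gs \<subseteq> degree_one_generators n E} =
    (mon ` expos n E d :: 'k::field vpoly poly set)"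
proof (intro equalityI subsetI)
  fix f :: "'k vpoly poly" assume "f \<in> mon ` expos n E d"
  then obtain es where "f = mon (sum_list es)" "length es = d" "set es \<subseteq> gen_expos n E"
    unfolding expos_def by auto
  then show "f \<in> {prod_list gs |gs. length gs = d \<and> set gs \<subseteq> degree_one_generators n E}"
    unfolding mon_sum_list degree_one_generators_eq by (intro CollectI exI[of _ "map mon es"]) auto
next
  fix f :: "'k vpoly poly"
  assume "f \<in> {prod_list gs |gs. length gs = d \<and> set gs \<subseteq> degree_one_generators n E}"
  then obtain gs where gs: "f = prod_list gs" "length gs = d" "set gs \<subseteq> mon ` gen_expos n E"
    unfolding degree_one_generators_eq by auto
  have "\<exists>es. gs = map mon es \<and> set es \<subseteq> gen_expos n E"
    using gs(3)
  proof (induction gs)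
    case (Cons g gs)
    then obtain e es where "g = mon e" "e \<in> gen_expos n E" "gs = map mon es" "set es \<subseteq> gen_expos n E"
      by auto
    then show ?case by (intro exI[of _ "e # es"]) simp
  qed simp
  then obtain es where es: "gs = map mon es" "set es \<subseteq> gen_expos n E" by blast
  have "sum_list es \<in> expos n E d" using es gs(2) unfolding expos_def by auto
  moreover have "f = mon (sum_list es)" using gs(1) es(1) by (simp add: mon_sum_list)
  ultimately show "f \<in> mon ` expos n E d" by blast
qed

section \<open>Linear independence of the monomials\<close>

definition mon_coeff :: "expo \<Rightarrow> 'k::field vpoly poly \<Rightarrow> 'k" where
  "mon_coeff e f = lookup (Polynomial.coeff f (snd e)) (fst e)"

lemma mon_coeff_mon: "mon_coeff e (mon e') = (if e' = e then 1 else 0)"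
  by (auto simp: mon_coeff_def mon_def coeff_monom vmonomial_def lookup_single when_def prod_eq_iff)

lemma lookup_scale: "lookup (single 0 a * p) c = a * lookup p c"
  for p :: "'a::comm_monoid_add \<Rightarrow>\<^sub>0 'k::field"
proof -
  have "single 0 a * p = Poly_Mapping.map ((*) a) p"
    by (simp add: mult_map_scale_conv_mult)
  then show ?thesis by (simp add: Poly_Mapping.map.rep_eq when_def)
qed

lemma mon_coeff_scale: "mon_coeff e (Kscale a f) = a * mon_coeff e f"
  by (simp add: mon_coeff_def Kscale_def lookup_scale)

lemma mon_coeff_sum: "mon_coeff e (sum g A) = (\<Sum>x\<in>A. mon_coeff e (g x))"
  by (simp add: mon_coeff_def coeff_sum lookup_sum)

lemma inj_mon: "inj (mon :: expo \<Rightarrow> 'k::field vpoly poly)"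
proof (rule injI)
  fix e e' :: expo assume "(mon e :: 'k vpoly poly) = mon e'"
  then have "mon_coeff e (mon e :: 'k vpoly poly) = mon_coeff e (mon e')" by simp
  then show "e = e'" by (simp add: mon_coeff_mon split: if_splits)
qed

lemma independent_mon: "K.independent (mon ` A :: 'k::field vpoly poly set)"
  unfolding K.independent_explicit_finite_subsets
proof (intro allI impI ballI)
  fix T :: "'k vpoly poly set" and u f
  assume T: "T \<subseteq> mon ` A" "finite T" and sum: "(\<Sum>v\<in>T. Kscale (u v) v) = 0" and f: "f \<in> T"
  obtain e where e: "f = mon e" using T f by blast
  have "0 = mon_coeff e (\<Sum>v\<in>T. Kscale (u v) v)" unfolding sum by (simp add: mon_coeff_def)
  also have "\<dots> = (\<Sum>v\<in>T. if v = f then u v else 0)"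
    unfolding mon_coeff_sum
  proof (rule sum.cong)
    fix v assume "v \<in> T"
    then obtain e' where "v = mon e'" using T by blast
    then show "mon_coeff e (Kscale (u v) v) = (if v = f then u v else 0)"
      using injD[OF inj_mon, of e' e] e by (cases "e' = e") (auto simp: mon_coeff_scale mon_coeff_mon)
  qed simp
  also have "\<dots> = u f" using T f by simp
  finally show "u f = 0" by simp
qed

section \<open>Covers as sums of generators\<close>

lemma k_vertex_cover_add:
  "\<lbrakk>k_vertex_cover n E k a; k_vertex_cover n E l b\<rbrakk> \<Longrightarrow> k_vertex_cover n E (k + l) (a + b)"
  unfolding k_vertex_cover_def using Poly_Mapping.keys_add[of a b]
  by (auto simp: lookup_add intro: add_mono_thms_linordered_semiring(1)[THEN order_trans])
   (metis add.assoc add.left_commute add_mono)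

lemma k_vertex_cover_zero: "k_vertex_cover n E 0 0"
  by (simp add: k_vertex_cover_def)

lemma gen_expos_cover:
  assumes "e \<in> gen_expos n E"
  shows "k_vertex_cover n E (snd e) (fst e)"
proof -
  consider v where "v \<in> Vn n" "e = (single v 1, 0)"
    | C where "minimal_vertex_cover n E C" "e = (indic C, 1)"
    using assms unfolding gen_expos_def by auto
  then show ?thesis
  proof cases
    case 2
    have fin: "finite C" using 2(1) by (rule minimal_cover_finite)
    have C: "C \<subseteq> Vn n" "\<And>f. f \<in> E \<Longrightarrow> f \<inter> C \<noteq> {}"
      using 2 unfolding minimal_vertex_cover_def vertex_cover_def by auto
    have "keys (indic C) \<subseteq> Vn n"
      using C fin by (auto simp: in_keys_iff lookup_indic split: if_splits)
    then show ?thesis using C(2) fin 2 unfolding k_vertex_cover_def by (force simp: lookup_indic)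
  qed (auto simp: k_vertex_cover_def)
qed

lemma sum_list_gen_expos_cover:
  "set es \<subseteq> gen_expos n E \<Longrightarrow> k_vertex_cover n E (snd (sum_list es)) (fst (sum_list es))"
  by (induction es) (simp_all add: k_vertex_cover_zero k_vertex_cover_add gen_expos_cover)

text \<open>Generators are covers of the order given by their exponent of t, and covers add up, so
  products of generators lie in the algebra. The dimension of a component thus becomes a count of
  exponents.\<close>

lemma vca_component_eq:
  "vca_component n E d = K.span (mon ` expos n E d :: 'k::field vpoly poly set)"
proof -
  have A: "f \<in> vertex_cover_algebra n E" if "f \<in> K.span (mon ` expos n E d)" for f :: "'k vpoly poly"
    using that
  proof (induction rule: K.span_induct_alt)
    case base
    have "Kscale 0 1 \<in> vertex_cover_algebra n E"
      unfolding vertex_cover_algebra_def by (rule generated_subalgebra.const)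
    then show ?case by simp
  next
    case (step c x y)
    obtain es where es: "x = mon (sum_list es)" "set es \<subseteq> gen_expos n E"
      using step(1) unfolding expos_def by auto
    have "x \<in> vertex_cover_algebra n E"
      unfolding vertex_cover_algebra_def es(1) mon_def
      using sum_list_gen_expos_cover[OF es(2)] by (intro generated_subalgebra.gen) blast
    moreover have "Kscale c x = Kscale c 1 * x" by (simp add: Kscale_def)
    ultimately show ?case
      using step(2) unfolding vertex_cover_algebra_def
      by (auto intro: generated_subalgebra.intros)
  qed
  then show ?thesis unfolding vca_component_def products_eq by blast
qed

lemma vca_hilbert_series_nth:
  "fps_nth (vca_hilbert_series TYPE('k::field) n E) d = of_nat (card (expos n E d))"
proof -
  have "K.dim (vca_component n E d :: 'k vpoly poly set) = card (mon ` expos n E d :: 'k vpoly poly set)"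
    unfolding vca_component_eq by (rule K.dim_span_eq_card_independent[OF independent_mon])
  also have "\<dots> = card (expos n E d)"
    using inj_mon inj_on_subset by (intro card_image) blast
  finally show ?thesis by (simp add: vca_hilbert_series_def)
qed

lemma card_Vn: "card (Vn n) = 2 * n"
  unfolding Vn_def by (subst card_Un_disjoint) auto

lemma card_expos_one: "card (expos n E 1) = 2 * n + card {C. minimal_vertex_cover n E C}"
proof -
  have eq: "expos n E 1 = gen_expos n E"
    by (auto simp: expos_def length_Suc_conv intro!: exI[of _ "[_]"])
  have "inj_on (\<lambda>C. (indic C, 1::nat)) {C. minimal_vertex_cover n E C}"
  proof (rule inj_onI)
    fix C D assume "C \<in> {C. minimal_vertex_cover n E C}" "D \<in> {C. minimal_vertex_cover n E C}"
      "(indic C, 1::nat) = (indic D, 1)"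
    then have "indic C = indic D" "finite C" "finite D" by (auto dest: minimal_cover_finite)
    then show "C = D" using lookup_indic[of C] lookup_indic[of D] by (metis subsetI subset_antisym zero_neq_one)
  qed
  moreover have "inj_on (\<lambda>v. (single v (1::nat), 0::nat)) (Vn n)"
    by (rule inj_onI) (metis Pair_inject lookup_single_eq lookup_single_not_eq zero_neq_one)
  moreover have "finite {C. minimal_vertex_cover n E C}"
    by (rule finite_subset[of _ "Pow (Vn n)"])
      (auto simp: minimal_vertex_cover_def vertex_cover_def)
  ultimately show ?thesis
    unfolding eq gen_expos_def by (subst card_Un_disjoint) (auto simp: card_image card_Vn)
qed

definition size_expo :: "nat \<Rightarrow> (vertex \<Rightarrow>\<^sub>0 nat) \<Rightarrow> nat" where
  "size_expo n a = (\<Sum>v\<in>Vn n. lookup a v)"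

lemma size_expo_add: "size_expo n (a + b) = size_expo n a + size_expo n b"
  by (simp add: size_expo_def lookup_add sum.distrib)

lemma size_expo_indic: "C \<subseteq> Vn n \<Longrightarrow> size_expo n (indic C) = card C"
proof -
  assume C: "C \<subseteq> Vn n"
  then have "finite C" by (rule finite_subset) simp
  then have "size_expo n (indic C) = (\<Sum>v\<in>Vn n. if v \<in> C then 1 else 0)"
    by (simp add: size_expo_def lookup_indic)
  also have "\<dots> = card (Vn n \<inter> C)" by (simp add: sum.If_cases Int_commute)
  finally show ?thesis using C by (simp add: Int_absorb1)
qed

text \<open>Each m_C t has degree \<open>n\<close> in the vertices, so for every generator the size
  plus the exponent of t is \<open>n\<close> times that exponent plus 1. The degree of a monomial
  (a, k) is therefore |a| - (n - 1) k, written here without subtraction.\<close>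

lemma sum_list_size:
  assumes unmixed: "\<And>C. minimal_vertex_cover n E C \<Longrightarrow> card C = n"
    and "set es \<subseteq> gen_expos n E"
  shows "size_expo n (fst (sum_list es)) + snd (sum_list es) = n * snd (sum_list es) + length es"
  using assms(2)
proof (induction es)
  case Nil
  then show ?case by (simp add: size_expo_def)
next
  case (Cons e es)
  have "size_expo n (fst e) + snd e = n * snd e + 1"
  proof -
    consider v where "v \<in> Vn n" "e = (single v 1, 0)"
      | C where "minimal_vertex_cover n E C" "e = (indic C, 1)"
      using Cons.prems unfolding gen_expos_def by auto
    then show ?thesis
    proof cases
      case 1
      then show ?thesis by (simp add: size_expo_def lookup_single when_def)
    next
      case 2
      then have "C \<subseteq> Vn n" unfolding minimal_vertex_cover_def vertex_cover_def by blast
      then show ?thesis using 2 unmixed by (simp add: size_expo_indic)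
    qed
  qed
  then show ?case using Cons by (simp add: size_expo_add algebra_simps)
qed

context bip_graph
begin

lemma minimal_cover_below:
  assumes "vertex_cover n E C"
  shows "\<exists>D. minimal_vertex_cover n E D \<and> D \<subseteq> C"
proof -
  have "indep (Vn n - C)"
    unfolding indep_def
  proof (intro conjI ballI notI)
    fix v w assume vw: "v \<in> Vn n - C" "w \<in> Vn n - C" "{v, w} \<in> E"
    then have "{v, w} \<inter> C \<noteq> {}" using assms unfolding vertex_cover_def by metis
    then show False using vw by simp
  qed blast
  then obtain F where F: "facet F" "Vn n - C \<subseteq> F" using indep_extend by blast
  then have "minimal_vertex_cover n E (Vn n - F)" using facet_iff_cover facet_subset by blast
  moreover have "Vn n - F \<subseteq> C" using F(2) by blast
  ultimately show ?thesis by blast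
qed

text \<open>This is where bipartiteness makes the algebra generated in degree at most one in t: from
  a cover of order \<open>Suc k\<close>, a minimal vertex cover inside \<open>C0\<close> can be
  subtracted so that a cover of order \<open>k\<close> remains. A cover of order 0 is a sum of
  single vertices.\<close>

lemma cover_decomposition:
  "k_vertex_cover n E k a \<Longrightarrow> \<exists>es. set es \<subseteq> gen_expos n E \<and> sum_list es = (a, k)"
proof (induction k arbitrary: a)
  case 0
  then have "keys a \<subseteq> Vn n" by (simp add: k_vertex_cover_def)
  then show ?case
  proof (induction "size_expo n a" arbitrary: a)
    case 0
    then have "lookup a v = 0" for v
      by (cases "v \<in> Vn n") (auto simp: size_expo_def in_keys_iff)
    then have "a = 0" by (intro poly_mapping_eqI) simp
    then show ?case by (intro exI[of _ "[]"]) (simp add: zero_prod_def)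
  next
    case (Suc s)
    have "\<exists>v\<in>Vn n. lookup a v \<noteq> 0"
    proof (rule ccontr)
      assume "\<not> ?thesis"
      then have "size_expo n a = 0" unfolding size_expo_def by simp
      then show False using Suc.hyps(2) by simp
    qed
    then obtain v where v: "v \<in> Vn n" "lookup a v \<noteq> 0" by blast
    define b where "b = a - single v 1"
    have a: "a = single v 1 + b"
    proof (rule poly_mapping_eqI)
      fix w
      show "lookup a w = lookup (single v 1 + b) w"
        using v(2) by (cases "w = v") (simp_all add: b_def lookup_add lookup_minus lookup_single)
    qed
    have "size_expo n (single v (1::nat)) = 1"
      using v by (simp add: size_expo_def lookup_single when_def)
    then have "s = size_expo n b" using Suc.hyps(2) size_expo_add[of n "single v 1" b] a by simp
    moreover have "keys b \<subseteq> Vn n"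
      using Suc.prems unfolding b_def by (auto simp: in_keys_iff lookup_minus)
    ultimately obtain es where es: "set es \<subseteq> gen_expos n E" "sum_list es = (b, 0)"
      using Suc.hyps(1) by blast
    have "(single v 1, 0) \<in> gen_expos n E" using v unfolding gen_expos_def by blast
    then have "set ((single v 1, 0) # es) \<subseteq> gen_expos n E" using es(1) by simp
    moreover have "sum_list ((single v 1, 0) # es) = (a, 0)" using es(2) a by simp
    ultimately show ?case by blast
  qed
next
  case (Suc k)
  \<comment> \<open>The thresholds differ on the two sides. Every edge meets \<open>C0\<close>,
    since the value 0 at its end in \<open>Xs\<close> forces \<open>Suc k\<close> at the other end;
    and an edge with both ends in \<open>C\<close> keeps at least \<open>k\<close> at its end in
    \<open>Ys\<close> after the subtraction.\<close>
  define C0 where "C0 = {v \<in> Xs. lookup a v \<ge> 1} \<union> {v \<in> Ys. lookup a v \<ge> Suc k}"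
  have sum_ge: "lookup a v + lookup a w \<ge> Suc k" if "{v, w} \<in> E" for v w
    using Suc.prems that by (simp add: k_vertex_cover_def)
  have "vertex_cover n E C0"
    unfolding vertex_cover_def
  proof (intro conjI ballI)
    fix e assume e: "e \<in> E"
    obtain v w where vw: "e = {v, w}" "v \<in> Xs" "w \<in> Ys" using edge_pair[OF e] .
    have "lookup a v \<ge> 1 \<or> lookup a w \<ge> Suc k"
      using sum_ge[of v w] e vw by auto
    then show "e \<inter> C0 \<noteq> {}" using vw unfolding C0_def by blast
  qed (auto simp: C0_def Vn_eq)
  then obtain C where C: "minimal_vertex_cover n E C" "C \<subseteq> C0" using minimal_cover_below by blast
  have fin: "finite C" using C(1) by (rule minimal_cover_finite)
  have pos: "lookup a v \<ge> 1" if "v \<in> C" for v using C(2) that unfolding C0_def by auto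
  define b where "b = a - indic C"
  have lb: "lookup b v = lookup a v - (if v \<in> C then 1 else 0)" for v
    by (simp add: b_def lookup_minus lookup_indic[OF fin])
  have a: "a = indic C + b"
    using pos by (intro poly_mapping_eqI) (auto simp: lookup_add lb lookup_indic[OF fin])
  have "k_vertex_cover n E k b"
    unfolding k_vertex_cover_def
  proof (intro conjI allI impI)
    show "keys b \<subseteq> Vn n"
      using Suc.prems unfolding k_vertex_cover_def by (auto simp: in_keys_iff lb)
    have one: "k \<le> lookup b v + lookup b w"
      if e: "{v, w} \<in> E" "v \<in> Xs" "w \<in> Ys" for v w
    proof (cases "v \<in> C \<and> w \<in> C")
      case True
      then have "lookup a w \<ge> Suc k" using C(2) e XY_disjoint unfolding C0_def by blast
      moreover have "lookup a v \<ge> 1" using pos True by blast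
      ultimately show ?thesis using True by (simp add: lb)
    next
      case False
      then show ?thesis using sum_ge[OF e(1)] by (auto simp: lb)
    qed
    fix v w assume e: "{v, w} \<in> E"
    then show "k \<le> lookup b v + lookup b w"
      using edgeE[OF e] one[of v w] one[of w v] by (auto simp: insert_commute add.commute)
  qed
  then obtain es where es: "set es \<subseteq> gen_expos n E" "sum_list es = (b, k)" using Suc.IH by blast
  have "(indic C, 1) \<in> gen_expos n E" using C(1) unfolding gen_expos_def by blast
  then have "set ((indic C, 1) # es) \<subseteq> gen_expos n E" using es(1) by simp
  moreover have "sum_list ((indic C, 1) # es) = (a, Suc k)" using es(2) a by simp
  ultimately show ?case by blast
qed

text \<open>By unmixedness the exponents determine the degree, so all decompositions of a cover into
  generators have the same length.\<close>

lemma expos_eq_covers: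
  assumes unmixed: "\<And>C. minimal_vertex_cover n E C \<Longrightarrow> card C = n"
  shows "expos n E d = {(a, k). k_vertex_cover n E k a \<and> size_expo n a + k = n * k + d}"
proof (intro equalityI subsetI)
  fix e assume "e \<in> expos n E d"
  then obtain es where "e = sum_list es" "length es = d" "set es \<subseteq> gen_expos n E"
    unfolding expos_def by blast
  then show "e \<in> {(a, k). k_vertex_cover n E k a \<and> size_expo n a + k = n * k + d}"
    using sum_list_size[OF unmixed] sum_list_gen_expos_cover[of es n E] by (auto simp: case_prod_beta)
next
  fix e assume "e \<in> {(a, k). k_vertex_cover n E k a \<and> size_expo n a + k = n * k + d}"
  then obtain a k where e: "e = (a, k)" "k_vertex_cover n E k a" "size_expo n a + k = n * k + d" by blast
  obtain es where es: "set es \<subseteq> gen_expos n E" "sum_list es = (a, k)"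
    using cover_decomposition[OF e(2)] by blast
  have "length es = d" using sum_list_size[OF unmixed es(1)] es(2) e(3) by simp
  then show "e \<in> expos n E d" unfolding expos_def using es e(1) by (intro CollectI exI[of _ es]) simp
qed

end

section \<open>Vertex covers of a graph that comes from a poset\<close>

text \<open>In a pair \<open>(f, k)\<close>, the components of \<open>f i\<close> are the values of a \<open>k\<close>-vertex cover at \<open>x\<^sub>i\<close> and \<open>y\<^sub>i\<close>.\<close>

definition cover_pairs :: "nat \<Rightarrow> nat rel \<Rightarrow> ((nat \<Rightarrow> nat \<times> nat) \<times> nat) set" where
  "cover_pairs n r = {(f, k). f \<in> {1..n} \<rightarrow>\<^sub>E UNIV \<and> (\<forall>(i, j)\<in>r. k \<le> fst (f i) + snd (f j))}"

text \<open>The degree |a| - (n - 1) k, rearranged as a sum of excesses plus \<open>k\<close>. On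
  \<open>cover_pairs\<close> of a reflexive relation none of the differences is truncated.\<close>

definition cover_weight :: "nat \<Rightarrow> (nat \<Rightarrow> nat \<times> nat) \<times> nat \<Rightarrow> nat" where
  "cover_weight n = (\<lambda>(f, k). (\<Sum>i\<in>{1..n}. fst (f i) + snd (f i) - k) + k)"

locale labelled_graph = bip_graph +
  fixes r :: "nat rel" and \<psi> :: "vertex \<Rightarrow> vertex"
  assumes bij: "bij_betw \<psi> (Vn n) (Vn n)"
    and r_sub: "r \<subseteq> {1..n} \<times> {1..n}"
    and r_refl: "\<And>i. i \<in> {1..n} \<Longrightarrow> (i, i) \<in> r"
    and r_trans: "\<And>i j k. \<lbrakk>(i, j) \<in> r; (j, k) \<in> r\<rbrakk> \<Longrightarrow> (i, k) \<in> r"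
    and E_eq: "E = (`) \<psi> ` poset_graph r"
begin

definition p where "p i = \<psi> (X i)"
definition q where "q i = \<psi> (Y i)"

lemma E_iff: "e \<in> E \<longleftrightarrow> (\<exists>i j. (i, j) \<in> r \<and> e = {p i, q j})"
proof -
  have "(`) \<psi> ` poset_graph r = {{p i, q j} |i j. (i, j) \<in> r}"
  proof -
    have "poset_graph r = (\<lambda>(i, j). {X i, Y j}) ` r" unfolding poset_graph_def by force
    moreover have "{{p i, q j} |i j. (i, j) \<in> r} = (\<lambda>(i, j). {p i, q j}) ` r" by force
    ultimately show ?thesis by (simp add: image_image case_prod_beta p_def q_def)
  qed
  then show ?thesis unfolding E_eq by auto
qed

lemma edge_pq: "(i, j) \<in> r \<Longrightarrow> {p i, q j} \<in> E"
  unfolding E_iff by blast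

lemma inj_\<psi>: "\<lbrakk>\<psi> v = \<psi> w; v \<in> Vn n; w \<in> Vn n\<rbrakk> \<Longrightarrow> v = w"
  using bij_betw_imp_inj_on[OF bij] by (rule inj_onD)

lemma pq_eq:
  assumes "i \<in> {1..n}" "j \<in> {1..n}"
  shows "p i = p j \<longleftrightarrow> i = j" "q i = q j \<longleftrightarrow> i = j" "p i \<noteq> q j" "q j \<noteq> p i"
    and "p i \<in> Vn n" "q i \<in> Vn n"
proof -
  have V: "X i \<in> Vn n" "X j \<in> Vn n" "Y i \<in> Vn n" "Y j \<in> Vn n" using assms by (auto simp: Vn_def)
  show "p i = p j \<longleftrightarrow> i = j" using inj_\<psi>[of "X i" "X j"] V by (auto simp: p_def)
  show "q i = q j \<longleftrightarrow> i = j" using inj_\<psi>[of "Y i" "Y j"] V by (auto simp: q_def)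
  show "p i \<noteq> q j" "q j \<noteq> p i" using inj_\<psi>[of "X i" "Y j"] V by (auto simp: p_def q_def)
  show "p i \<in> Vn n" "q i \<in> Vn n" using bij_betwE[OF bij] V by (auto simp: p_def q_def)
qed

lemma Vn_pq: "Vn n = p ` {1..n} \<union> q ` {1..n}"
proof -
  have "Vn n = \<psi> ` Vn n" using bij by (simp add: bij_betw_def)
  also have "\<dots> = p ` {1..n} \<union> q ` {1..n}"
    unfolding Vn_def image_Un image_image p_def q_def ..
  finally show ?thesis .
qed

text \<open>Reflexivity puts \<open>p i\<close> or \<open>q i\<close> into \<open>C\<close>. If both
  were there, minimality would give edges \<open>{p i, q b}\<close> and \<open>{p c, q i}\<close>
  that \<open>C\<close> meets only in \<open>p i\<close> and \<open>q i\<close>, and the edge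
  \<open>{p c, q b}\<close> provided by transitivity would be uncovered.\<close>

lemma unmixed:
  assumes C: "minimal_vertex_cover n E C"
  shows "card C = n"
proof -
  have CV: "C \<subseteq> Vn n" and cov: "\<And>e. e \<in> E \<Longrightarrow> e \<inter> C \<noteq> {}"
    and min: "\<And>D. D \<subset> C \<Longrightarrow> \<not> vertex_cover n E D"
    using C unfolding minimal_vertex_cover_def vertex_cover_def by blast+
  have own_edge: "\<exists>e\<in>E. e \<inter> C = {v}" if v: "v \<in> C" for v
  proof -
    have "\<not> vertex_cover n E (C - {v})" using min[of "C - {v}"] v by blast
    then obtain e where "e \<in> E" "e \<inter> (C - {v}) = {}" using CV unfolding vertex_cover_def by blast
    then show ?thesis using cov[of e] by (intro bexI[of _ e]) auto
  qed
  have one: "p i \<in> C \<longleftrightarrow> q i \<notin> C" if i: "i \<in> {1..n}" for i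
  proof
    assume pi: "p i \<in> C"
    show "q i \<notin> C"
    proof
      assume qi: "q i \<in> C"
      obtain e where e: "e \<in> E" "e \<inter> C = {p i}" using own_edge[OF pi] by blast
      then obtain a b where ab: "(a, b) \<in> r" "e = {p a, q b}" unfolding E_iff by blast
      have "a \<in> {1..n}" "b \<in> {1..n}" using ab(1) r_sub by auto
      then have "p i \<noteq> q b" using pq_eq(3) i by blast
      moreover have "x = p i" if "x \<in> {p a, q b}" "x \<in> C" for x using that e(2) ab(2) by blast
      ultimately have "q b \<notin> C" by (metis insertCI)
      moreover have "p i \<in> {p a, q b} \<inter> C" using e(2) ab(2) by simp
      ultimately have "p i = p a" "q b \<notin> C" using \<open>p i \<noteq> q b\<close> by auto
      then have 1: "(i, b) \<in> r" using ab pq_eq(1)[of i a] i r_sub by auto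
      obtain e' where e': "e' \<in> E" "e' \<inter> C = {q i}" using own_edge[OF qi] by blast
      then obtain c d where cd: "(c, d) \<in> r" "e' = {p c, q d}" unfolding E_iff by blast
      have "c \<in> {1..n}" "d \<in> {1..n}" using cd(1) r_sub by auto
      then have "q i \<noteq> p c" using pq_eq(4) i by blast
      moreover have "x = q i" if "x \<in> {p c, q d}" "x \<in> C" for x using that e'(2) cd(2) by blast
      ultimately have "p c \<notin> C" by (metis insertCI)
      moreover have "q i \<in> {p c, q d} \<inter> C" using e'(2) cd(2) by simp
      ultimately have "q i = q d" "p c \<notin> C" using \<open>q i \<noteq> p c\<close> by auto
      then have 2: "(c, i) \<in> r" using cd pq_eq(2)[of i d] i r_sub by auto
      show False using cov[OF edge_pq[OF r_trans[OF 2 1]]] \<open>q b \<notin> C\<close> \<open>p c \<notin> C\<close> by blast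
    qed
  next
    assume "q i \<notin> C"
    then show "p i \<in> C" using cov[OF edge_pq[OF r_refl[OF i]]] by blast
  qed
  have "bij_betw (\<lambda>i. if p i \<in> C then p i else q i) {1..n} C"
    unfolding bij_betw_def
  proof
    show "inj_on (\<lambda>i. if p i \<in> C then p i else q i) {1..n}"
      by (rule inj_onI) (use pq_eq in \<open>auto split: if_splits\<close>)
    show "(\<lambda>i. if p i \<in> C then p i else q i) ` {1..n} = C"
    proof
      show "(\<lambda>i. if p i \<in> C then p i else q i) ` {1..n} \<subseteq> C" using one by auto
      show "C \<subseteq> (\<lambda>i. if p i \<in> C then p i else q i) ` {1..n}"
      proof
        fix v assume v: "v \<in> C"
        then obtain i where i: "i \<in> {1..n}" "v = p i \<or> v = q i" using CV Vn_pq by auto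
        then show "v \<in> (\<lambda>i. if p i \<in> C then p i else q i) ` {1..n}"
          using v one[OF i(1)] by (intro image_eqI[of _ _ i]) auto
      qed
    qed
  qed
  then show ?thesis using bij_betw_same_card by fastforce
qed

lemma k_vertex_cover_iff:
  "k_vertex_cover n E k a \<longleftrightarrow> keys a \<subseteq> Vn n \<and>
    (\<forall>(i, j)\<in>r. k \<le> lookup a (p i) + lookup a (q j))"
proof
  assume "k_vertex_cover n E k a"
  then show "keys a \<subseteq> Vn n \<and>
    (\<forall>(i, j)\<in>r. k \<le> lookup a (p i) + lookup a (q j))"
    using edge_pq unfolding k_vertex_cover_def by auto
next
  assume R: "keys a \<subseteq> Vn n \<and>
    (\<forall>(i, j)\<in>r. k \<le> lookup a (p i) + lookup a (q j))"
  show "k_vertex_cover n E k a"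
    unfolding k_vertex_cover_def
  proof (intro conjI allI impI)
    fix v w assume "{v, w} \<in> E"
    then obtain i j where ij: "(i, j) \<in> r" "{v, w} = {p i, q j}" unfolding E_iff by blast
    then show "k \<le> lookup a v + lookup a w"
      using R by (auto simp: doubleton_eq_iff add.commute)
  qed (use R in blast)
qed

lemma size_expo_pq:
  "size_expo n a = (\<Sum>i\<in>{1..n}. lookup a (p i) + lookup a (q i))"
proof -
  have "size_expo n a = (\<Sum>v\<in>Vn n. lookup a (\<psi> v))"
    unfolding size_expo_def by (rule sum.reindex_bij_betw[OF bij, symmetric])
  also have "\<dots> = (\<Sum>v\<in>X ` {1..n}. lookup a (\<psi> v)) + (\<Sum>v\<in>Y ` {1..n}. lookup a (\<psi> v))"
    unfolding Vn_def by (rule sum.union_disjoint) auto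
  also have "\<dots> = (\<Sum>i\<in>{1..n}. lookup a (p i)) + (\<Sum>i\<in>{1..n}. lookup a (q i))"
    unfolding p_def q_def by (simp add: sum.reindex inj_on_def)
  finally show ?thesis by (simp add: sum.distrib)
qed

lemma cover_weight_eq:
  assumes "(f, k) \<in> cover_pairs n r"
  shows "cover_weight n (f, k) + n * k = (\<Sum>i\<in>{1..n}. fst (f i) + snd (f i)) + k"
proof -
  have le: "k \<le> fst (f i) + snd (f i)" if "i \<in> {1..n}" for i
    using assms r_refl[OF that] unfolding cover_pairs_def by auto
  have "(\<Sum>i\<in>{1..n}. fst (f i) + snd (f i)) = (\<Sum>i\<in>{1..n}. (fst (f i) + snd (f i) - k) + k)"
    using le by (intro sum.cong) auto
  then show ?thesis by (simp add: cover_weight_def sum.distrib)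
qed

definition to_pairs where
  "to_pairs = (\<lambda>(a, k). (\<lambda>i\<in>{1..n}. (lookup a (p i), lookup a (q i)), k :: nat))"

definition of_pairs where
  "of_pairs = (\<lambda>(f, k). ((\<Sum>i\<in>{1..n}. single (p i) (fst (f i)) + single (q i) (snd (f i))) ::
     vertex \<Rightarrow>\<^sub>0 nat, k :: nat))"

lemma lookup_of_pairs:
  assumes "i \<in> {1..n}"
  shows "lookup (fst (of_pairs (f, k))) (p i) = fst (f i)"
    and "lookup (fst (of_pairs (f, k))) (q i) = snd (f i)"
proof -
  have "lookup (fst (of_pairs (f, k))) (p i) = (\<Sum>j\<in>{1..n}. if j = i then fst (f j) else 0)"
    unfolding of_pairs_def using pq_eq assms
    by (simp add: lookup_sum lookup_add lookup_single when_def del: atLeastAtMost_iff cong: sum.cong)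
  then show "lookup (fst (of_pairs (f, k))) (p i) = fst (f i)" using assms by simp
  have "lookup (fst (of_pairs (f, k))) (q i) = (\<Sum>j\<in>{1..n}. if j = i then snd (f j) else 0)"
    unfolding of_pairs_def using pq_eq assms
    by (simp add: lookup_sum lookup_add lookup_single when_def del: atLeastAtMost_iff cong: sum.cong)
  then show "lookup (fst (of_pairs (f, k))) (q i) = snd (f i)" using assms by simp
qed

lemma keys_of_pairs: "keys (fst (of_pairs (f, k))) \<subseteq> Vn n"
proof
  fix v assume v: "v \<in> keys (fst (of_pairs (f, k)))"
  show "v \<in> Vn n"
  proof (rule ccontr)
    assume "v \<notin> Vn n"
    then have "p i \<noteq> v \<and> q i \<noteq> v" if "i \<in> {1..n}" for i using pq_eq(5,6)[OF that that] by auto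
    then have "lookup (fst (of_pairs (f, k))) v = 0"
      by (simp add: of_pairs_def lookup_sum lookup_add lookup_single)
    then show False using v by (simp add: in_keys_iff)
  qed
qed

lemma card_expos: "card (expos n E d) = card {s \<in> cover_pairs n r. cover_weight n s = d}"
proof -
  have mem: "to_pairs (a, k) \<in> cover_pairs n r \<longleftrightarrow> k_vertex_cover n E k a" 
    if "keys a \<subseteq> Vn n" for a k
    using r_sub that unfolding to_pairs_def cover_pairs_def k_vertex_cover_iff by (auto; fastforce)
  have weight: "cover_weight n (to_pairs (a, k)) = d \<longleftrightarrow> size_expo n a + k = n * k + d"
    if c: "k_vertex_cover n E k a" for a k
  proof -
    have "to_pairs (a, k) \<in> cover_pairs n r" using mem c unfolding k_vertex_cover_def by blast
    then have "cover_weight n (to_pairs (a, k)) + n * k = size_expo n a + k"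
      using cover_weight_eq unfolding to_pairs_def size_expo_pq by simp
    then show ?thesis by linarith
  qed
  have to_of: "to_pairs (of_pairs s) = s" if s: "s \<in> cover_pairs n r" for s
  proof -
    obtain f k where fk: "s = (f, k)" "f \<in> extensional {1..n}" 
      using s unfolding cover_pairs_def by (auto simp: PiE_def)
    have "(\<lambda>i\<in>{1..n}. (lookup (fst (of_pairs s)) (p i), lookup (fst (of_pairs s)) (q i))) = f"
      using fk lookup_of_pairs by (intro extensionalityI[of _ "{1..n}"]) auto
    moreover have "snd (of_pairs s) = k" by (simp add: of_pairs_def fk)
    ultimately show ?thesis unfolding to_pairs_def fk by (auto simp: case_prod_beta)
  qed
  have "bij_betw to_pairs {(a, k). k_vertex_cover n E k a \<and> size_expo n a + k = n * k + d}
    {s \<in> cover_pairs n r. cover_weight n s = d}"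
  proof (rule bij_betw_byWitness[where f' = of_pairs])
    show "\<forall>x\<in>{(a, k). k_vertex_cover n E k a \<and> size_expo n a + k = n * k + d}. of_pairs (to_pairs x) = x"
    proof (rule ballI)
      fix x assume "x \<in> {(a, k). k_vertex_cover n E k a \<and> size_expo n a + k = n * k + d}"
      then obtain a k where x: "x = (a, k)" and c: "k_vertex_cover n E k a" by blast
      have "fst (of_pairs (to_pairs (a, k))) = a"
      proof (rule poly_mapping_eqI)
        fix v
        show "lookup (fst (of_pairs (to_pairs (a, k)))) v = lookup a v"
        proof (cases "v \<in> Vn n")
          case True
          then obtain i where "i \<in> {1..n}" "v = p i \<or> v = q i" using Vn_pq by auto
          then show ?thesis using lookup_of_pairs[of i] unfolding to_pairs_def by auto
        next
          case False
          then have "v \<notin> keys a" "v \<notin> keys (fst (of_pairs (to_pairs (a, k))))"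
            using c keys_of_pairs[of "fst (to_pairs (a, k))" "snd (to_pairs (a, k))"]
            unfolding k_vertex_cover_def by auto
          then show ?thesis by (simp add: in_keys_iff)
        qed
      qed
      moreover have "snd (of_pairs (to_pairs (a, k))) = k" by (simp add: of_pairs_def to_pairs_def)
      ultimately show "of_pairs (to_pairs x) = x" unfolding x by (simp add: prod_eq_iff)
    qed
    show "\<forall>s\<in>{s \<in> cover_pairs n r. cover_weight n s = d}. to_pairs (of_pairs s) = s" using to_of by blast
    show "to_pairs ` {(a, k). k_vertex_cover n E k a \<and> size_expo n a + k = n * k + d} \<subseteq>
        {s \<in> cover_pairs n r. cover_weight n s = d}"
    proof (rule image_subsetI)
      fix x assume "x \<in> {(a, k). k_vertex_cover n E k a \<and> size_expo n a + k = n * k + d}"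
      then obtain a k where x: "x = (a, k)" and
        c: "k_vertex_cover n E k a" "size_expo n a + k = n * k + d" by auto
      then have "keys a \<subseteq> Vn n" unfolding k_vertex_cover_def by blast
      then show "to_pairs x \<in> {s \<in> cover_pairs n r. cover_weight n s = d}"
        using mem weight[OF c(1)] c x by simp
    qed
    show "of_pairs ` {s \<in> cover_pairs n r. cover_weight n s = d} \<subseteq>
        {(a, k). k_vertex_cover n E k a \<and> size_expo n a + k = n * k + d}"
    proof (rule image_subsetI)
      fix x assume x: "x \<in> {s \<in> cover_pairs n r. cover_weight n s = d}"
      obtain f k where fk: "x = (f, k)" by (cases x)
      obtain a k' where ak: "of_pairs x = (a, k')" by (cases "of_pairs x")
      have s: "(f, k) \<in> cover_pairs n r" "of_pairs (f, k) = (a, k')" "d = cover_weight n (f, k)"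
        using x fk ak by auto
      have "keys a \<subseteq> Vn n" using keys_of_pairs[of f k] s(2) by simp
      moreover have tp: "to_pairs (a, k') = (f, k)" using to_of[OF s(1)] s(2) by simp
      ultimately have "k_vertex_cover n E k' a" using mem[of a k'] s(1) by simp
      then show "of_pairs x \<in> {(a, k). k_vertex_cover n E k a \<and> size_expo n a + k = n * k + d}"
        using weight[of k' a] tp s(3) ak by simp
    qed
  qed
  from bij_betw_same_card[OF this] show ?thesis using expos_eq_covers[OF unmixed] by simp
qed

end

section \<open>Generating functions\<close>

text \<open>Carried along with every series because the cardinality of an infinite set is 0, which
  would falsify the product formulas.\<close>

definition finite_fibres :: "('a \<Rightarrow> nat) \<Rightarrow> 'a set \<Rightarrow> bool" where
  "finite_fibres w A \<longleftrightarrow> (\<forall>d. finite {x \<in> A. w x = d})"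

definition weight_series :: "('a \<Rightarrow> nat) \<Rightarrow> 'a set \<Rightarrow> rat fps" where
  "weight_series w A = Abs_fps (\<lambda>d. of_nat (card {x \<in> A. w x = d}))"

lemma weight_series_bij:
  assumes "bij_betw h A B" "\<And>x. x \<in> A \<Longrightarrow> v (h x) = w x"
  shows "weight_series w A = weight_series v B" "finite_fibres w A \<longleftrightarrow> finite_fibres v B"
proof -
  have b: "bij_betw h {x \<in> A. w x = d} {y \<in> B. v y = d}" for d
  proof (rule bij_betw_subset[OF assms(1)])
    show "h ` {x \<in> A. w x = d} = {y \<in> B. v y = d}"
    proof (intro equalityI subsetI)
      fix y assume "y \<in> {y \<in> B. v y = d}"
      then obtain x where "x \<in> A" "y = h x" "v y = d" using assms(1) unfolding bij_betw_def by blast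
      then show "y \<in> h ` {x \<in> A. w x = d}" using assms(2) by auto
    qed (use assms bij_betwE[OF assms(1)] in auto)
  qed blast
  show "weight_series w A = weight_series v B"
    unfolding weight_series_def using bij_betw_same_card[OF b] by simp
  show "finite_fibres w A \<longleftrightarrow> finite_fibres v B"
    unfolding finite_fibres_def using bij_betw_finite[OF b] by simp
qed

lemma weight_series_times:
  assumes "finite_fibres w A" "finite_fibres v B"
  shows "weight_series (\<lambda>(x, y). w x + v y) (A \<times> B) = weight_series w A * weight_series v B"
    and "finite_fibres (\<lambda>(x, y). w x + v y) (A \<times> B)"
proof -
  have eq: "{z \<in> A \<times> B. (\<lambda>(x, y). w x + v y) z = d} =
    (\<Union>i\<in>{0..d}. {x \<in> A. w x = i} \<times> {y \<in> B. v y = d - i})" for d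
    by auto
  have fin: "finite ({x \<in> A. w x = i} \<times> {y \<in> B. v y = j})" for i j
    using assms unfolding finite_fibres_def by simp
  show "finite_fibres (\<lambda>(x, y). w x + v y) (A \<times> B)"
    unfolding finite_fibres_def eq using fin by blast
  show "weight_series (\<lambda>(x, y). w x + v y) (A \<times> B) = weight_series w A * weight_series v B"
  proof (rule fps_ext)
    fix d
    have "card {z \<in> A \<times> B. (\<lambda>(x, y). w x + v y) z = d} =
        (\<Sum>i\<in>{0..d}. card ({x \<in> A. w x = i} \<times> {y \<in> B. v y = d - i}))"
      unfolding eq using fin by (intro card_UN_disjoint) auto
    then show "fps_nth (weight_series (\<lambda>(x, y). w x + v y) (A \<times> B)) d =
        fps_nth (weight_series w A * weight_series v B) d"
      by (simp add: weight_series_def fps_mult_nth card_cartesian_product)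
  qed
qed

lemma weight_series_PiE:
  assumes "finite_fibres w A"
  shows "weight_series (\<lambda>f. \<Sum>i\<in>{1..n}. w (f i)) ({1..n} \<rightarrow>\<^sub>E A) = weight_series w A ^ n \<and>
    finite_fibres (\<lambda>f. \<Sum>i\<in>{1..n}. w (f i)) ({1..n} \<rightarrow>\<^sub>E A)"
proof (induction n)
  case 0
  have "{x. x = (\<lambda>_. undefined) \<and> (0::nat) = d} = (if d = 0 then {\<lambda>_. undefined :: 'a} else {})" for d
    by auto
  then have "weight_series (\<lambda>f. 0) ({} \<rightarrow>\<^sub>E A) = 1"
    by (intro fps_ext) (simp add: weight_series_def)
  then show ?case by (simp add: finite_fibres_def)
next
  case (Suc n)
  let ?h = "\<lambda>(y, g). g(Suc n := y)"
  have at: "{1..Suc n} = insert (Suc n) {1..n}" by auto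
  have "bij_betw ?h (A \<times> ({1..n} \<rightarrow>\<^sub>E A)) ({1..Suc n} \<rightarrow>\<^sub>E A)"
    unfolding at bij_betw_def PiE_insert_eq using inj_combinator[of "Suc n" "{1..n}" "\<lambda>_. A"] by simp
  moreover have "(\<Sum>i\<in>{1..Suc n}. w (?h x i)) = (\<lambda>(y, g). w y + (\<Sum>i\<in>{1..n}. w (g i))) x" for x
  proof -
    obtain y g where x: "x = (y, g)" by (cases x)
    have "(\<Sum>i\<in>{1..n}. w ((g(Suc n := y)) i)) = (\<Sum>i\<in>{1..n}. w (g i))"
      by (rule sum.cong) auto
    then show ?thesis unfolding at x by simp
  qed
  ultimately have
    "weight_series (\<lambda>f. \<Sum>i\<in>{1..Suc n}. w (f i)) ({1..Suc n} \<rightarrow>\<^sub>E A) =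
      weight_series (\<lambda>(y, g). w y + (\<Sum>i\<in>{1..n}. w (g i))) (A \<times> ({1..n} \<rightarrow>\<^sub>E A))"
    "finite_fibres (\<lambda>f. \<Sum>i\<in>{1..Suc n}. w (f i)) ({1..Suc n} \<rightarrow>\<^sub>E A) \<longleftrightarrow>
      finite_fibres (\<lambda>(y, g). w y + (\<Sum>i\<in>{1..n}. w (g i))) (A \<times> ({1..n} \<rightarrow>\<^sub>E A))"
    using weight_series_bij[of ?h "A \<times> ({1..n} \<rightarrow>\<^sub>E A)" "{1..Suc n} \<rightarrow>\<^sub>E A"
        "\<lambda>f. \<Sum>i\<in>{1..Suc n}. w (f i)" "\<lambda>(y, g). w y + (\<Sum>i\<in>{1..n}. w (g i))"]
    by metis+
  then show ?case
    using weight_series_times[OF assms, of "\<lambda>f. \<Sum>i\<in>{1..n}. w (f i)" "{1..n} \<rightarrow>\<^sub>E A"] Suc.IH by simp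
qed

lemma one_minus_X_mult_nth:
  "fps_nth ((1 - fps_X) * F) d = fps_nth F d - (if d = 0 then 0 else fps_nth F (d - 1))"
  for F :: "rat fps"
  by (simp add: left_diff_distrib)

lemma weight_series_nat: "(1 - fps_X) * weight_series (\<lambda>x. x) UNIV = 1" "finite_fibres (\<lambda>x. x) UNIV"
proof -
  have "weight_series (\<lambda>x. x) UNIV = Abs_fps (\<lambda>_. 1)" by (simp add: weight_series_def)
  then show "(1 - fps_X) * weight_series (\<lambda>x. x) UNIV = 1"
    by (intro fps_ext) (simp only: one_minus_X_mult_nth, simp)
qed (simp add: finite_fibres_def)

text \<open>There is one pair in degree 0, where \<open>(d, 0)\<close> and \<open>(0, d)\<close>
  coincide, and there are two in each higher degree. This is the source of the factor
  \<open>1 + fps_X\<close> for each element of a chain.\<close>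

lemma weight_series_orthogonal:
  defines "P \<equiv> {(b::nat, t::nat). b = 0 \<or> t = 0}"
  shows "(1 - fps_X) * weight_series (\<lambda>(b, t). b + t) P = 1 + fps_X" "finite_fibres (\<lambda>(b, t). b + t) P"
proof -
  have eq: "{x \<in> P. (\<lambda>(b, t). b + t) x = d} = {(d, 0), (0, d)}" for d
    by (auto simp: P_def)
  show "finite_fibres (\<lambda>(b, t). b + t) P" unfolding finite_fibres_def eq by simp
  have "card {(d, 0), (0, d)} = (if d = 0 then 1 else 2)" for d :: nat by simp
  then have "weight_series (\<lambda>(b, t). b + t) P = Abs_fps (\<lambda>d. if d = 0 then 1 else 2)"
    unfolding weight_series_def eq by (intro fps_ext) simp
  then show "(1 - fps_X) * weight_series (\<lambda>(b, t). b + t) P = 1 + fps_X"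
    by (intro fps_ext) (simp only: one_minus_X_mult_nth, auto simp: fps_X_def)
qed

section \<open>The series of a chain\<close>

definition chain_rel :: "nat \<Rightarrow> nat rel" where
  "chain_rel n = {(i, j). 1 \<le> i \<and> i \<le> j \<and> j \<le> n}"

type_synonym step = "nat \<times> nat \<times> nat"

text \<open>A step \<open>(a, b, t)\<close> records two excesses and \<open>t = k - m\<close>. If
  \<open>t > 0\<close>, then \<open>m\<close> is the whole second component at the new element and
  leaves no excess \<open>b\<close>; this is why \<open>b\<close> or \<open>t\<close> is 0.\<close>

definition steps :: "step set" where
  "steps = UNIV \<times> {(b, t). b = 0 \<or> t = 0}"

definition step_weight :: "step \<Rightarrow> nat" where
  "step_weight = (\<lambda>(a, x). a + (\<lambda>(b, t). b + t) x)"

lemma weight_series_steps: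
  "(1 - fps_X) ^ 2 * weight_series step_weight steps = 1 + fps_X" "finite_fibres step_weight steps"
proof -
  note t = weight_series_times[OF weight_series_nat(2) weight_series_orthogonal(2)]
  show "finite_fibres step_weight steps" using t(2) by (simp add: step_weight_def steps_def)
  have "(1 - fps_X) ^ 2 * weight_series step_weight steps =
    ((1 - fps_X) * weight_series (\<lambda>x. x) UNIV) *
    ((1 - fps_X) * weight_series (\<lambda>(b, t). b + t) {(b::nat, t::nat). b = 0 \<or> t = 0})"
    using t(1) by (simp add: step_weight_def steps_def power2_eq_square algebra_simps)
  then show "(1 - fps_X) ^ 2 * weight_series step_weight steps = 1 + fps_X"
    by (simp add: weight_series_nat(1) weight_series_orthogonal(1))
qed

text \<open>A \<open>k\<close>-cover \<open>(a, b)\<close> of the chain with \<open>n + 1\<close> elements is determined by \<open>t = k - m\<close>, where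
  \<open>m\<close> is the minimum of \<open>b (n + 1)\<close> and \<open>k\<close>, the excesses of \<open>a (n + 1)\<close> over \<open>t\<close> and of \<open>b (n + 1)\<close> over \<open>m\<close>, and
  an \<open>m\<close>-cover of the chain with \<open>n\<close> elements: the conditions \<open>a i + b (n + 1) \<ge> k\<close> say that all
  \<open>a i\<close> are at least \<open>t\<close>.\<close>

definition push :: "nat \<Rightarrow> step \<times> (nat \<Rightarrow> nat \<times> nat) \<times> nat \<Rightarrow> (nat \<Rightarrow> nat \<times> nat) \<times> nat" where
  "push n = (\<lambda>((a, b, t), (f, m)).
     (\<lambda>i\<in>{1..Suc n}. if i = Suc n then (a + t, b + m) else (fst (f i) + t, snd (f i)), m + t))"

definition pop :: "nat \<Rightarrow> (nat \<Rightarrow> nat \<times> nat) \<times> nat \<Rightarrow> step \<times> (nat \<Rightarrow> nat \<times> nat) \<times> nat" where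
  "pop n = (\<lambda>(f, k). let m = min (snd (f (Suc n))) k; t = k - m in
     ((fst (f (Suc n)) - t, snd (f (Suc n)) - m, t), (\<lambda>i\<in>{1..n}. (fst (f i) - t, snd (f i)), m)))"

lemma cover_pairs_chainD:
  assumes "(f, k) \<in> cover_pairs n (chain_rel n)"
  shows "f \<in> extensional {1..n}" "\<lbrakk>1 \<le> i; i \<le> j; j \<le> n\<rbrakk> \<Longrightarrow> k \<le> fst (f i) + snd (f j)"
  using assms unfolding cover_pairs_def chain_rel_def by (auto simp: PiE_def)

lemma cover_pairs_chainI:
  assumes "f \<in> extensional {1..n}" "\<And>i j. \<lbrakk>1 \<le> i; i \<le> j; j \<le> n\<rbrakk> \<Longrightarrow> k \<le> fst (f i) + snd (f j)"
  shows "(f, k) \<in> cover_pairs n (chain_rel n)"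
  using assms unfolding cover_pairs_def chain_rel_def by (auto simp: PiE_def)

lemma bij_push:
  "bij_betw (push n) (steps \<times> cover_pairs n (chain_rel n)) (cover_pairs (Suc n) (chain_rel (Suc n)))"
proof (rule bij_betw_byWitness[where f' = "pop n"])
  show "\<forall>x\<in>steps \<times> cover_pairs n (chain_rel n). pop n (push n x) = x"
  proof
    fix x assume x: "x \<in> steps \<times> cover_pairs n (chain_rel n)"
    then obtain a b t f m where eq: "x = ((a, b, t), (f, m))" and bt: "b = 0 \<or> t = 0"
      and f: "(f, m) \<in> cover_pairs n (chain_rel n)" unfolding steps_def by auto
    \<comment> \<open>The condition on \<open>b\<close> and \<open>t\<close> is exactly what lets
      \<open>pop\<close> recover \<open>m\<close> as a minimum.\<close>
    have mn: "min (b + m) (m + t) = m" using bt by auto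
    let ?g = "\<lambda>i\<in>{1..Suc n}. if i = Suc n then (a + t, b + m) else (fst (f i) + t, snd (f i))"
    have "(\<lambda>i\<in>{1..n}. (fst (?g i) - t, snd (?g i))) = f"
      by (rule extensionalityI[of _ "{1..n}"]) (use cover_pairs_chainD(1)[OF f] in auto)
    then show "pop n (push n x) = x"
      using mn unfolding eq push_def pop_def by (simp add: Let_def)
  qed
  show "\<forall>y\<in>cover_pairs (Suc n) (chain_rel (Suc n)). push n (pop n y) = y"
  proof
    fix y assume y: "y \<in> cover_pairs (Suc n) (chain_rel (Suc n))"
    obtain f k where eq: "y = (f, k)" by (cases y)
    note c = cover_pairs_chainD[OF y[unfolded eq]]
    \<comment> \<open>The relations between every \<open>i\<close> and \<open>Suc n\<close> make the
      subtractions in \<open>pop\<close> exact.\<close>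
    have ge: "k - min (snd (f (Suc n))) k \<le> fst (f i)" if "1 \<le> i" "i \<le> Suc n" for i
      using c(2)[of i "Suc n"] that by auto
    have "fst (push n (pop n y)) i = f i" for i
    proof (cases "i \<in> {1..Suc n}")
      case True
      then show ?thesis using ge[of i]
        by (auto simp: eq push_def pop_def Let_def prod_eq_iff)
    next
      case False
      then show ?thesis using c(1) by (auto simp: eq push_def pop_def Let_def extensional_def)
    qed
    then show "push n (pop n y) = y"
      by (simp add: prod_eq_iff fun_eq_iff) (simp add: eq push_def pop_def Let_def)
  qed
  show "push n ` (steps \<times> cover_pairs n (chain_rel n)) \<subseteq> cover_pairs (Suc n) (chain_rel (Suc n))"
  proof (rule image_subsetI)
    fix x assume x: "x \<in> steps \<times> cover_pairs n (chain_rel n)"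
    then obtain a b t f m where eq: "x = ((a, b, t), (f, m))" and bt: "b = 0 \<or> t = 0"
      and f: "(f, m) \<in> cover_pairs n (chain_rel n)" unfolding steps_def by auto
    show "push n x \<in> cover_pairs (Suc n) (chain_rel (Suc n))"
      unfolding eq push_def split
    proof (rule cover_pairs_chainI)
      fix i j assume ij: "1 \<le> i" "i \<le> j" "j \<le> Suc n"
      let ?g = "\<lambda>i\<in>{1..Suc n}. if i = Suc n then (a + t, b + m) else (fst (f i) + t, snd (f i))"
      show "m + t \<le> fst (?g i) + snd (?g j)"
        using cover_pairs_chainD(2)[OF f, of i j] ij by (cases "j = Suc n") auto
    qed auto
  qed
  show "pop n ` cover_pairs (Suc n) (chain_rel (Suc n)) \<subseteq> steps \<times> cover_pairs n (chain_rel n)"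
  proof (rule image_subsetI)
    fix y assume y: "y \<in> cover_pairs (Suc n) (chain_rel (Suc n))"
    obtain f k where eq: "y = (f, k)" by (cases y)
    note c = cover_pairs_chainD[OF y[unfolded eq]]
    define m where "m = min (snd (f (Suc n))) k"
    have "((\<lambda>i\<in>{1..n}. (fst (f i) - (k - m), snd (f i))), m) \<in> cover_pairs n (chain_rel n)"
    proof (rule cover_pairs_chainI)
      fix i j assume ij: "1 \<le> i" "i \<le> j" "j \<le> n"
      then show "m \<le> fst ((\<lambda>i\<in>{1..n}. (fst (f i) - (k - m), snd (f i))) i) +
          snd ((\<lambda>i\<in>{1..n}. (fst (f i) - (k - m), snd (f i))) j)"
        using c(2)[of i j] c(2)[of i "Suc n"] by (auto simp: m_def)
    qed simp
    moreover have "snd (f (Suc n)) - m = 0 \<or> k - m = 0" by (auto simp: m_def)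
    ultimately show "pop n y \<in> steps \<times> cover_pairs n (chain_rel n)"
      unfolding eq pop_def split Let_def m_def[symmetric] by (simp add: steps_def)
  qed
qed

text \<open>The new element has excess \<open>(a + t) + (b + m) - (m + t) = a + b\<close>. At the
  others, the first component and the order of the cover both grow by \<open>t\<close>, so the
  excess stays; the summand for the order grows from \<open>m\<close> to
  \<open>m + t\<close>.\<close>

lemma weight_push: "cover_weight (Suc n) (push n x) = (\<lambda>(s, c). step_weight s + cover_weight n c) x"
proof -
  obtain a b t f m where x: "x = ((a, b, t), (f, m))" by (metis prod_cases3 surj_pair)
  have at: "{1..Suc n} = insert (Suc n) {1..n}" by auto
  let ?g = "\<lambda>i\<in>{1..Suc n}. if i = Suc n then (a + t, b + m) else (fst (f i) + t, snd (f i))"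
  have "(\<Sum>i\<in>{1..n}. fst (?g i) + snd (?g i) - (m + t)) = (\<Sum>i\<in>{1..n}. fst (f i) + snd (f i) - m)"
    by (rule sum.cong) auto
  then have "(\<Sum>i\<in>{1..Suc n}. fst (?g i) + snd (?g i) - (m + t)) =
      a + b + (\<Sum>i\<in>{1..n}. fst (f i) + snd (f i) - m)"
    unfolding at by (subst sum.insert) auto
  then show ?thesis unfolding x push_def cover_weight_def step_weight_def split by simp
qed

lemma weight_series_chain:
  "(1 - fps_X) ^ (2 * n + 1) * weight_series (cover_weight n) (cover_pairs n (chain_rel n)) = (1 + fps_X) ^ n
    \<and> finite_fibres (cover_weight n) (cover_pairs n (chain_rel n))"
proof (induction n)
  case 0
  have r: "chain_rel 0 = {}" by (auto simp: chain_rel_def)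
  \<comment> \<open>For the empty chain only \<open>k\<close> is free, with series 1/(1 -
    z).\<close>
  have "bij_betw (\<lambda>k. ((\<lambda>_. undefined), k)) UNIV (cover_pairs 0 (chain_rel 0))"
    unfolding cover_pairs_def r by (auto simp: bij_betw_def inj_on_def)
  from weight_series_bij[OF this, of "cover_weight 0" "\<lambda>x. x"] weight_series_nat show ?case
    by (simp add: cover_weight_def)
next
  case (Suc n)
  note b = weight_series_bij[OF bij_push[of n], where v = "cover_weight (Suc n)"
      and w = "\<lambda>(s, c). step_weight s + cover_weight n c", OF weight_push]
  note t = weight_series_times[OF weight_series_steps(2) conjunct2[OF Suc.IH]]
  have "(1 - fps_X) ^ (2 * Suc n + 1) * weight_series (cover_weight (Suc n)) (cover_pairs (Suc n) (chain_rel (Suc n))) =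
    ((1 - fps_X) ^ 2 * weight_series step_weight steps) *
    ((1 - fps_X) ^ (2 * n + 1) * weight_series (cover_weight n) (cover_pairs n (chain_rel n)))"
  proof -
    have "(1 - fps_X :: rat fps) ^ (2 * Suc n + 1) = (1 - fps_X) ^ 2 * (1 - fps_X) ^ (2 * n + 1)"
      by (simp flip: power_add)
    moreover have "weight_series (cover_weight (Suc n)) (cover_pairs (Suc n) (chain_rel (Suc n))) =
        weight_series step_weight steps * weight_series (cover_weight n) (cover_pairs n (chain_rel n))"
      using b(1) t(1) by simp
    ultimately show ?thesis by (simp only: mult_ac)
  qed
  also have "\<dots> = (1 + fps_X) ^ Suc n" using Suc.IH weight_series_steps(1) by simp
  finally show ?case using b(2) t(2) by simp
qed

section \<open>The series of an antichain\<close>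

definition power_series_of_powers :: "nat \<Rightarrow> rat fps" where
  "power_series_of_powers j = Abs_fps (\<lambda>k. of_nat k ^ j)"

text \<open>The numerators are the Eulerian polynomials, obtained by iterating \<open>z d/dz\<close>.\<close>

lemma eulerian:
  "\<exists>e. degree e \<le> j \<and> power_series_of_powers j * (1 - fps_X) ^ (j + 1) = fps_of_poly e"
proof (induction j)
  case 0
  have "power_series_of_powers 0 * (1 - fps_X) = 1"
    by (subst mult.commute, rule fps_ext)
      (simp only: one_minus_X_mult_nth, simp add: power_series_of_powers_def)
  then show ?case by (intro exI[of _ 1]) simp
next
  case (Suc j)
  then obtain e where e: "degree e \<le> j" "power_series_of_powers j * (1 - fps_X) ^ (j + 1) = fps_of_poly e"
    by blast
  define G where "G = power_series_of_powers j"
  have step: "power_series_of_powers (Suc j) = fps_X * fps_deriv G"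
  proof (rule fps_ext)
    fix k show "fps_nth (power_series_of_powers (Suc j)) k = fps_nth (fps_X * fps_deriv G) k"
      by (cases k) (simp_all add: G_def power_series_of_powers_def)
  qed
  \<comment> \<open>Applying z d/dz to e/(1 - z)^(j + 1) gives z ((1 - z) \<open>pderiv e\<close> +
    (j + 1) e)/(1 - z)^(j + 2).\<close>
  define e' where "e' = [:0, 1:] * ([:1, -1:] * pderiv e + smult (of_nat (j + 1)) e)"
  have u: "fps_of_poly [:1, -1:] = (1 - fps_X :: rat fps)"
    by (simp add: fps_of_poly_linear')
  have "fps_deriv (G * (1 - fps_X) ^ (j + 1)) = fps_of_poly (pderiv e)"
    unfolding G_def e(2) fps_of_poly_pderiv ..
  moreover have "fps_deriv ((1 - fps_X :: rat fps) ^ (j + 1)) = - (of_nat (j + 1) * (1 - fps_X) ^ j)"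
    unfolding fps_deriv_power' by (simp add: algebra_simps)
  ultimately have "fps_of_poly (pderiv e) =
      G * - (of_nat (j + 1) * (1 - fps_X) ^ j) + fps_deriv G * (1 - fps_X) ^ (j + 1)"
    by (metis fps_deriv_mult)
  then have d: "fps_of_poly (pderiv e) = fps_deriv G * (1 - fps_X) ^ (j + 1) - of_nat (j + 1) * (G * (1 - fps_X) ^ j)"
    by (simp add: algebra_simps)
  have "fps_of_poly e' = fps_X * ((1 - fps_X) * fps_of_poly (pderiv e) + of_nat (j + 1) * (G * (1 - fps_X) ^ (j + 1)))"
    unfolding e'_def fps_of_poly_mult fps_of_poly_add u fps_of_poly_smult e(2)[symmetric] G_def
    by (simp only: fps_of_poly_fps_X fps_of_nat)
  also have "\<dots> = fps_X * fps_deriv G * (1 - fps_X) ^ (Suc j + 1)"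
    unfolding d by (simp add: algebra_simps)
  finally have "power_series_of_powers (Suc j) * (1 - fps_X) ^ (Suc j + 1) = fps_of_poly e'"
    unfolding step by simp
  moreover have "degree e' \<le> Suc j"
  proof -
    have "degree ([:1, -1:] * pderiv e) \<le> j"
    proof (cases "pderiv e = 0")
      case False
      then have "degree e \<noteq> 0" by (simp add: pderiv_eq_0_iff)
      moreover have "degree ([:1, -1:] * pderiv e) \<le> degree [:1, -1::rat:] + degree (pderiv e)"
        by (rule degree_mult_le)
      ultimately show ?thesis using e(1) by (simp add: degree_pderiv)
    qed simp
    moreover have "degree (smult (of_nat (j + 1)) e) \<le> j" using e(1) degree_smult_le le_trans by blast
    ultimately have "degree ([:1, -1:] * pderiv e + smult (of_nat (j + 1)) e) \<le> j" by (rule degree_add_le)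
    then have "degree e' \<le> 1 + j"
      unfolding e'_def by (intro order_trans[OF degree_mult_le]) simp
    then show ?thesis by simp
  qed
  ultimately show ?case by blast
qed

definition antichain_rel :: "nat \<Rightarrow> nat rel" where
  "antichain_rel n = {(i, i) |i. i \<in> {1..n}}"

text \<open>There are \<open>k + d + 1\<close> pairs with sum \<open>k + d\<close>, which gives 1/(1
  - z)^2 + k/(1 - z). A numerator polynomial in \<open>k\<close> is what the later summation over
  \<open>k\<close> requires.\<close>

lemma weight_series_excess:
  defines "A k \<equiv> {(a::nat, b::nat). k \<le> a + b}"
  shows "(1 - fps_X) ^ 2 * weight_series (\<lambda>(a, b). a + b - k) (A k) = 1 + of_nat k * (1 - fps_X)"
    and "finite_fibres (\<lambda>(a, b). a + b - k) (A k)"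
proof -
  have eq: "{x \<in> A k. (\<lambda>(a, b). a + b - k) x = d} = (\<lambda>a. (a, k + d - a)) ` {0..k + d}" for d
    by (auto simp: A_def image_iff)
  show "finite_fibres (\<lambda>(a, b). a + b - k) (A k)" unfolding finite_fibres_def eq by simp
  have "card ((\<lambda>a. (a, k + d - a)) ` {0..k + d}) = k + d + 1" for d
    by (subst card_image) (auto simp: inj_on_def)
  then have s: "weight_series (\<lambda>(a, b). a + b - k) (A k) = Abs_fps (\<lambda>d. of_nat (k + d + 1))"
    unfolding weight_series_def eq by simp
  have "(1 - fps_X) * Abs_fps (\<lambda>d. of_nat (k + d + 1)) = Abs_fps (\<lambda>d. if d = 0 then of_nat (k + 1) else (1 :: rat))"
    by (rule fps_ext) (simp only: one_minus_X_mult_nth, auto simp: of_nat_diff)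
  moreover have "(1 - fps_X) * Abs_fps (\<lambda>d. if d = 0 then of_nat (k + 1) else (1 :: rat)) =
      1 + of_nat k * (1 - fps_X)"
    by (rule fps_ext) (simp only: one_minus_X_mult_nth, auto simp: fps_X_def simp flip: fps_of_nat)
  ultimately show "(1 - fps_X) ^ 2 * weight_series (\<lambda>(a, b). a + b - k) (A k) = 1 + of_nat k * (1 - fps_X)"
    unfolding s by (simp add: power2_eq_square mult.assoc)
qed

text \<open>For fixed \<open>k\<close> the \<open>n\<close> pairs contribute z^k (1 + k (1 -
  z))^n/(1 - z)^(2n). Expand in powers of \<open>k\<close> and sum over \<open>k\<close>: the factor
  (1 - z)^j at k^j cancels all but one power of the denominator (1 - z)^(j + 1) of the series of the
  k^j. So the numerator is a sum of Eulerian polynomials with binomial coefficients.\<close>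

lemma weight_series_antichain:
  "\<exists>h. degree h \<le> n \<and>
    (1 - fps_X) ^ (2 * n + 1) * weight_series (cover_weight n) (cover_pairs n (antichain_rel n)) = fps_of_poly h"
proof -
  define A where "A k = {(a::nat, b::nat). k \<le> a + b}" for k
  define g where "g k = weight_series (\<lambda>(a, b). a + b - k) (A k)" for k
  define W where "W = weight_series (cover_weight n) (cover_pairs n (antichain_rel n))"
  define Q where "Q = inverse ((1 - fps_X :: rat fps) ^ (2 * n))"
  \<comment> \<open>\<open>R j\<close> is (1 - z)^j/(1 - z)^(2n), the factor that accompanies
    k^j.\<close>
  define R where "R j = (1 - fps_X) ^ j * Q" for j
  have unit: "(1 - fps_X) ^ (2 * n) * Q = 1"
    unfolding Q_def by (rule inverse_mult_eq_1') simp
  have gR: "g k ^ n = (\<Sum>j\<le>n. of_nat (n choose j) * of_nat k ^ j * R j)" for k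
  proof -
    have "(1 - fps_X) ^ (2 * n) * g k ^ n = (1 + of_nat k * (1 - fps_X)) ^ n"
      using weight_series_excess(1)[of k] unfolding g_def A_def
      by (simp add: power_mult flip: power_mult_distrib)
    also have "\<dots> = (\<Sum>j\<le>n. of_nat (n choose j) * (of_nat k * (1 - fps_X)) ^ j)"
      by (subst add.commute, subst binomial_ring) simp
    finally have "Q * ((1 - fps_X) ^ (2 * n) * g k ^ n) = (\<Sum>j\<le>n. of_nat (n choose j) * of_nat k ^ j * R j)"
      by (simp add: R_def sum_distrib_left power_mult_distrib mult_ac)
    then show ?thesis using unit by (simp add: mult.assoc[symmetric] mult.commute[of Q])
  qed
  \<comment> \<open>The order \<open>k\<close> accounts for \<open>k\<close> of the degree
    \<open>d\<close>; the remaining \<open>d - k\<close> is the total excess.\<close>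
  have Wd: "fps_nth W d = (\<Sum>k\<in>{0..d}. fps_nth (g k ^ n) (d - k))" for d
  proof -
    let ?B = "\<lambda>k. {f \<in> {1..n} \<rightarrow>\<^sub>E A k. (\<Sum>i\<in>{1..n}. (\<lambda>(a, b). a + b - k) (f i)) = d - k}"
    have eq: "{s \<in> cover_pairs n (antichain_rel n). cover_weight n s = d} = (\<Union>k\<in>{0..d}. ?B k \<times> {k})"
      unfolding cover_pairs_def antichain_rel_def cover_weight_def A_def
    proof (intro equalityI subsetI)
      fix s assume s: "s \<in> {s \<in> {(f, k). f \<in> {1..n} \<rightarrow>\<^sub>E UNIV \<and>
          (\<forall>(i, j)\<in>{(i, i) |i. i \<in> {1..n}}. k \<le> fst (f i) + snd (f j))}.
          (case s of (f, k) \<Rightarrow> (\<Sum>i\<in>{1..n}. fst (f i) + snd (f i) - k) + k) = d}"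
      obtain f k where "s = (f, k)" by (cases s)
      then show "s \<in> (\<Union>k\<in>{0..d}. {f \<in> {1..n} \<rightarrow>\<^sub>E {(a, b). k \<le> a + b}.
          (\<Sum>i\<in>{1..n}. case f i of (a, b) \<Rightarrow> a + b - k) = d - k} \<times> {k})"
        using s by (auto simp: PiE_iff case_prod_beta)
    next
      fix s assume "s \<in> (\<Union>k\<in>{0..d}. {f \<in> {1..n} \<rightarrow>\<^sub>E {(a, b). k \<le> a + b}.
          (\<Sum>i\<in>{1..n}. case f i of (a, b) \<Rightarrow> a + b - k) = d - k} \<times> {k})"
      then show "s \<in> {s \<in> {(f, k). f \<in> {1..n} \<rightarrow>\<^sub>E UNIV \<and>
          (\<forall>(i, j)\<in>{(i, i) |i. i \<in> {1..n}}. k \<le> fst (f i) + snd (f j))}.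
          (case s of (f, k) \<Rightarrow> (\<Sum>i\<in>{1..n}. fst (f i) + snd (f i) - k) + k) = d}"
        by (auto simp: PiE_iff case_prod_beta)
    qed
    have fin: "finite (?B k)" and cB: "of_nat (card (?B k)) = fps_nth (g k ^ n) (d - k)" for k
    proof -
      note PiE = weight_series_PiE[OF weight_series_excess(2)[of k], of n, folded A_def, folded g_def]
      show "finite (?B k)" using PiE unfolding finite_fibres_def by blast
      have "fps_nth (weight_series (\<lambda>f. \<Sum>i\<in>{1..n}. (\<lambda>(a, b). a + b - k) (f i)) ({1..n} \<rightarrow>\<^sub>E A k)) (d - k) =
          of_nat (card (?B k))"
        unfolding weight_series_def by simp
      then show "of_nat (card (?B k)) = fps_nth (g k ^ n) (d - k)" using PiE by simp
    qed
    have "card {s \<in> cover_pairs n (antichain_rel n). cover_weight n s = d} = (\<Sum>k\<in>{0..d}. card (?B k \<times> {k}))"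
      unfolding eq using fin by (intro card_UN_disjoint) auto
    then have "fps_nth W d = (\<Sum>k\<in>{0..d}. of_nat (card (?B k)))"
      by (simp add: W_def weight_series_def card_cartesian_product)
    then show ?thesis by (simp only: cB)
  qed
  have W: "W = (\<Sum>j\<le>n. of_nat (n choose j) * (power_series_of_powers j * R j))"
  proof (rule fps_ext)
    fix d
    have "fps_nth W d = (\<Sum>k\<in>{0..d}. \<Sum>j\<le>n. of_nat (n choose j) * (of_nat k ^ j * fps_nth (R j) (d - k)))"
    proof -
      have "fps_nth (of_nat a * of_nat k ^ j * F) i = of_nat a * (of_nat k ^ j * fps_nth F i)"
        for a k j i and F :: "rat fps"
      proof -
        have "of_nat a * of_nat k ^ j = (fps_const (of_nat a * of_nat k ^ j) :: rat fps)"
          by (metis fps_of_nat of_nat_mult of_nat_power)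
        then show ?thesis by (simp add: mult.assoc)
      qed
      then show ?thesis unfolding Wd gR fps_sum_nth by simp
    qed
    also have "\<dots> = (\<Sum>j\<le>n. of_nat (n choose j) * (\<Sum>k\<in>{0..d}. of_nat k ^ j * fps_nth (R j) (d - k)))"
      by (subst sum.swap) (simp add: sum_distrib_left)
    also have "\<dots> = fps_nth (\<Sum>j\<le>n. of_nat (n choose j) * (power_series_of_powers j * R j)) d"
    proof -
      have "fps_nth (power_series_of_powers j * F) d = (\<Sum>k\<in>{0..d}. of_nat k ^ j * fps_nth F (d - k))"
        for j F by (simp add: fps_mult_nth power_series_of_powers_def)
      then show ?thesis by (simp add: fps_sum_nth flip: fps_of_nat)
    qed
    finally show "fps_nth W d = fps_nth (\<Sum>j\<le>n. of_nat (n choose j) * (power_series_of_powers j * R j)) d" .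
  qed
  obtain e where e: "\<And>j. degree (e j) \<le> j"
    "\<And>j. power_series_of_powers j * (1 - fps_X) ^ (j + 1) = fps_of_poly (e j)"
    using eulerian by metis
  define h where "h = (\<Sum>j\<le>n. smult (of_nat (n choose j)) (e j))"
  have "(1 - fps_X) ^ (2 * n + 1) * W =
      (\<Sum>j\<le>n. of_nat (n choose j) * (power_series_of_powers j * (1 - fps_X) ^ (j + 1))) * ((1 - fps_X) ^ (2 * n) * Q)"
    unfolding W R_def by (simp add: sum_distrib_left sum_distrib_right mult_ac)
  also have "\<dots> = fps_of_poly h"
    unfolding unit e(2) h_def fps_of_poly_sum fps_of_poly_smult by (simp add: fps_of_nat)
  finally have "(1 - fps_X) ^ (2 * n + 1) * W = fps_of_poly h" .
  moreover have "degree h \<le> n"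
    unfolding h_def
    by (rule degree_sum_le) (auto intro: order_trans[OF degree_smult_le] order_trans[OF e(1)])
  ultimately show ?thesis unfolding W_def by blast
qed

section \<open>Hilbert series of the graphs and their coefficient in degree one\<close>

lemma (in labelled_graph) vca_hilbert_series_eq:
  "vca_hilbert_series TYPE('k::field) n E = weight_series (cover_weight n) (cover_pairs n r)"
  by (rule fps_ext) (simp add: vca_hilbert_series_nth card_expos weight_series_def)

lemma (in bip_graph) labelled_graph_if_relabelling:
  assumes r: "naturally_labelled_poset n r" and eq: "equal_up_to_relabelling n E (poset_graph r)"
  obtains \<psi> where "labelled_graph n E r \<psi>"
proof -
  have po: "refl_on {1..n} r" "trans r" "r \<subseteq> {1..n} \<times> {1..n}"
    using r partial_order_onD unfolding naturally_labelled_poset_def by blast+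
  have "e \<subseteq> Vn n" if e: "e \<in> E" for e
  proof -
    obtain v w where "e = {v, w}" "v \<in> Xs" "w \<in> Ys" using edge_pair[OF e] .
    then show ?thesis unfolding Vn_eq by simp
  qed
  then obtain \<psi> where "bij_betw \<psi> (Vn n) (Vn n)" "E = (`) \<psi> ` poset_graph r"
    using equal_up_to_relabellingE[OF eq] by blast
  then have "labelled_graph n E r \<psi>"
    using po by unfold_locales (auto dest: refl_onD transD)
  then show thesis by (rule that)
qed

lemma fps_eq_divide_iff:
  fixes F N D :: "rat fps"
  assumes "fps_nth D 0 \<noteq> 0"
  shows "F = N / D \<longleftrightarrow> D * F = N"
proof -
  have 1: "D * inverse D = 1" using assms by (rule inverse_mult_eq_1')
  have 2: "N / D = N * inverse D" using assms by (rule fps_divide_unit)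
  have "D * (N * inverse D) = D * inverse D * N" "D * F * inverse D = D * inverse D * F"
    by (simp_all only: mult_ac)
  then have "D * (N * inverse D) = N" "D * F * inverse D = F" unfolding 1 by simp_all
  then show ?thesis unfolding 2 by metis
qed

lemma one_minus_X_power_nth_0 [simp]: "fps_nth ((1 - fps_X :: rat fps) ^ m) 0 \<noteq> 0"
  by simp

lemma (in bip_graph) vca_hilbert_series_chain:
  assumes "comes_from_chain n E"
  shows "vca_hilbert_series TYPE('k::field) n E = (1 + fps_X) ^ n / (1 - fps_X) ^ (2 * n + 1)"
proof -
  obtain r where r: "naturally_labelled_poset n r" "total_on {1..n} r"
    "equal_up_to_relabelling n E (poset_graph r)"
    using assms unfolding comes_from_chain_def by blast
  obtain \<psi> where "labelled_graph n E r \<psi>" using labelled_graph_if_relabelling[OF r(1,3)] .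
  then interpret labelled_graph n E r \<psi> .
  \<comment> \<open>A total order that respects the labels is the order of the labels.\<close>
  have "(i, j) \<in> r \<longleftrightarrow> (i, j) \<in> chain_rel n" for i j
  proof
    assume "(i, j) \<in> r"
    then show "(i, j) \<in> chain_rel n"
      using r(1) r_sub unfolding naturally_labelled_poset_def chain_rel_def by auto
  next
    assume ij: "(i, j) \<in> chain_rel n"
    then have "i \<in> {1..n}" "j \<in> {1..n}" "i \<le> j" unfolding chain_rel_def by auto
    moreover have "(j, i) \<notin> r" if "i \<noteq> j" "i \<le> j"
      using r(1) that unfolding naturally_labelled_poset_def by fastforce
    ultimately show "(i, j) \<in> r" using r(2) r_refl unfolding total_on_def by metis
  qed
  then have "r = chain_rel n" by auto
  then show ?thesis
    using weight_series_chain[of n] by (simp only: vca_hilbert_series_eq fps_eq_divide_iff[OF one_minus_X_power_nth_0])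
qed

text \<open>\<open>h\<close> is fixed before \<open>E\<close>: all graphs that come from an
  antichain with \<open>n\<close> elements share one numerator, so any of them can serve as the
  model.\<close>

lemma antichain_numerator:
  obtains h where "degree h \<le> n"
    and "\<And>E. \<lbrakk>bipartite_graph n E; comes_from_antichain n E\<rbrakk> \<Longrightarrow>
      vca_hilbert_series TYPE('k::field) n E = fps_of_poly h / (1 - fps_X) ^ (2 * n + 1)"
proof -
  obtain h where h: "degree h \<le> n" "(1 - fps_X) ^ (2 * n + 1) *
      weight_series (cover_weight n) (cover_pairs n (antichain_rel n)) = fps_of_poly h"
    using weight_series_antichain by blast
  show thesis
  proof (rule that[OF h(1)])
    fix E assume E: "bipartite_graph n E" "comes_from_antichain n E"
    interpret bip_graph n E by unfold_locales (rule E)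
    obtain r where r: "naturally_labelled_poset n r" "\<forall>i j. (i, j) \<in> r \<longrightarrow> i = j"
      "equal_up_to_relabelling n E (poset_graph r)"
      using E(2) unfolding comes_from_antichain_def by blast
    obtain \<psi> where "labelled_graph n E r \<psi>" using labelled_graph_if_relabelling[OF r(1,3)] .
    then interpret labelled_graph n E r \<psi> .
    have "r = antichain_rel n"
    proof (intro equalityI subsetI)
      fix x assume x: "x \<in> r"
      obtain i j where ij: "x = (i, j)" by (cases x)
      then have "j = i" "i \<in> {1..n}" using x r(2) r_sub by auto
      then show "x \<in> antichain_rel n" unfolding antichain_rel_def ij by blast
    qed (use r_refl in \<open>auto simp: antichain_rel_def\<close>)
    then show "vca_hilbert_series TYPE('k) n E = fps_of_poly h / (1 - fps_X) ^ (2 * n + 1)"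
      using h(2) by (simp only: vca_hilbert_series_eq fps_eq_divide_iff[OF one_minus_X_power_nth_0])
  qed
qed

text \<open>Choosing one end of each edge of a perfect matching gives a facet, and these choices
  already reach the upper bound.\<close>

lemma (in bip_graph) card_facets_antichain:
  assumes "comes_from_antichain n E"
  shows "card {F. facet F} = 2 ^ n"
proof (rule antisym[OF card_facets_le])
  obtain r where r: "naturally_labelled_poset n r" "\<forall>i j. (i, j) \<in> r \<longrightarrow> i = j"
    "equal_up_to_relabelling n E (poset_graph r)"
    using assms unfolding comes_from_antichain_def by blast
  obtain \<psi> where "labelled_graph n E r \<psi>" using labelled_graph_if_relabelling[OF r(1,3)] .
  then interpret labelled_graph n E r \<psi> .
  define F where "F T = p ` T \<union> q ` ({1..n} - T)" for T
  have edge: "e \<in> E \<longleftrightarrow> (\<exists>i\<in>{1..n}. e = {p i, q i})" for e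
    unfolding E_iff using r(2) r_sub r_refl by blast
  have p_mem: "p i \<in> F T \<longleftrightarrow> i \<in> T" and q_mem: "q i \<in> F T \<longleftrightarrow> i \<notin> T"
    if "T \<subseteq> {1..n}" "i \<in> {1..n}" for T i
    using that pq_eq unfolding F_def by (auto; blast)+
  have fac: "facet (F T)" if T: "T \<subseteq> {1..n}" for T
    unfolding facet_def indep_def
  proof (intro conjI ballI)
    show "F T \<subseteq> Vn n" using T unfolding F_def Vn_pq by blast
    show "{v, w} \<notin> E" if "v \<in> F T" "w \<in> F T" for v w
    proof
      assume "{v, w} \<in> E"
      then obtain i where i: "i \<in> {1..n}" "{v, w} = {p i, q i}" unfolding edge by blast
      then have "p i \<in> F T" "q i \<in> F T" using that by (auto simp: doubleton_eq_iff)
      then show False using p_mem[OF T i(1)] q_mem[OF T i(1)] by blast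
    qed
    fix v assume v: "v \<in> Vn n - F T"
    then obtain i where i: "i \<in> {1..n}" "v = p i \<or> v = q i" unfolding Vn_pq by blast
    have "{p i, q i} \<in> E" "{q i, p i} \<in> E" unfolding edge using i(1) by (auto simp: insert_commute)
    then show "\<exists>w\<in>F T. {v, w} \<in> E" using i v p_mem[OF T i(1)] q_mem[OF T i(1)] by blast
  qed
  have "inj_on F (Pow {1..n})"
  proof (rule inj_onI)
    fix T T' assume T: "T \<in> Pow {1..n}" "T' \<in> Pow {1..n}" "F T = F T'"
    then have "i \<in> T \<longleftrightarrow> i \<in> T'" if "i \<in> {1..n}" for i using p_mem[OF _ that] by auto
    then show "T = T'" using T by auto
  qed
  then have "card (F ` Pow {1..n}) = 2 ^ n" by (simp add: card_image card_Pow)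
  moreover have "card (F ` Pow {1..n}) \<le> card {F. facet F}"
    using fac finite_facets by (intro card_mono) auto
  ultimately show "2 ^ n \<le> card {F. facet F}" by simp
qed

lemma (in bip_graph) vca_hilbert_series_nth_1:
  "fps_nth (vca_hilbert_series TYPE('k::field) n E) 1 = of_nat (2 * n + card {F. facet F})"
  by (simp only: vca_hilbert_series_nth card_expos_one card_facets)

text \<open>The numerator contributes \<open>n\<close> and the denominator
  \<open>2 * n + 1\<close>.\<close>

lemma chain_series_nth_1:
  "fps_nth ((1 + fps_X) ^ n / (1 - fps_X) ^ (2 * n + 1) :: rat fps) 1 = of_nat (3 * n + 1)"
proof -
  let ?F = "(1 + fps_X) ^ n / (1 - fps_X) ^ (2 * n + 1) :: rat fps"
  have nth: "fps_nth ((1 + fps_X :: rat fps) ^ m) 0 = 1 \<and> fps_nth ((1 + fps_X :: rat fps) ^ m) 1 = of_nat m" for m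
    by (induction m) (simp_all add: fps_mult_nth_1 distrib_right)
  have nth': "fps_nth ((1 - fps_X :: rat fps) ^ m) 0 = 1 \<and> fps_nth ((1 - fps_X :: rat fps) ^ m) 1 = - of_nat m" for m
    by (induction m) (simp_all add: fps_mult_nth_1 left_diff_distrib)
  have F: "(1 - fps_X) ^ (2 * n + 1) * ?F = (1 + fps_X) ^ n"
    using fps_eq_divide_iff[OF one_minus_X_power_nth_0] by blast
  have 0: "fps_nth ?F 0 = 1"
    using arg_cong[OF F, of "\<lambda>F. fps_nth F 0"] nth[of n] nth'[of "2 * n + 1"] by (simp only: fps_mult_nth_0)
  have "fps_nth ((1 - fps_X) ^ (2 * n + 1)) 0 * fps_nth ?F 1 + fps_nth ((1 - fps_X) ^ (2 * n + 1)) 1 * fps_nth ?F 0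
      = fps_nth ((1 + fps_X :: rat fps) ^ n) 1"
    using arg_cong[OF F, of "\<lambda>F. fps_nth F 1"] by (simp only: fps_mult_nth_1)
  then have "fps_nth ?F 1 - of_nat (2 * n + 1) = of_nat n"
    unfolding 0 using nth[of n] nth'[of "2 * n + 1"] by simp
  then show ?thesis by simp
qed

theorem proposition3p11:
  fixes n :: nat and E :: "vertex set set"
  assumes "n \<ge> 1"
    and "bipartite_graph n E"
    and "no_isolated_vertices n E"
    and "cohen_macaulay_graph TYPE('k::field) n E"
  shows "(comes_from_chain n E \<longleftrightarrow>
            vca_hilbert_series TYPE('k) n E = (1 + fps_X) ^ n / (1 - fps_X) ^ (2 * n + 1)) \<and>
         (\<forall>E''. bipartite_graph n E'' \<and> comes_from_antichain n E'' \<longrightarrow>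
           (comes_from_antichain n E \<longleftrightarrow>
            vca_hilbert_series TYPE('k) n E =
              (\<Sum>i\<le>n. fps_const (vca_h_vector TYPE('k) n E'' i) * fps_X ^ i)
                / (1 - fps_X) ^ (2 * n + 1)))"
proof (intro conjI allI impI)
  interpret bip_graph n E by unfold_locales (rule assms(2))
  let ?chain = "(1 + fps_X) ^ n / (1 - fps_X) ^ (2 * n + 1) :: rat fps"
  show "comes_from_chain n E \<longleftrightarrow> vca_hilbert_series TYPE('k) n E = ?chain"
  proof
    assume H: "vca_hilbert_series TYPE('k) n E = ?chain"
    \<comment> \<open>Comparing the coefficients of z is enough to fix the number of facets.\<close>
    have "of_nat (2 * n + card {F. facet F}) = (of_nat (3 * n + 1) :: rat)"
      using vca_hilbert_series_nth_1[where 'k = 'k] unfolding H chain_series_nth_1 by (rule sym)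
    then have card: "card {F. facet F} = n + 1" by (simp only: of_nat_eq_iff)
    \<comment> \<open>The two sides have only the empty face in common, so the induction on common
      faces starts there.\<close>
    have "adjacent\<^sup>*\<^sup>* Xs Ys"
    proof (rule facets_connected[where A = "{}"])
      show "card B = 1 \<and> card C = 1"
        if "indep A" "Z = {z \<in> Vn n. \<exists>a\<in>A. {a, z} \<in> E}" "B = Xs - A - Z" "C = Ys - A - Z"
          "B \<noteq> {}" "C \<noteq> {}" "\<And>b c. \<lbrakk>b \<in> B; c \<in> C\<rbrakk> \<Longrightarrow> {b, c} \<in> E" for A Z B C
        by (rule link_if_cohen_macaulay[OF assms(4) that])
      show "facet Xs" "facet Ys" by (rule facet_Xs_Ys[OF assms(3)])+
    qed (auto simp: indep_def)
    then show "comes_from_chain n E" using chain_if_card_facets[OF assms(3)] card by blast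
  qed (rule vca_hilbert_series_chain)
  fix E'' assume E'': "bipartite_graph n E'' \<and> comes_from_antichain n E''"
  interpret E'': bip_graph n E'' by unfold_locales (use E'' in blast)
  obtain h where h: "degree h \<le> n" "\<And>E. \<lbrakk>bipartite_graph n E; comes_from_antichain n E\<rbrakk> \<Longrightarrow>
      vca_hilbert_series TYPE('k) n E = fps_of_poly h / (1 - fps_X) ^ (2 * n + 1)"
    using antichain_numerator by blast
  have H'': "vca_hilbert_series TYPE('k) n E'' = fps_of_poly h / (1 - fps_X) ^ (2 * n + 1)"
    using h(2) E'' by blast
  have "(THE h'. vca_hilbert_series TYPE('k) n E'' = fps_of_poly h' / (1 - fps_X) ^ (2 * n + 1)) = h"
  proof (rule the_equality)
    show "vca_hilbert_series TYPE('k) n E'' = fps_of_poly h / (1 - fps_X) ^ (2 * n + 1)" by (rule H'')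
    fix h' assume "vca_hilbert_series TYPE('k) n E'' = fps_of_poly h' / (1 - fps_X) ^ (2 * n + 1)"
    then have "fps_of_poly h' = fps_of_poly h"
      using H'' by (metis fps_eq_divide_iff one_minus_X_power_nth_0)
    then show "h' = h" by (simp add: fps_of_poly_eq_iff)
  qed
  then have hv: "vca_h_vector TYPE('k) n E'' = Polynomial.coeff h" by (simp add: vca_h_vector_def)
  \<comment> \<open>The bound \<open>degree h \<le> n\<close> ensures that cutting the sum at
    \<open>n\<close> loses no coefficient.\<close>
  have "(\<Sum>i\<le>n. fps_const (Polynomial.coeff h i) * fps_X ^ i) = fps_of_poly h"
  proof (rule fps_ext)
    fix d
    have "Polynomial.coeff h d = 0" if "\<not> d \<le> n" using h(1) that by (intro coeff_eq_0) simp
    then show "fps_nth (\<Sum>i\<le>n. fps_const (Polynomial.coeff h i) * fps_X ^ i) d = fps_nth (fps_of_poly h) d"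
      by (simp add: fps_sum_nth if_distrib cong: if_cong)
  qed
  \<comment> \<open>The right-hand side is the series of \<open>E''\<close>, so the two graphs can
    be compared directly, in particular in their numbers of facets.\<close>
  then have rhs: "(\<Sum>i\<le>n. fps_const (vca_h_vector TYPE('k) n E'' i) * fps_X ^ i) / (1 - fps_X) ^ (2 * n + 1) =
      vca_hilbert_series TYPE('k) n E''"
    unfolding hv H'' by simp
  show "comes_from_antichain n E \<longleftrightarrow> vca_hilbert_series TYPE('k) n E =
      (\<Sum>i\<le>n. fps_const (vca_h_vector TYPE('k) n E'' i) * fps_X ^ i) / (1 - fps_X) ^ (2 * n + 1)"
    unfolding rhs
  proof
    assume "comes_from_antichain n E"
    then show "vca_hilbert_series TYPE('k) n E = vca_hilbert_series TYPE('k) n E''"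
      using h(2) assms(2) H'' by simp
  next
    assume "vca_hilbert_series TYPE('k) n E = vca_hilbert_series TYPE('k) n E''"
    then have "of_nat (2 * n + card {F. facet F}) = (of_nat (2 * n + card {F. E''.facet F}) :: rat)"
      using vca_hilbert_series_nth_1[where 'k = 'k] E''.vca_hilbert_series_nth_1[where 'k = 'k] by simp
    then have "card {F. facet F} = 2 ^ n"
      using E''.card_facets_antichain E'' by (simp only: of_nat_eq_iff)
    then show "comes_from_antichain n E" by (rule antichain_if_card_facets)
  qed
qed

end
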